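(* Let $g(t)=A(t)f^1\otimes f^1+B(t)f^2\otimes f^2+C(t)f^3\otimes f^3$ be the solution of the positive cross curvature flow on $\mathrm{SL}(2,\mathbb R)$ with given initial data $A_0,B_0,C_0>0$, $B_0\ge C_0$. Then there exists a finite positive time $T_b$ such that the (maximal) solution $g(t)$ exists for all $t\in[0,T_b)$. Moreover: 1. If there is a time $t$ such that $A\ge B-C$, then there are constants $\eta_i\in(0,\infty)$ such that, as $t\to T_b$, $$A\sim\eta_1(T_b-t)^{-1/14},\quad B\sim\eta_2(T_b-t)^{3/14},\quad C\sim\eta_3(T_b-t)^{3/14}.$$ 2. If there is a time $t$ such that $A<\frac13\left(2\sqrt{B^2-BC+C^2}-B-C\right)$, then there are constants $\eta_i\in(0,\infty)$ such that, as $t\to T_b$, $$A\sim\eta_1(T_b-t)^{3/14},\quad B\sim\eta_2(T_b-t)^{-1/14},\quad C\sim\eta_3(T_b-t)^{3/14}.$$ 3. If for all $t\in[0,T_b)$, $\frac13\left(2\sqrt{B^2-BC+C^2}-B-C\right)\le A<B-C$, then, as $t\to T_b$, $$A\sim\frac{64}{C(T_b)}(T_b-t),\quad B-C(T_b)\sim4\sqrt{2(T_b-t)},\quad C-C(T_b)\sim-4\sqrt{2(T_b-t)},$$ where $C(T_b)=\lim_{t\to T_b}C(t)\in(0,\infty)$.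
   Context: $(f_i)$ is a left-invariant frame on $\mathrm{SL}(2,\mathbb R)$ with $[f_2,f_3]=-2f_1$, $[f_3,f_1]=2f_2$, $[f_1,f_2]=2f_3$; $(f^i)$ is the dual frame. The positive cross curvature flow is $\partial_tg=2h$, where $h$ is the cross curvature tensor (diagonal in an orthonormal frame diagonalizing Ricci, with $h_{ii}=k_jk_l$, $k_i$ being the sectional curvature of the plane orthogonal to the $i$-th vector). It is equivalent to the ODE system, for positive functions $A,B,C$ with $(A,B,C)(0)=(A_0,B_0,C_0)$, $$\frac{dA}{dt}=\frac{2AF_2F_3}{(ABC)^2},\quad\frac{dB}{dt}=\frac{2BF_3F_1}{(ABC)^2},\quad\frac{dC}{dt}=\frac{2CF_1F_2}{(ABC)^2},$$ $$F_1=-3A^2+B^2+C^2-2BC-2AC-2AB,$$ $$F_2=-3B^2+A^2+C^2+2BC+2AC-2AB,$$ $$F_3=-3C^2+A^2+B^2+2BC-2AC+2AB.$$ The notation $u\sim v$ means $u/v\to1$. *)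

theory Defs
  imports "HOL-Analysis.Analysis" "HOL-Library.Landau_Symbols"
begin

text \<open>
  Left-invariant vector fields on \<open>SL(2,\<real>)\<close> have the form \<open>p \<mapsto> p ** X\<close> with \<open>X\<close> in the tangent
  space at the identity, i.e. \<open>X\<close> traceless, and the Lie bracket of two such fields is the field of
  the commutator. A left-invariant 2-tensor is constant on left-invariant fields, so it is represented
  by its values on \<open>sl2\<close>. All forms below are functions on all 2 by 2 matrices, but only their
  restrictions to \<open>sl2\<close> matter.
\<close>

type_synonym mat2 = "real ^ 2 ^ 2"
type_synonym form2 = "mat2 \<Rightarrow> mat2 \<Rightarrow> real"

definition sl2 :: "mat2 set" where
  "sl2 = {X. trace X = 0}"

definition lie_bracket :: "mat2 \<Rightarrow> mat2 \<Rightarrow> mat2" where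
  "lie_bracket X Y = X ** Y - Y ** X"

definition sl2_frame :: "(3 \<Rightarrow> mat2) \<Rightarrow> bool" where
  "sl2_frame f \<longleftrightarrow>
     inj f \<and> independent (range f) \<and> span (range f) = sl2 \<and>
     lie_bracket (f 2) (f 3) = (-2) *\<^sub>R f 1 \<and>
     lie_bracket (f 3) (f 1) = 2 *\<^sub>R f 2 \<and>
     lie_bracket (f 1) (f 2) = 2 *\<^sub>R f 3"

definition dual_frame :: "(3 \<Rightarrow> mat2) \<Rightarrow> 3 \<Rightarrow> mat2 \<Rightarrow> real" where
  "dual_frame f i X = representation (range f) X (f i)"

definition diag_metric :: "(3 \<Rightarrow> mat2) \<Rightarrow> real \<Rightarrow> real \<Rightarrow> real \<Rightarrow> form2" where
  "diag_metric f a b c X Y =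
     a * (dual_frame f 1 X * dual_frame f 1 Y)
   + b * (dual_frame f 2 X * dual_frame f 2 Y)
   + c * (dual_frame f 3 X * dual_frame f 3 Y)"

text \<open>Koszul's formula; for left-invariant fields the terms that differentiate \<open>g\<close> vanish.\<close>

definition levi_civita :: "form2 \<Rightarrow> mat2 \<Rightarrow> mat2 \<Rightarrow> mat2" where
  "levi_civita g X Y = (THE Z. Z \<in> sl2 \<and> (\<forall>W\<in>sl2.
     2 * g Z W = g (lie_bracket X Y) W - g (lie_bracket Y W) X + g (lie_bracket W X) Y))"

definition riemann :: "form2 \<Rightarrow> mat2 \<Rightarrow> mat2 \<Rightarrow> mat2 \<Rightarrow> mat2" where
  "riemann g X Y Z =
     levi_civita g X (levi_civita g Y Z) - levi_civita g Y (levi_civita g X Z)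
     - levi_civita g (lie_bracket X Y) Z"

definition sectional_curvature :: "form2 \<Rightarrow> mat2 \<Rightarrow> mat2 \<Rightarrow> real" where
  "sectional_curvature g X Y = g (riemann g X Y Y) X / (g X X * g Y Y - (g X Y)\<^sup>2)"

definition orthonormal_frame :: "form2 \<Rightarrow> (3 \<Rightarrow> mat2) \<Rightarrow> bool" where
  "orthonormal_frame g e \<longleftrightarrow>
     (\<forall>i. e i \<in> sl2) \<and> (\<forall>i j. g (e i) (e j) = (if i = j then 1 else 0))"

text \<open>
  The Ricci tensor is the trace of \<open>Z \<mapsto> R(Z,X)Y\<close>, computed in an orthonormal frame \<open>e\<close>; its value
  does not depend on the choice of \<open>e\<close>.
\<close>

definition ricci :: "form2 \<Rightarrow> (3 \<Rightarrow> mat2) \<Rightarrow> form2" where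
  "ricci g e X Y = (\<Sum>i\<in>UNIV. g (riemann g (e i) X Y) (e i))"

text \<open>
  \<open>k i\<close> is the sectional curvature of the plane orthogonal to \<open>e i\<close>. Since \<open>h\<close> is bilinear, its
  values on the frame determine it on \<open>sl2\<close>. The result does not depend on the frame:
  in dimension three, Ricci eigenvectors with equal eigenvalues have equal \<open>k\<close>.
\<close>

definition is_cross_curvature :: "form2 \<Rightarrow> form2 \<Rightarrow> bool" where
  "is_cross_curvature g h \<longleftrightarrow> bilinear h \<and>
     (\<exists>e k. orthonormal_frame g e \<and>
        (\<forall>i j. i \<noteq> j \<longrightarrow> ricci g e (e i) (e j) = 0) \<and>
        (\<forall>i j l. distinct [i, j, l] \<longrightarrow> k i = sectional_curvature g (e j) (e l)) \<and>
        (\<forall>i j. i \<noteq> j \<longrightarrow> h (e i) (e j) = 0) \<and>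
        (\<forall>i j l. distinct [i, j, l] \<longrightarrow> h (e i) (e i) = k j * k l))"

text \<open>
  \<open>\<partial>\<^sub>t g = 2 h\<close> on \<open>[0, T)\<close>, for \<open>g(t) = A(t) f\<^sup>1\<otimes>f\<^sup>1 + B(t) f\<^sup>2\<otimes>f\<^sup>2 + C(t) f\<^sup>3\<otimes>f\<^sup>3\<close>; the derivative
  at \<open>0\<close> is one-sided.
\<close>

definition positive_xcf ::
  "(3 \<Rightarrow> mat2) \<Rightarrow> (real \<Rightarrow> real) \<Rightarrow> (real \<Rightarrow> real) \<Rightarrow> (real \<Rightarrow> real) \<Rightarrow> real \<Rightarrow> bool" where
  "positive_xcf f A B C T \<longleftrightarrow> (\<forall>t\<in>{0..<T}.
     A t > 0 \<and> B t > 0 \<and> C t > 0 \<and>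
     (\<exists>h. is_cross_curvature (diag_metric f (A t) (B t) (C t)) h \<and>
        (\<forall>X\<in>sl2. \<forall>Y\<in>sl2.
           ((\<lambda>s. diag_metric f (A s) (B s) (C s) X Y) has_real_derivative 2 * h X Y)
             (at t within {0..<T}))))"

text \<open>
  The unique maximal solution with the given initial data. Since \<open>T'\<close> ranges over all reals,
  this also excludes solutions on \<open>[0, \<infinity>)\<close>.
\<close>

definition maximal_positive_xcf ::
  "(3 \<Rightarrow> mat2) \<Rightarrow> real \<Rightarrow> real \<Rightarrow> real \<Rightarrow>
   (real \<Rightarrow> real) \<Rightarrow> (real \<Rightarrow> real) \<Rightarrow> (real \<Rightarrow> real) \<Rightarrow> real \<Rightarrow> bool" where
  "maximal_positive_xcf f A0 B0 C0 A B C T \<longleftrightarrow>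
     0 < T \<and> positive_xcf f A B C T \<and> A 0 = A0 \<and> B 0 = B0 \<and> C 0 = C0 \<and>
     (\<forall>A' B' C' T'. positive_xcf f A' B' C' T' \<and> A' 0 = A0 \<and> B' 0 = B0 \<and> C' 0 = C0 \<longrightarrow>
        T' \<le> T \<and> (\<forall>t\<in>{0..<T'}. A' t = A t \<and> B' t = B t \<and> C' t = C t))"

unbundle asymp_equiv_syntax

end

theory Submission
  imports Defs "HOL-Analysis.Cross3"
begin

text \<open>
  Write \<open>E = B - C\<close>. The condition \<open>B \<ge> C\<close> is preserved and makes \<open>F\<^sub>3 > 0\<close>; the conditions \<open>A \<ge> E\<close> and \<open>F\<^sub>1 > 0\<close>
  are each preserved forward in time, because \<open>A - E\<close> and \<open>F\<^sub>1\<close> satisfy scalar equations \<open>y' = k y + r\<close> with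
  \<open>r > 0\<close>. The second condition of the theorem is exactly \<open>F\<^sub>1 > 0\<close>.

  If \<open>A \<ge> E\<close> at some time, then \<open>A / B\<close> and \<open>C / B\<close> increase and \<open>A / B\<close> blows up in finite time. If \<open>F\<^sub>1 > 0\<close>
  at some time, then \<open>A / B\<close> and \<open>C / B\<close> decrease to zero in finite time. In both cases one coefficient \<open>X\<close>
  dominates the other two, \<open>Y X\<^sup>3\<close> and \<open>Z X\<^sup>3\<close> converge, and the equation for \<open>X\<close> integrates to
  \<open>X \<sim> \<eta> (T - t) powr (-1/14)\<close>.

  Otherwise \<open>B\<close>, \<open>C\<close> stay in a compact set and \<open>A \<rightarrow> 0\<close>. With \<open>S = B + C\<close> and \<open>w = E\<^sup>2 / A\<close> one has
  \<open>w' = w / (A (B C)\<^sup>2) (16 S\<^sup>2 (w - S) + O(A))\<close>: the value \<open>w = lim S\<close> is unstable, and leaving it would violate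
  \<open>0 < w \<le> 2 S + 3 A\<close>. So \<open>w\<close> converges to \<open>lim S\<close>, and this fixes the slope of \<open>A\<close> and of \<open>E\<^sup>2\<close>.
\<close>

section \<open>Maximal solutions of autonomous equations\<close>

text \<open>The exponents come from homogeneity. When \<open>X\<close> dominates, its own factor is
  close to \<open>- 3 * X^2\<close> and the other two are close to \<open>X^2\<close>, so
  \<open>ln Y\<close> and \<open>ln Z\<close> fall three times as fast as \<open>ln X\<close> grows.
  With \<open>Y * X^3\<close> and \<open>Z * X^3\<close> convergent, \<open>X'\<close> is asymptotic
  to a constant times \<open>X^15\<close>, which gives the powers -1/14 and 3/14.

  The main obstacle: maximality only says that the solution leaves every compact subset of the open
  octant, not which coefficient degenerates. Each regime therefore shows that all three coefficients
  would be trapped if the decisive ratio, or \<open>A\<close> itself, stayed away from zero. This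
  alternative speaks of a finite interval only, so finiteness must be obtained before it is used,
  from a nonnegative quantity that decreases at a definite rate.

  In the third regime the equation for \<open>w\<close> is singular as \<open>A\<close> tends to 0
  and time is a poor parameter. Both \<open>w\<close> and \<open>ln A\<close> are driven by the same
  positive factor, so \<open>w\<close> is measured against \<open>ln A\<close> instead.\<close>

lemma mono_if_deriv_nonneg:
  fixes f :: "real \<Rightarrow> real"
  assumes "a \<le> b"
    and deriv: "\<And>t. t \<in> {a..b} \<Longrightarrow> (f has_real_derivative f' t) (at t within {a..b})"
    and "\<And>t. t \<in> {a..b} \<Longrightarrow> 0 \<le> f' t"
  shows "f a \<le> f b"
proof -
  obtain x where "x \<in> {a..b}" "f b - f a = f' x * (b - a)"
    using mvt_very_simple[OF \<open>a \<le> b\<close>, of f "\<lambda>x h. f' x * h"] deriv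
    by (auto simp: has_field_derivative_def)
  moreover from this have "0 \<le> f' x * (b - a)" using assms by simp
  ultimately show ?thesis by simp
qed

text \<open>Variation of constants with the integral replaced by one intermediate value: the mean
  value theorem is applied to \<open>y\<close> times the integrating factor
  \<open>exp (- K t)\<close>. The positivity of the weights \<open>p\<close> and \<open>q\<close> is
  all that the sign arguments below use.\<close>

lemma linear_ode_variation:
  fixes y k r :: "real \<Rightarrow> real"
  assumes "a < b" and "continuous_on {a..b} k"
    and deriv: "\<And>t. t \<in> {a..b} \<Longrightarrow> (y has_real_derivative k t * y t + r t) (at t within {a..b})"
  obtains x p q where "x \<in> {a..b}" "p > 0" "q > 0" "y b = p * y a + q * r x"
proof -
  define K where "K t = integral {a..t} k" for t
  have K: "(K has_real_derivative k t) (at t within {a..b})" if "t \<in> {a..b}" for t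
    unfolding K_def using integral_has_real_derivative[OF assms(2) that] .
  define z where "z t = y t * exp (- K t)" for t
  have z: "(z has_real_derivative r t * exp (- K t)) (at t within {a..b})" if "t \<in> {a..b}" for t
    unfolding z_def using that
    by (auto intro!: derivative_eq_intros deriv K simp: algebra_simps)
  have "\<exists>x\<in>{a<..<b}. z b - z a = r x * exp (- K x) * (b - a)"
    using mvt_simple[OF \<open>a < b\<close>, of z "\<lambda>x h. r x * exp (- K x) * h"] z
    by (auto simp: has_field_derivative_def)
  then obtain x where x: "x \<in> {a<..<b}" "z b = z a + r x * exp (- K x) * (b - a)"
    by (auto simp: algebra_simps)
  have "y b = exp (K b) * z b"
    by (simp add: z_def flip: exp_add)
  also have "\<dots> = (exp (K b) * exp (- K a)) * y a + (exp (K b) * exp (- K x) * (b - a)) * r x"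
    unfolding x(2) by (simp add: z_def algebra_simps)
  finally show ?thesis
    using that[of x "exp (K b) * exp (- K a)" "exp (K b) * exp (- K x) * (b - a)"] x \<open>a < b\<close>
    by (auto simp: algebra_simps)
qed

lemma linear_ode_nonneg:
  fixes y k r :: "real \<Rightarrow> real"
  assumes "a \<le> b" and "continuous_on {a..b} k"
    and "\<And>t. t \<in> {a..b} \<Longrightarrow> (y has_real_derivative k t * y t + r t) (at t within {a..b})"
    and "\<And>t. t \<in> {a..b} \<Longrightarrow> 0 \<le> r t" and "0 \<le> y a"
  shows "0 \<le> y b"
proof (cases "a = b")
  case False
  with assms(1) have "a < b" by simp
  from this assms(2,3) obtain x p q where "x \<in> {a..b}" "p > 0" "q > 0" "y b = p * y a + q * r x"
    by (rule linear_ode_variation)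
  with assms show ?thesis by simp
qed (use assms in simp)

text \<open>The initial value may be zero: a positive forcing term lifts \<open>y\<close> off zero
  at once. This turns the weak inequality of the first regime into a strict one.\<close>

lemma linear_ode_pos:
  fixes y k r :: "real \<Rightarrow> real"
  assumes "a < b" and "continuous_on {a..b} k"
    and "\<And>t. t \<in> {a..b} \<Longrightarrow> (y has_real_derivative k t * y t + r t) (at t within {a..b})"
    and "\<And>t. t \<in> {a..b} \<Longrightarrow> 0 < r t" and "0 \<le> y a"
  shows "0 < y b"
proof -
  from assms(1,2,3) obtain x p q where "x \<in> {a..b}" "p > 0" "q > 0" "y b = p * y a + q * r x"
    by (rule linear_ode_variation)
  with assms show ?thesis by (simp add: add_nonneg_pos)
qed

text \<open>Gronwall's argument: on the compact interval up to \<open>t\<close> both paths stay in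
  one ball, and with the Lipschitz constant \<open>L\<close> of that ball the squared distance times
  \<open>exp (- (2 * L) * s)\<close> is nonincreasing.\<close>

lemma ode_unique:
  fixes G :: "'a::euclidean_space \<Rightarrow> 'a"
  assumes lip: "\<And>R. \<exists>L. L-lipschitz_on (cball 0 R) G"
    and x: "\<And>t. t \<in> {0..<T} \<Longrightarrow> (x has_vector_derivative G (x t)) (at t within {0..<T})"
    and y: "\<And>t. t \<in> {0..<T} \<Longrightarrow> (y has_vector_derivative G (y t)) (at t within {0..<T})"
    and "x 0 = y 0" and t: "t \<in> {0..<T}"
  shows "x t = y t"
proof -
  have sub: "{0..t} \<subseteq> {0..<T}" using t by auto
  have cont: "continuous_on {0..t} x" "continuous_on {0..t} y"
    using sub unfolding continuous_on_eq_continuous_within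
    by (auto intro!: has_vector_derivative_continuous[OF has_vector_derivative_within_subset[OF x sub]]
        has_vector_derivative_continuous[OF has_vector_derivative_within_subset[OF y sub]])
  have "bounded (x ` {0..t} \<union> y ` {0..t})"
    using cont by (auto intro!: compact_imp_bounded compact_continuous_image)
  then obtain R where R: "x ` {0..t} \<union> y ` {0..t} \<subseteq> cball 0 R"
    unfolding bounded_iff by (auto simp: subset_iff)
  obtain L where L: "L-lipschitz_on (cball 0 R) G" using lip by blast
  define e where "e s = (x s - y s) \<bullet> (x s - y s) * exp (- (2 * L) * s)" for s
  define e' where "e' s = (2 * ((x s - y s) \<bullet> (G (x s) - G (y s))) - 2 * L * ((x s - y s) \<bullet> (x s - y s)))
     * exp (- (2 * L) * s)" for s
  have alg: "p * q + q * - (2 * L) * n = (p - 2 * L * n) * q" for p q n :: real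
    by (simp add: algebra_simps)
  have "- e 0 \<le> - e t"
  proof (rule mono_if_deriv_nonneg[where f = "\<lambda>s. - e s" and f' = "\<lambda>s. - e' s"])
    fix s assume s: "s \<in> {0..t}"
    have d: "((\<lambda>s. x s - y s) has_vector_derivative (G (x s) - G (y s))) (at s within {0..t})"
      using s sub by (intro has_vector_derivative_diff has_vector_derivative_within_subset[OF x sub]
          has_vector_derivative_within_subset[OF y sub]) auto
    have "((\<lambda>s. (x s - y s) \<bullet> (x s - y s)) has_real_derivative 
       2 * ((x s - y s) \<bullet> (G (x s) - G (y s)))) (at s within {0..t})"
      using has_derivative_inner[OF d[unfolded has_vector_derivative_def] d[unfolded has_vector_derivative_def]]
      unfolding has_field_derivative_def
      by (rule has_derivative_eq_rhs) (auto simp: fun_eq_iff inner_commute algebra_simps)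
    moreover have "((\<lambda>s. exp (- (2 * L) * s)) has_real_derivative exp (- (2 * L) * s) * (- (2 * L)))
       (at s within {0..t})"
      by (auto intro!: derivative_eq_intros)
    ultimately have "(e has_real_derivative e' s) (at s within {0..t})"
      unfolding e_def e'_def by (rule DERIV_mult[THEN DERIV_cong]) (rule alg)
    then show "((\<lambda>s. - e s) has_real_derivative - e' s) (at s within {0..t})"
      by (rule DERIV_minus)
    have "norm (G (x s) - G (y s)) \<le> L * norm (x s - y s)"
      using lipschitz_onD[OF L, of "x s" "y s"] R s unfolding dist_norm by blast
    then have "(x s - y s) \<bullet> (G (x s) - G (y s)) \<le> norm (x s - y s) * (L * norm (x s - y s))"
      by (meson norm_cauchy_schwarz norm_ge_zero mult_left_mono order_trans)
    also have "\<dots> = L * ((x s - y s) \<bullet> (x s - y s))"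
      by (simp add: dot_square_norm power2_eq_square)
    finally show "0 \<le> - e' s" by (simp add: e'_def mult_le_0_iff)
  qed (use t in auto)
  then have "e t \<le> 0" by (simp add: e_def \<open>x 0 = y 0\<close>)
  then have "(x t - y t) \<bullet> (x t - y t) \<le> 0"
    by (simp add: e_def mult_le_0_iff)
  then show ?thesis using inner_gt_zero_iff[of "x t - y t"] by (metis leD right_minus_eq)
qed

lemma indefinite_integral_has_vector_derivative:
  fixes f :: "real \<Rightarrow> 'a::banach"
  assumes "continuous_on {0..} f" "t \<ge> 0"
  shows "((\<lambda>t. integral {0..t} f) has_vector_derivative f t) (at t within {0..})"
proof -
  have "((\<lambda>t. integral {0..t} f) has_vector_derivative f t) (at t within {0..t+1})"
    by (rule integral_has_vector_derivative) (use assms in \<open>auto intro: continuous_on_subset\<close>)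
  moreover have "at t within {0..t+1} = at t within {0..}"
    by (rule at_within_nhd[of _ "{..<t+1}"]) auto
  ultimately show ?thesis by simp
qed

text \<open>Banach's fixed point theorem for the rescaled path \<open>u t = exp (- \<lambda> t) x t\<close>, whose sup norm
  makes the integral operator a contraction on the whole half line.\<close>

lemma picard_global:
  fixes G :: "'a::euclidean_space \<Rightarrow> 'a"
  assumes lip: "L-lipschitz_on UNIV G" and bdd: "\<And>x. norm (G x) \<le> M"
  obtains x where "x 0 = x0" "\<And>t. t \<ge> 0 \<Longrightarrow> (x has_vector_derivative G (x t)) (at t within {0..})"
proof -
  have "L \<ge> 0" using lip lipschitz_on_nonneg by blast
  \<comment> \<open>Any weight larger than \<open>L\<close> would give a contraction; the summand 1
    keeps \<open>l\<close> positive when \<open>L\<close> is 0.\<close>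
  define l where "l = 2 * L + 1"
  have "l > 0" using \<open>L \<ge> 0\<close> by (simp add: l_def)
  have "M \<ge> 0" using bdd norm_ge_zero order_trans by blast
  have contG: "continuous_on UNIV G" using lip lipschitz_on_continuous_on by blast
  define H where "H u s = G (exp (l * s) *\<^sub>R apply_bcontfun u s)" for u :: "real \<Rightarrow>\<^sub>C 'a" and s
  have contH: "continuous_on S (H u)" for u S
    unfolding H_def by (intro continuous_on_compose2[OF contG] continuous_intros) auto
  \<comment> \<open>Bounded continuous functions live on the whole real line, hence
    \<open>max 0 t\<close>: it extends the path by the constant \<open>x0\<close> to negative
    times.\<close>
  define P where "P u t = exp (- l * max 0 t) *\<^sub>R (x0 + integral {0..max 0 t} (H u))" for u t
  have contI: "continuous_on {0..} (\<lambda>t. integral {0..t} (H u))" for u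
    unfolding continuous_on_eq_continuous_within
    using indefinite_integral_has_vector_derivative[OF contH] has_vector_derivative_continuous
    by fastforce
  have "P u \<in> bcontfun" for u
  proof -
    have "continuous_on UNIV (P u)"
      unfolding P_def by (intro continuous_intros continuous_on_compose2[OF contI]) auto
    moreover have "norm (P u t) \<le> norm x0 + M / l" for t
    proof -
      define \<tau> where "\<tau> = max 0 t"
      then have "\<tau> \<ge> 0" by linarith
      have "norm (integral {0..\<tau>} (H u)) \<le> M * (\<tau> - 0)"
        using \<open>\<tau> \<ge> 0\<close> by (intro integral_bound contH) (auto simp: H_def bdd)
      then have "norm (P u t) \<le> exp (- l * \<tau>) * (norm x0 + M * \<tau>)"
        using norm_triangle_ineq[of x0 "integral {0..\<tau>} (H u)"]
        by (simp add: P_def flip: \<tau>_def)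
      also have "\<dots> = exp (- l * \<tau>) * norm x0 + exp (- l * \<tau>) * (l * \<tau>) * (M / l)"
        using \<open>l > 0\<close> by (simp add: field_simps)
      also have "\<dots> \<le> 1 * norm x0 + 1 * (M / l)"
      proof (intro add_mono mult_right_mono)
        show "exp (- l * \<tau>) \<le> 1" using \<open>l > 0\<close> \<open>\<tau> \<ge> 0\<close> by simp
        have "l * \<tau> \<le> exp (l * \<tau>)" using exp_ge_add_one_self[of "l * \<tau>"] by linarith
        then show "exp (- l * \<tau>) * (l * \<tau>) \<le> 1" by (simp add: exp_minus field_simps)
      qed (use \<open>l > 0\<close> \<open>M \<ge> 0\<close> in auto)
      finally show ?thesis by simp
    qed
    ultimately show ?thesis
      unfolding bcontfun_def by (auto simp: bounded_iff)
  qed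
  then have appP: "apply_bcontfun (Bcontfun (P u)) = P u" for u
    by (simp add: Bcontfun_inverse)
  have "\<exists>!u. Bcontfun (P u) = u"
  proof (rule banach_fix_type)
    show "0 \<le> L / l" "L / l < 1" using \<open>L \<ge> 0\<close> by (auto simp: l_def)
    show "\<forall>u v. dist (Bcontfun (P u)) (Bcontfun (P v)) \<le> L / l * dist u v"
    proof (intro allI dist_bound)
      fix u v :: "real \<Rightarrow>\<^sub>C 'a" and t :: real
      define \<tau> where "\<tau> = max 0 t"
      then have "\<tau> \<ge> 0" by linarith
      \<comment> \<open>Integrating the weight \<open>exp (l * s)\<close> reproduces it with the
        factor \<open>1 / l\<close>; the outer factor of \<open>P\<close> cancels it, which leaves
        the contraction constant \<open>L / l\<close>.\<close>
      have E: "((\<lambda>s. L * dist u v * exp (l * s)) has_integral 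
          L * dist u v / l * exp (l * \<tau>) - L * dist u v / l * exp (l * 0)) {0..\<tau>}"
        using \<open>\<tau> \<ge> 0\<close> \<open>l > 0\<close> 
        by (intro fundamental_theorem_of_calculus)
           (auto simp flip: has_real_derivative_iff_has_vector_derivative intro!: derivative_eq_intros)
      have Hd: "norm (H u s - H v s) \<le> L * dist u v * exp (l * s)" for s
      proof -
        have "norm (H u s - H v s) \<le> L * norm (exp (l * s) *\<^sub>R apply_bcontfun u s - exp (l * s) *\<^sub>R apply_bcontfun v s)"
          unfolding H_def using lipschitz_onD[OF lip] by (simp add: dist_norm)
        also have "\<dots> = L * (exp (l * s) * dist (apply_bcontfun u s) (apply_bcontfun v s))"
          by (simp add: dist_norm flip: scaleR_diff_right)
        also have "\<dots> \<le> L * (exp (l * s) * dist u v)"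
          using \<open>L \<ge> 0\<close> by (intro mult_left_mono dist_bounded) auto
        finally show ?thesis by (simp add: mult_ac)
      qed
      have int: "H u integrable_on {0..\<tau>}" for u
        by (intro integrable_continuous_real contH)
      have "norm (integral {0..\<tau>} (\<lambda>s. H u s - H v s)) \<le> integral {0..\<tau>} (\<lambda>s. L * dist u v * exp (l * s))"
        using E Hd int by (intro integral_norm_bound_integral integrable_diff) (auto simp: has_integral_integrable)
      also have "\<dots> \<le> L / l * dist u v * exp (l * \<tau>)"
        unfolding integral_unique[OF E] using \<open>l > 0\<close> \<open>L \<ge> 0\<close> by simp
      finally have *: "norm (integral {0..\<tau>} (H u) - integral {0..\<tau>} (H v)) \<le> L / l * dist u v * exp (l * \<tau>)"
        by (simp add: integral_diff int)
      have "dist (P u t) (P v t) = exp (- l * \<tau>) * norm (integral {0..\<tau>} (H u) - integral {0..\<tau>} (H v))"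
        by (simp add: P_def dist_norm flip: \<tau>_def scaleR_diff_right)
      also have "\<dots> \<le> exp (- l * \<tau>) * (L / l * dist u v * exp (l * \<tau>))"
        by (intro mult_left_mono *) auto
      finally show "dist (apply_bcontfun (Bcontfun (P u)) t) (apply_bcontfun (Bcontfun (P v)) t) \<le> L / l * dist u v"
        by (simp add: appP exp_minus field_simps)
    qed
  qed
  then obtain u where u: "Bcontfun (P u) = u" by blast
  define x where "x t = x0 + integral {0..t} (H u)" for t
  have H: "H u t = G (x t)" if "t \<ge> 0" for t
  proof -
    have "apply_bcontfun u t = exp (- l * t) *\<^sub>R x t"
      using fun_cong[OF arg_cong[OF u, of apply_bcontfun], of t] that 
      by (simp add: appP P_def x_def max_absorb2)
    then show ?thesis by (simp add: H_def exp_minus)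
  qed
  show ?thesis
  proof (rule that)
    show "x 0 = x0" by (simp add: x_def)
    show "(x has_vector_derivative G (x t)) (at t within {0..})" if "t \<ge> 0" for t
      using has_vector_derivative_add[OF has_vector_derivative_const 
          indefinite_integral_has_vector_derivative[OF contH that], of x0 u]
      unfolding H[OF that] x_def[abs_def] by simp
  qed
qed

section \<open>Gluing local solutions into a maximal one\<close>

definition ode_sol :: "('a::real_normed_vector \<Rightarrow> 'a) \<Rightarrow> 'a \<Rightarrow> (real \<Rightarrow> 'a) \<Rightarrow> real \<Rightarrow> bool" where
  "ode_sol G x0 x T \<longleftrightarrow> x 0 = x0 \<and>
     (\<forall>t\<in>{0..<T}. (x has_vector_derivative G (x t)) (at t within {0..<T}))"

text \<open>Passes from a modified equation back to the original one: the strict bound on the closed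
  interval survives slightly beyond \<open>T\<close> by continuity, and inside the ball both fields
  agree.\<close>

lemma ode_sol_extend:
  fixes G :: "'a::real_normed_vector \<Rightarrow> 'a"
  assumes "x 0 = x0" and deriv: "\<And>t. t \<ge> 0 \<Longrightarrow> (x has_vector_derivative H (x t)) (at t within {0..})"
    and "T \<ge> 0" and less: "\<And>t. t \<in> {0..T} \<Longrightarrow> norm (x t) < R"
    and GH: "\<And>v. norm v < R \<Longrightarrow> H v = G v"
  obtains T' where "T' > T" "ode_sol G x0 x T'"
proof -
  have "continuous_on {0..} x"
    unfolding continuous_on_eq_continuous_within
    by (auto intro: has_vector_derivative_continuous[OF deriv])
  then have "((\<lambda>t. norm (x t)) \<longlongrightarrow> norm (x T)) (at T within {0..})"
    using \<open>T \<ge> 0\<close> by (auto simp: continuous_on_def intro!: tendsto_norm)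
  then have "eventually (\<lambda>t. norm (x t) < R) (at T within {0..})"
    by (rule order_tendstoD) (use less \<open>T \<ge> 0\<close> in auto)
  then obtain d where d: "d > 0" "\<And>t. t \<ge> 0 \<Longrightarrow> t \<noteq> T \<Longrightarrow> dist t T < d \<Longrightarrow> norm (x t) < R"
    unfolding eventually_at by auto
  have "norm (x t) < R" if "t \<in> {0..<T+d}" for t
    using that d(2)[of t] less[of t] by (cases "t \<le> T") (auto simp: dist_real_def)
  then have "(x has_vector_derivative G (x t)) (at t within {0..<T+d})" if "t \<in> {0..<T+d}" for t
    using that has_vector_derivative_within_subset[OF deriv, of t "{0..<T+d}"] GH[of "x t"]
    by (simp add: subset_iff)
  then show ?thesis using that[of "T+d"] d assms(1) by (auto simp: ode_sol_def)
qed

text \<open>All local solutions agree by uniqueness, so their union is a solution. If it were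
  bounded on a finite interval, the global solution of the equation truncated outside a larger ball
  would coincide with it up to the end point and continue it beyond.\<close>

theorem maximal_solution:
  fixes G :: "'a::euclidean_space \<Rightarrow> 'a"
  assumes lip: "\<And>R. \<exists>L. L-lipschitz_on (cball 0 R) G"
  obtains J x where "J = {0..} \<or> (\<exists>T>0. J = {0..<T})" "x 0 = x0"
    "\<And>t. t \<in> J \<Longrightarrow> (x has_vector_derivative G (x t)) (at t within J)"
    "\<And>y T t. ode_sol G x0 y T \<Longrightarrow> t \<in> {0..<T} \<Longrightarrow> t \<in> J \<and> y t = x t"
    "bounded (x ` J) \<Longrightarrow> J = {0..}"
proof -
  define \<T> where "\<T> = {T. T > 0 \<and> (\<exists>y. ode_sol G x0 y T)}"
  define J where "J = (\<Union>T\<in>\<T>. {0..<T})"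
  have uniq: "y t = z t" if "ode_sol G x0 y T" "ode_sol G x0 z T'" "0 \<le> t" "t < T" "t < T'" for y z T T' t
  proof (rule ode_unique[OF lip, of "min T T'" y z t])
    have "{0..<min T T'} \<subseteq> {0..<T}" "{0..<min T T'} \<subseteq> {0..<T'}" by auto
    then show "s \<in> {0..<min T T'} \<Longrightarrow> (y has_vector_derivative G (y s)) (at s within {0..<min T T'})"
      "s \<in> {0..<min T T'} \<Longrightarrow> (z has_vector_derivative G (z s)) (at s within {0..<min T T'})" for s
      using that unfolding ode_sol_def
      by (auto intro: has_vector_derivative_within_subset[of _ _ _ "{0..<T}"]
          has_vector_derivative_within_subset[of _ _ _ "{0..<T'}"])
  qed (use that in \<open>auto simp: ode_sol_def\<close>)
  have "\<forall>t. \<exists>v. t \<in> J \<longrightarrow> (\<exists>y T. ode_sol G x0 y T \<and> t < T \<and> v = y t)"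
    unfolding J_def \<T>_def by fastforce
  from choice[OF this] obtain x
    where x: "\<And>t. t \<in> J \<Longrightarrow> \<exists>y T. ode_sol G x0 y T \<and> t < T \<and> x t = y t"
    by blast
  have eq: "t \<in> J \<and> y t = x t" if "ode_sol G x0 y T" "t \<in> {0..<T}" for y T t
  proof
    show "t \<in> J" using that unfolding J_def \<T>_def by (auto intro!: exI[of _ T])
    from x[OF this] show "y t = x t" using uniq that by force
  qed
  \<comment> \<open>The truncation composes \<open>G\<close> with the projection onto a ball. The
    projection is 1-Lipschitz, so the truncated field is globally Lipschitz and bounded, as
    \<open>picard_global\<close> requires.\<close>
  have global: "\<exists>y. y 0 = x0 \<and> (\<forall>t\<ge>0. (y has_vector_derivative G (closest_point (cball 0 R) (y t))) (at t within {0..}))"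
    and lip_global: "\<exists>L. L-lipschitz_on UNIV (\<lambda>v. G (closest_point (cball 0 R) v))" if "R > 0" for R
  proof -
    obtain L where L: "L-lipschitz_on (cball 0 R) G" using lip by blast
    have ne: "cball (0::'a) R \<noteq> {}" using that by auto
    have "1-lipschitz_on UNIV (closest_point (cball (0::'a) R))"
      by (rule lipschitz_onI) (use ne closest_point_lipschitz[of "cball (0::'a) R"] in auto)
    moreover have "L-lipschitz_on (closest_point (cball (0::'a) R) ` UNIV) G"
      by (rule lipschitz_on_subset[OF L]) (use closest_point_in_set[OF closed_cball ne] in blast)
    ultimately have L': "(L * 1)-lipschitz_on UNIV (\<lambda>v. G (closest_point (cball 0 R) v))"
      by (rule lipschitz_on_compose2)
    then show "\<exists>L. L-lipschitz_on UNIV (\<lambda>v. G (closest_point (cball 0 R) v))" by blast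
    have "bounded (G ` cball 0 R)"
      by (intro compact_imp_bounded compact_continuous_image lipschitz_on_continuous_on[OF L]) auto
    then obtain M where "\<forall>v \<in> cball 0 R. norm (G v) \<le> M" by (auto simp: bounded_iff)
    then have "norm (G (closest_point (cball 0 R) v)) \<le> M" for v
      using closest_point_in_set[OF closed_cball ne] by blast
    from picard_global[OF L' this, of x0]
    show "\<exists>y. y 0 = x0 \<and> (\<forall>t\<ge>0. (y has_vector_derivative G (closest_point (cball 0 R) (y t))) (at t within {0..}))"
      by metis
  qed
  have restrict: "G (closest_point (cball 0 R) v) = G v" if "norm v < R" for v R
    using that by (simp add: closest_point_self)
  have "\<exists>T. T \<in> \<T>"
  proof -
    define R where "R = norm x0 + 1"
    have "R > 0" by (simp add: R_def add_nonneg_pos)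
    from global[OF this] obtain y where "y 0 = x0" 
      "\<And>t. t\<ge>0 \<Longrightarrow> (y has_vector_derivative G (closest_point (cball 0 R) (y t))) (at t within {0..})"
      by blast
    then obtain T' where "T' > 0" "ode_sol G x0 y T'"
      by (rule ode_sol_extend[where T = 0 and R = R and G = G]) (auto simp: R_def restrict \<open>y 0 = x0\<close>)
    then show ?thesis by (auto simp: \<T>_def)
  qed
  then obtain T1 where "T1 \<in> \<T>" by blast
  then have "T1 > 0" by (simp add: \<T>_def)
  have J: "J = {0..} \<or> (\<exists>T>0. J = {0..<T})"
  proof (cases "bdd_above \<T>")
    case True
    have "J = {0..<Sup \<T>}"
      using less_cSup_iff[OF _ True] \<open>T1 \<in> \<T>\<close> unfolding J_def by fastforce
    moreover have "Sup \<T> > 0"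
      using cSup_upper[OF \<open>T1 \<in> \<T>\<close> True] \<open>T1 > 0\<close> by linarith
    ultimately show ?thesis by blast
  next
    case False
    then have "J = {0..}" unfolding J_def bdd_above_def by (auto simp: not_le)
    then show ?thesis by blast
  qed
  have x0: "x 0 = x0"
    using \<open>T1 \<in> \<T>\<close> \<open>T1 > 0\<close> eq[of _ T1 0] by (auto simp: \<T>_def ode_sol_def)
  have deriv: "(x has_vector_derivative G (x t)) (at t within J)" if t: "t \<in> J" for t
  proof -
    obtain y T where y: "ode_sol G x0 y T" "t < T" "x t = y t" using x[OF t] by blast
    have "t \<ge> 0" using t by (auto simp: J_def)
    have T: "{0..<T} \<subseteq> J" using eq[OF y(1)] by auto
    have "at t within J = at t within {0..<T}"
      by (rule at_within_nhd[of _ "{..<T}"]) (use y \<open>t \<ge> 0\<close> T in \<open>auto simp: J_def\<close>)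
    moreover have "(x has_vector_derivative G (x t)) (at t within {0..<T})"
      by (rule has_vector_derivative_transform[of t _ x y]) 
        (use y \<open>t \<ge> 0\<close> eq[OF y(1)] in \<open>auto simp: ode_sol_def\<close>)
    ultimately show ?thesis by simp
  qed
  have "J = {0..}" if bd: "bounded (x ` J)"
  proof (rule ccontr)
    assume "J \<noteq> {0..}"
    with J obtain T where T: "T > 0" "J = {0..<T}" by blast
    from bd obtain M where M: "M > 0" "\<And>t. t \<in> J \<Longrightarrow> norm (x t) \<le> M" by (auto simp: bounded_pos)
    \<comment> \<open>The slack 1 makes the bound \<open>M\<close>, which extends to the end point
      by continuity, a strict bound by \<open>R\<close>.\<close>
    define R where "R = M + 1"
    have "R > 0" using M by (simp add: R_def)
    from global[OF this] obtain y where y: "y 0 = x0" 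
      "\<And>t. t\<ge>0 \<Longrightarrow> (y has_vector_derivative G (closest_point (cball 0 R) (y t))) (at t within {0..})"
      by blast
    have xy: "y t = x t" if "t \<in> {0..<T}" for t
    proof (rule ode_unique[where G = "\<lambda>v. G (closest_point (cball 0 R) v)"])
      show "\<exists>L. L-lipschitz_on (cball 0 r) (\<lambda>v. G (closest_point (cball 0 R) v))" for r
        using lip_global[OF \<open>R > 0\<close>] lipschitz_on_subset by blast
      show "(y has_vector_derivative G (closest_point (cball 0 R) (y t))) (at t within {0..<T})" if "t \<in> {0..<T}" for t
        using that by (intro has_vector_derivative_within_subset[OF y(2)]) auto
      show "(x has_vector_derivative G (closest_point (cball 0 R) (x t))) (at t within {0..<T})" if "t \<in> {0..<T}" for t
      proof -
        have "norm (x t) < R" using M(2)[of t] that T by (auto simp: R_def)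
        then show ?thesis using deriv[of t] that T by (simp add: restrict)
      qed
    qed (use that y x0 in auto)
    have contnorm: "continuous_on {0..T} (\<lambda>t. norm (y t))"
    proof (intro continuous_intros)
      have "continuous_on {0..} y"
        unfolding continuous_on_eq_continuous_within
        by (auto intro: has_vector_derivative_continuous[OF y(2)])
      then show "continuous_on {0..T} y" by (rule continuous_on_subset) auto
    qed
    have ym: "norm (y t) \<le> M" if "t \<in> {0..T}" for t
      by (rule continuous_le_on_closure[of "{0..<T}", OF _ _ _ ])
        (use contnorm that M xy T in auto)
    from y obtain T' where "T' > T" "ode_sol G x0 y T'"
    proof (rule ode_sol_extend[where T = T and R = R and G = G])
      show "norm (y t) < R" if "t \<in> {0..T}" for t using ym[OF that] by (simp add: R_def)
    qed (use T restrict in auto)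
    then have "T \<in> J" using eq[of y T' T] T by auto
    then show False using T by simp
  qed
  with that[of J x] J x0 deriv eq show ?thesis by blast
qed

section \<open>Maps that are Lipschitz on every ball\<close>

text \<open>Uniformity on balls around 0, rather than near each point, is the form that
  \<open>maximal_solution\<close> asks for, and it gives boundedness on balls, which closure under
  products needs.\<close>

definition loc_lip :: "('a::real_normed_vector \<Rightarrow> 'b::real_normed_vector) \<Rightarrow> bool" where
  "loc_lip g \<longleftrightarrow> (\<forall>R. \<exists>L. L-lipschitz_on (cball 0 R) g)"

lemma loc_lip_const: "loc_lip (\<lambda>x. c)"
  unfolding loc_lip_def by (intro allI exI[of _ 0] lipschitz_on_constant)

lemma loc_lip_bounded_linear: "bounded_linear g \<Longrightarrow> loc_lip g"
  unfolding loc_lip_def by (rule allI, erule bounded_linear.lipschitz_boundE, rule exI)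

lemma loc_lip_add: 
  assumes "loc_lip g" and "loc_lip h"
  shows "loc_lip (\<lambda>x. g x + h x)"
  unfolding loc_lip_def
proof
  fix R
  obtain L K where L: "L-lipschitz_on (cball 0 R) g" and K: "K-lipschitz_on (cball 0 R) h"
    using assms unfolding loc_lip_def by blast
  show "\<exists>L. L-lipschitz_on (cball 0 R) (\<lambda>x. g x + h x)"
    by (rule exI, rule lipschitz_on_add[OF L K])
qed

lemma loc_lip_diff: 
  assumes "loc_lip g" and "loc_lip h"
  shows "loc_lip (\<lambda>x. g x - h x)"
  unfolding loc_lip_def
proof
  fix R
  obtain L K where L: "L-lipschitz_on (cball 0 R) g" and K: "K-lipschitz_on (cball 0 R) h"
    using assms unfolding loc_lip_def by blast
  show "\<exists>L. L-lipschitz_on (cball 0 R) (\<lambda>x. g x - h x)"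
    by (rule exI, rule lipschitz_on_diff[OF L K])
qed

lemma loc_lip_Pair: 
  assumes "loc_lip g" and "loc_lip h"
  shows "loc_lip (\<lambda>x. (g x, h x))"
  unfolding loc_lip_def
proof
  fix R
  obtain L K where L: "L-lipschitz_on (cball 0 R) g" and K: "K-lipschitz_on (cball 0 R) h"
    using assms unfolding loc_lip_def by blast
  show "\<exists>L. L-lipschitz_on (cball 0 R) (\<lambda>x. (g x, h x))"
    by (rule exI, rule lipschitz_on_Pair[OF L K])
qed

lemma loc_lip_imp_bounded:
  fixes g :: "'a::euclidean_space \<Rightarrow> 'b::real_normed_vector"
  assumes "loc_lip g"
  obtains M where "M > 0" "\<And>x. norm x \<le> R \<Longrightarrow> norm (g x) \<le> M"
proof -
  obtain L where L: "L-lipschitz_on (cball 0 R) g" using assms loc_lip_def by blast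
  have "bounded (g ` cball 0 R)"
    by (intro compact_imp_bounded compact_continuous_image lipschitz_on_continuous_on[OF L] compact_cball)
  then obtain M where "M > 0" "\<forall>x\<in>cball 0 R. norm (g x) \<le> M" by (auto simp: bounded_pos)
  with that[of M] show ?thesis by simp
qed

lemma loc_lip_mult:
  fixes g h :: "'a::euclidean_space \<Rightarrow> real"
  assumes g: "loc_lip g" and h: "loc_lip h"
  shows "loc_lip (\<lambda>x. g x * h x)"
  unfolding loc_lip_def
proof
  fix R
  obtain M where M: "M > 0" "\<And>x. norm x \<le> R \<Longrightarrow> norm (g x) \<le> M" using loc_lip_imp_bounded[OF g] by metis
  obtain N where N: "N > 0" "\<And>x. norm x \<le> R \<Longrightarrow> norm (h x) \<le> N" using loc_lip_imp_bounded[OF h] by metis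
  obtain L K where L: "L-lipschitz_on (cball 0 R) g" and K: "K-lipschitz_on (cball 0 R) h"
    using assms unfolding loc_lip_def by metis
  have "(M * K + N * L)-lipschitz_on (cball 0 R) (\<lambda>x. g x * h x)"
  proof (rule lipschitz_onI)
    fix x y :: 'a assume xy: "x \<in> cball 0 R" "y \<in> cball 0 R"
    have "\<bar>g x * h x - g y * h y\<bar> = \<bar>g x * (h x - h y) + h y * (g x - g y)\<bar>"
      by (simp add: algebra_simps)
    also have "\<dots> \<le> \<bar>g x\<bar> * \<bar>h x - h y\<bar> + \<bar>h y\<bar> * \<bar>g x - g y\<bar>"
      by (metis abs_mult abs_triangle_ineq)
    also have "\<dots> \<le> M * (K * dist x y) + N * (L * dist x y)"
      using lipschitz_onD[OF L xy] lipschitz_onD[OF K xy] M N xy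
      by (intro add_mono mult_mono) (auto simp: dist_real_def)
    finally show "dist (g x * h x) (g y * h y) \<le> (M * K + N * L) * dist x y"
      by (simp add: dist_real_def algebra_simps)
  qed (use M N lipschitz_on_nonneg[OF L] lipschitz_on_nonneg[OF K] in auto)
  then show "\<exists>L. L-lipschitz_on (cball 0 R) (\<lambda>x. g x * h x)" by blast
qed

lemma loc_lip_compose:
  fixes g :: "'a::euclidean_space \<Rightarrow> 'b::real_normed_vector"
  assumes g: "loc_lip g" and h: "loc_lip h"
  shows "loc_lip (\<lambda>x. h (g x))"
  unfolding loc_lip_def
proof
  fix R
  obtain M where M: "M > 0" "\<And>x. norm x \<le> R \<Longrightarrow> norm (g x) \<le> M" using loc_lip_imp_bounded[OF g] by metis
  obtain L K where L: "L-lipschitz_on (cball 0 R) g" and K: "K-lipschitz_on (cball 0 M) h"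
    using assms unfolding loc_lip_def by metis
  have "(K * L)-lipschitz_on (cball 0 R) (\<lambda>x. h (g x))"
    by (rule lipschitz_on_compose2[OF L lipschitz_on_subset[OF K]]) (use M in auto)
  then show "\<exists>L. L-lipschitz_on (cball 0 R) (\<lambda>x. h (g x))" by blast
qed

lemma loc_lip_exp: "loc_lip (exp :: real \<Rightarrow> real)"
  unfolding loc_lip_def
proof
  fix R :: real
  have "(exp R)-lipschitz_on (cball 0 R) (exp :: real \<Rightarrow> real)"
  proof (rule bounded_derivative_imp_lipschitz)
    show "(exp has_derivative (\<lambda>h. exp x * h)) (at x within cball 0 R)" for x :: real
      using DERIV_exp[of x] by (simp add: has_field_derivative_def has_derivative_at_withinI)
    show "onorm (\<lambda>h. exp x * h) \<le> exp R" if "x \<in> cball 0 R" for x :: real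
      by (rule onorm_le) (use that in \<open>auto simp: abs_mult intro!: mult_right_mono\<close>)
  qed auto
  then show "\<exists>L. L-lipschitz_on (cball 0 R) (exp :: real \<Rightarrow> real)" by blast
qed

lemmas loc_lip_intros = loc_lip_const loc_lip_add loc_lip_diff loc_lip_Pair loc_lip_mult

section \<open>Cross curvature of diagonal left-invariant metrics\<close>

unbundle cross3_syntax

text \<open>The operator with diagonal matrix \<open>k\<close>. Together with the cross product it
  expresses bracket, connection and curvature of a diagonal metric.\<close>

definition scale3 :: "real^3 \<Rightarrow> real^3 \<Rightarrow> real^3" where
  "scale3 k v = (\<chi> i. k $ i * v $ i)"

text \<open>The rows of a square matrix are orthonormal; a one-sided inverse of a square matrix is
  two-sided, so the columns are orthonormal as well.\<close>

lemma orthonormal_columns: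
  fixes q :: "3 \<Rightarrow> real^3"
  assumes "\<And>i j. q i \<bullet> q j = (if i = j then 1 else 0)"
  shows "(\<Sum>i\<in>UNIV. q i $ a * q i $ b) = (if a = b then 1 else 0)"
proof -
  define Q :: "real^3^3" where "Q = (\<chi> i. q i)"
  have "Q ** transpose Q = mat 1"
    using assms by (simp add: Q_def vec_eq_iff matrix_matrix_mult_def transpose_def mat_def inner_vec_def)
  then have "transpose Q ** Q = mat 1" using matrix_left_right_inverse by blast
  then have "(transpose Q ** Q) $ a $ b = mat 1 $ a $ b" by simp
  then show ?thesis by (simp add: Q_def matrix_matrix_mult_def transpose_def mat_def)
qed

text \<open>The left side is the Ricci tensor of the curvature operator \<open>k\<close>, where
  bivectors are identified with vectors by the cross product. In dimension three it is the trace of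
  \<open>k\<close> minus \<open>k\<close>, independently of the frame \<open>q\<close>.\<close>

lemma sum_scale3_cross_orthonormal:
  fixes q :: "3 \<Rightarrow> real^3"
  assumes "\<And>i j. q i \<bullet> q j = (if i = j then 1 else 0)"
  shows "(\<Sum>i\<in>UNIV. scale3 k (q i \<times> x) \<bullet> (q i \<times> y)) = (k$1 + k$2 + k$3) * (x \<bullet> y) - scale3 k x \<bullet> y"
proof -
  have "(\<Sum>i\<in>UNIV. scale3 k (q i \<times> x) \<bullet> (q i \<times> y)) =
      (\<Sum>i\<in>UNIV. q i $ 1 * q i $ 1) * (k$3 * x$2 * y$2 + k$2 * x$3 * y$3)
    + (\<Sum>i\<in>UNIV. q i $ 2 * q i $ 2) * (k$3 * x$1 * y$1 + k$1 * x$3 * y$3)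
    + (\<Sum>i\<in>UNIV. q i $ 3 * q i $ 3) * (k$2 * x$1 * y$1 + k$1 * x$2 * y$2)
    - (\<Sum>i\<in>UNIV. q i $ 1 * q i $ 2) * (k$3 * (x$1 * y$2 + x$2 * y$1))
    - (\<Sum>i\<in>UNIV. q i $ 1 * q i $ 3) * (k$2 * (x$1 * y$3 + x$3 * y$1))
    - (\<Sum>i\<in>UNIV. q i $ 2 * q i $ 3) * (k$1 * (x$2 * y$3 + x$3 * y$2))"
    unfolding sum_3 by (simp add: scale3_def inner_vec_def sum_3 cross3_def) algebra
  also have "\<dots> = (k$1 + k$2 + k$3) * (x \<bullet> y) - scale3 k x \<bullet> y"
    unfolding orthonormal_columns[OF assms] by (simp add: scale3_def inner_vec_def sum_3 algebra_simps)
  finally show ?thesis .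
qed

lemma orthonormal_expansion:
  fixes q :: "3 \<Rightarrow> real^3"
  assumes "\<And>i j. q i \<bullet> q j = (if i = j then 1 else 0)"
  shows "(\<Sum>i\<in>UNIV. (v \<bullet> q i) *\<^sub>R q i) = v"
proof -
  have "(\<Sum>i\<in>UNIV. (v \<bullet> q i) *\<^sub>R q i) $ a = v $ a" for a
  proof -
    have "(\<Sum>i\<in>UNIV. (v \<bullet> q i) *\<^sub>R q i) $ a = (\<Sum>b\<in>UNIV. v $ b * (\<Sum>i\<in>UNIV. q i $ b * q i $ a))"
      by (simp add: inner_vec_def sum_3 algebra_simps)
    then show ?thesis
      unfolding orthonormal_columns[OF assms] using exhaust_3[of a] by (auto simp: sum_3)
  qed
  then show ?thesis by (simp add: vec_eq_iff)
qed

text \<open>In the orthonormal frame \<open>q\<close> the diagonal tensor \<open>k\<close> is again diagonal, so it and the tensor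
  \<open>diag (\<kappa> i)\<close> have the same eigenvectors and the same trace and Frobenius norm, hence the same adjugate.\<close>

lemma cross_curvature_frame_independent:
  fixes q :: "3 \<Rightarrow> real^3" and k :: "real^3" and \<kappa> H :: "3 \<Rightarrow> real"
  assumes on: "\<And>i j. q i \<bullet> q j = (if i = j then 1 else 0)"
    and ric: "\<And>i j. i \<noteq> j \<Longrightarrow> (\<Sum>l\<in>UNIV. scale3 k (q l \<times> q i) \<bullet> (q l \<times> q j)) = 0"
    and \<kappa>: "\<And>i j l. distinct [i, j, l] \<Longrightarrow> \<kappa> i = scale3 k (q j \<times> q l) \<bullet> (q j \<times> q l)"
    and H: "\<And>i j l. distinct [i, j, l] \<Longrightarrow> H i = \<kappa> j * \<kappa> l"
  assumes abc: "distinct [a, b, c]"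
  shows "(\<Sum>i\<in>UNIV. (q i $ a)\<^sup>2 * H i) = k $ b * k $ c"
proof -
  define T where "T = k$1 + k$2 + k$3"
  note ric_eq = sum_scale3_cross_orthonormal[OF on, of k, folded T_def]
  have diag: "scale3 k (q i) \<bullet> q j = 0" if "i \<noteq> j" for i j
    using ric[OF that] ric_eq[of "q i" "q j"] on[of i j] that by simp
  have cross_self: "scale3 k (0::real^3) = 0" by (simp add: scale3_def vec_eq_iff)
  have ne: "(1::3) \<noteq> 2" "(1::3) \<noteq> 3" "(2::3) \<noteq> 3" "(2::3) \<noteq> 1" "(3::3) \<noteq> 1" "(3::3) \<noteq> 2" by auto
  \<comment> \<open>The Ricci tensor at \<open>q i\<close> is evaluated in two ways. Together with
    the trace identity \<open>tr\<close> this identifies \<open>\<kappa> i\<close> with the diagonal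
    entry of \<open>k\<close> at \<open>q i\<close>.\<close>
  have r: "\<kappa> 2 + \<kappa> 3 = T - scale3 k (q 1) \<bullet> q 1" "\<kappa> 1 + \<kappa> 3 = T - scale3 k (q 2) \<bullet> q 2"
     "\<kappa> 1 + \<kappa> 2 = T - scale3 k (q 3) \<bullet> q 3"
    using ric_eq[of "q 1" "q 1"] ric_eq[of "q 2" "q 2"] ric_eq[of "q 3" "q 3"] on[of 1 1] on[of 2 2] on[of 3 3]
      \<kappa>[of 1 2 3] \<kappa>[of 1 3 2] \<kappa>[of 2 1 3] \<kappa>[of 2 3 1] \<kappa>[of 3 1 2] \<kappa>[of 3 2 1]
    by (simp_all add: sum_3 cross_self)
  have tr: "scale3 k (q 1) \<bullet> q 1 + scale3 k (q 2) \<bullet> q 2 + scale3 k (q 3) \<bullet> q 3 = T"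
  proof -
    have "scale3 k (q 1) \<bullet> q 1 + scale3 k (q 2) \<bullet> q 2 + scale3 k (q 3) \<bullet> q 3 = 
       k$1 * (\<Sum>i\<in>UNIV. q i $ 1 * q i $ 1) + k$2 * (\<Sum>i\<in>UNIV. q i $ 2 * q i $ 2) + k$3 * (\<Sum>i\<in>UNIV. q i $ 3 * q i $ 3)"
      by (simp add: scale3_def inner_vec_def sum_3 algebra_simps)
    then show ?thesis unfolding orthonormal_columns[OF on] by (simp add: T_def)
  qed
  have \<kappa>_eq: "scale3 k (q i) \<bullet> q i = \<kappa> i" for i
    using r tr exhaust_3[of i] by auto
  have "scale3 k (q i) = \<kappa> i *\<^sub>R q i" for i
  proof -
    have "scale3 k (q i) = (\<Sum>j\<in>UNIV. (scale3 k (q i) \<bullet> q j) *\<^sub>R q j)"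
      by (rule orthonormal_expansion[OF on, symmetric])
    also have "\<dots> = (\<Sum>j\<in>UNIV. if j = i then \<kappa> i *\<^sub>R q i else 0)"
      by (rule sum.cong) (auto simp: diag \<kappa>_eq)
    finally show ?thesis by simp
  qed
  from arg_cong[OF this, of "\<lambda>v. v $ _"] have eig: "k $ a * q i $ a = \<kappa> i * q i $ a" for i a
    by (simp add: scale3_def)
  have sum1: "\<kappa> 1 + \<kappa> 2 + \<kappa> 3 = T" using tr by (simp add: \<kappa>_eq)
  have sum2: "(\<kappa> 1)\<^sup>2 + (\<kappa> 2)\<^sup>2 + (\<kappa> 3)\<^sup>2 = (k$1)\<^sup>2 + (k$2)\<^sup>2 + (k$3)\<^sup>2"
  proof -
    have "(\<kappa> i)\<^sup>2 = (\<Sum>a\<in>UNIV. (k$a)\<^sup>2 * (q i $ a * q i $ a))" for i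
    proof -
      have "(\<kappa> i)\<^sup>2 = (\<kappa> i)\<^sup>2 * (q i \<bullet> q i)" by (simp add: on)
      also have "\<dots> = (\<Sum>a\<in>UNIV. (\<kappa> i * q i $ a) * (\<kappa> i * q i $ a))"
        by (simp add: inner_vec_def sum_3 algebra_simps power2_eq_square)
      finally show ?thesis by (simp add: eig[symmetric] power2_eq_square algebra_simps)
    qed
    then have "(\<kappa> 1)\<^sup>2 + (\<kappa> 2)\<^sup>2 + (\<kappa> 3)\<^sup>2 = (\<Sum>a\<in>UNIV. (k$a)\<^sup>2 * (\<Sum>i\<in>UNIV. q i $ a * q i $ a))"
      by (simp add: sum_3 algebra_simps)
    then show ?thesis unfolding orthonormal_columns[OF on] by (simp add: sum_3)
  qed
  \<comment> \<open>The product is written through the trace, the Frobenius norm and the entry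
    \<open>a\<close> alone. \<open>H i\<close> is the same expression in \<open>\<kappa> i\<close>,
    and the two agree wherever \<open>q i $ a\<close> is nonzero, because there \<open>k $ a\<close>
    equals \<open>\<kappa> i\<close>.\<close>
  have kbc: "k $ b * k $ c = ((T - k$a)\<^sup>2 - ((k$1)\<^sup>2 + (k$2)\<^sup>2 + (k$3)\<^sup>2 - (k$a)\<^sup>2)) / 2"
    using abc exhaust_3[of a] exhaust_3[of b] exhaust_3[of c]
    by (auto simp: T_def power2_eq_square algebra_simps)
  have Hi: "H i = ((T - \<kappa> i)\<^sup>2 - ((k$1)\<^sup>2 + (k$2)\<^sup>2 + (k$3)\<^sup>2 - (\<kappa> i)\<^sup>2)) / 2" for i
    unfolding sum1[symmetric] sum2[symmetric] using exhaust_3[of i] H[of 1 2 3] H[of 2 1 3] H[of 3 1 2]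
    by (auto simp: power2_eq_square algebra_simps)
  have "(q i $ a)\<^sup>2 * H i = (q i $ a * q i $ a) * (k $ b * k $ c)" for i
    using eig[where i = i and a = a] kbc Hi[of i] by (cases "q i $ a = 0") (auto simp: power2_eq_square)
  then have "(\<Sum>i\<in>UNIV. (q i $ a)\<^sup>2 * H i) = (\<Sum>i\<in>UNIV. q i $ a * q i $ a) * (k $ b * k $ c)"
    by (simp add: sum_distrib_right)
  then show ?thesis unfolding orthonormal_columns[OF on] by simp
qed

section \<open>Curvature of a diagonal metric in orthonormal coordinates\<close>

definition F1 :: "real \<Rightarrow> real \<Rightarrow> real \<Rightarrow> real" where
  "F1 A B C = - 3 * A\<^sup>2 + B\<^sup>2 + C\<^sup>2 - 2*B*C - 2*A*C - 2*A*B"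

definition F2 :: "real \<Rightarrow> real \<Rightarrow> real \<Rightarrow> real" where
  "F2 A B C = - 3 * B\<^sup>2 + A\<^sup>2 + C\<^sup>2 + 2*B*C + 2*A*C - 2*A*B"

definition F3 :: "real \<Rightarrow> real \<Rightarrow> real \<Rightarrow> real" where
  "F3 A B C = - 3 * C\<^sup>2 + A\<^sup>2 + B\<^sup>2 + 2*B*C - 2*A*C + 2*A*B"

locale sl2_diag_metric =
  fixes f :: "3 \<Rightarrow> mat2" and a b c :: real
  assumes frame: "sl2_frame f" and pos: "a > 0" "b > 0" "c > 0"
begin

abbreviation "g \<equiv> diag_metric f a b c"

lemma f_in_span: "f i \<in> span (range f)"
  by (simp add: span_base)

lemma dual_frame_add: "X \<in> sl2 \<Longrightarrow> Y \<in> sl2 \<Longrightarrow> dual_frame f i (X + Y) = dual_frame f i X + dual_frame f i Y"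
  using frame by (simp add: sl2_frame_def dual_frame_def representation_add)

lemma dual_frame_scale: "X \<in> sl2 \<Longrightarrow> dual_frame f i (r *\<^sub>R X) = r * dual_frame f i X"
  using frame by (simp add: sl2_frame_def dual_frame_def representation_scale)

lemma f_in_sl2: "f i \<in> sl2"
  using frame f_in_span by (auto simp: sl2_frame_def)

lemma sl2_subspace: "subspace sl2"
  using frame by (metis sl2_frame_def subspace_span)

lemma dual_frame_basis: "dual_frame f i (f j) = (if i = j then 1 else 0)"
  using frame by (auto simp: sl2_frame_def dual_frame_def representation_basis inj_def)

text \<open>Coordinates for the normalized frame: \<open>\<psi>\<close> is an isometry from
  Euclidean space onto \<open>sl2\<close>, so that all curvature computations become vector
  algebra.\<close>

definition \<psi> :: "real^3 \<Rightarrow> mat2" where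
  "\<psi> v = (v$1 / sqrt a) *\<^sub>R f 1 + (v$2 / sqrt b) *\<^sub>R f 2 + (v$3 / sqrt c) *\<^sub>R f 3"

lemma \<psi>_in_sl2: "\<psi> v \<in> sl2"
  unfolding \<psi>_def by (intro subspace_add subspace_scale sl2_subspace f_in_sl2)

lemma dual_frame_\<psi>: "dual_frame f 1 (\<psi> v) = v$1 / sqrt a" "dual_frame f 2 (\<psi> v) = v$2 / sqrt b"
    "dual_frame f 3 (\<psi> v) = v$3 / sqrt c"
  unfolding \<psi>_def
  by (simp_all add: dual_frame_add dual_frame_scale dual_frame_basis subspace_add subspace_scale sl2_subspace f_in_sl2)

lemma metric_\<psi>: "g (\<psi> v) (\<psi> w) = v \<bullet> w"
  using pos by (simp add: diag_metric_def dual_frame_\<psi> inner_vec_def sum_3)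

lemma \<psi>_linear: "\<psi> (v + w) = \<psi> v + \<psi> w" "\<psi> (v - w) = \<psi> v - \<psi> w" "\<psi> (r *\<^sub>R v) = r *\<^sub>R \<psi> v" "\<psi> (- v) = - \<psi> v"
  by (simp_all add: \<psi>_def add_divide_distrib diff_divide_distrib algebra_simps)

lemma sl2_expand:
  assumes "X \<in> sl2"
  shows "X = dual_frame f 1 X *\<^sub>R f 1 + dual_frame f 2 X *\<^sub>R f 2 + dual_frame f 3 X *\<^sub>R f 3"
proof -
  have "X \<in> span (range f)" using frame assms by (simp add: sl2_frame_def)
  then have "(\<Sum>v\<in>range f. representation (range f) X v *\<^sub>R v) = X"
    using frame by (intro sum_representation_eq) (auto simp: sl2_frame_def)
  moreover have "inj f" using frame by (simp add: sl2_frame_def)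
  ultimately show ?thesis by (simp add: sum.reindex dual_frame_def sum_3)
qed

lemma sl2_\<psi>:
  assumes "X \<in> sl2"
  obtains v where "X = \<psi> v"
proof
  show "X = \<psi> (vector [sqrt a * dual_frame f 1 X, sqrt b * dual_frame f 2 X, sqrt c * dual_frame f 3 X])"
    using sl2_expand[OF assms] pos by (simp add: \<psi>_def)
qed

text \<open>Milnor's structure constants of a unimodular Lie algebra of dimension three: in the
  normalized frame the bracket is the cross product followed by a diagonal operator.\<close>

definition \<sigma> :: "real^3" where
  "\<sigma> = vector [-2 * sqrt a / (sqrt b * sqrt c), 2 * sqrt b / (sqrt a * sqrt c), 2 * sqrt c / (sqrt a * sqrt b)]"

lemma lie_bracket_bilinear: 
  "lie_bracket (X + Y) Z = lie_bracket X Z + lie_bracket Y Z"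
  "lie_bracket Z (X + Y) = lie_bracket Z X + lie_bracket Z Y"
  "lie_bracket (r *\<^sub>R X) Z = r *\<^sub>R lie_bracket X Z"
  "lie_bracket Z (r *\<^sub>R X) = r *\<^sub>R lie_bracket Z X"
  by (simp_all add: lie_bracket_def vec_eq_iff matrix_matrix_mult_def sum_2 algebra_simps)

lemma lie_bracket_swap: "lie_bracket X Y = - lie_bracket Y X" and lie_bracket_self: "lie_bracket X X = 0"
  by (simp_all add: lie_bracket_def)

lemma lie_bracket_frame:
  "lie_bracket (f 2) (f 3) = (-2) *\<^sub>R f 1" "lie_bracket (f 3) (f 1) = 2 *\<^sub>R f 2" "lie_bracket (f 1) (f 2) = 2 *\<^sub>R f 3"
  "lie_bracket (f 3) (f 2) = 2 *\<^sub>R f 1" "lie_bracket (f 1) (f 3) = (-2) *\<^sub>R f 2" "lie_bracket (f 2) (f 1) = (-2) *\<^sub>R f 3"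
  using frame lie_bracket_swap[of "f 3" "f 2"] lie_bracket_swap[of "f 1" "f 3"] lie_bracket_swap[of "f 2" "f 1"]
  by (auto simp: sl2_frame_def)

lemma lie_bracket_\<psi>: "lie_bracket (\<psi> v) (\<psi> w) = \<psi> (scale3 \<sigma> (v \<times> w))"
proof -
  define s1 s2 s3 where "s1 = sqrt a" "s2 = sqrt b" "s3 = sqrt c"
  have nz: "s1 \<noteq> 0" "s2 \<noteq> 0" "s3 \<noteq> 0" using pos by (auto simp: s1_s2_s3_def)
  have "lie_bracket (\<psi> v) (\<psi> w) =
     (- 2 * (v$2 * w$3 - v$3 * w$2) / (s2 * s3)) *\<^sub>R f 1
   + (2 * (v$3 * w$1 - v$1 * w$3) / (s1 * s3)) *\<^sub>R f 2
   + (2 * (v$1 * w$2 - v$2 * w$1) / (s1 * s2)) *\<^sub>R f 3"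
    unfolding \<psi>_def s1_s2_s3_def[symmetric]
    by (simp only: lie_bracket_bilinear lie_bracket_self lie_bracket_frame)
      (simp add: algebra_simps diff_divide_distrib)
  also have "\<dots> = \<psi> (scale3 \<sigma> (v \<times> w))"
    unfolding \<psi>_def \<sigma>_def scale3_def s1_s2_s3_def[symmetric] using nz
    by (intro arg_cong2[of _ _ _ _ "(+)"] arg_cong2[of _ _ _ _ scaleR] refl) (simp_all add: cross3_def field_simps)
  finally show ?thesis .
qed

text \<open>Milnor's connection coefficients, half the sum of the structure constants minus one of
  them; \<open>scale3 \<mu> v\<close> is the axis of the infinitesimal rotation by which
  \<open>v\<close> differentiates.\<close>

definition \<mu> :: "real^3" where
  "\<mu> = vector [(\<sigma>$2 + \<sigma>$3 - \<sigma>$1) / 2, (\<sigma>$1 + \<sigma>$3 - \<sigma>$2) / 2, (\<sigma>$1 + \<sigma>$2 - \<sigma>$3) / 2]"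

text \<open>The right side of Koszul's formula is twice the inner product of this vector with
  \<open>u\<close>. Nondegeneracy of the inner product then makes the definite description
  unique.\<close>

lemma levi_civita_\<psi>: "levi_civita g (\<psi> v) (\<psi> w) = \<psi> (scale3 \<mu> v \<times> w)"
proof -
  have koszul: "2 * (z \<bullet> u) = scale3 \<sigma> (v \<times> w) \<bullet> u - scale3 \<sigma> (w \<times> u) \<bullet> v + scale3 \<sigma> (u \<times> v) \<bullet> w
     \<longleftrightarrow> z \<bullet> u = (scale3 \<mu> v \<times> w) \<bullet> u" for z u
  proof -
    have "scale3 \<sigma> (v \<times> w) \<bullet> u - scale3 \<sigma> (w \<times> u) \<bullet> v + scale3 \<sigma> (u \<times> v) \<bullet> w = 2 * ((scale3 \<mu> v \<times> w) \<bullet> u)"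
      by (simp add: scale3_def inner_vec_def sum_3 cross3_def \<mu>_def field_simps)
    then show ?thesis by simp
  qed
  show ?thesis
    unfolding levi_civita_def
  proof (rule the_equality)
    show "\<psi> (scale3 \<mu> v \<times> w) \<in> sl2 \<and> (\<forall>W\<in>sl2. 2 * g (\<psi> (scale3 \<mu> v \<times> w)) W =
        g (lie_bracket (\<psi> v) (\<psi> w)) W - g (lie_bracket (\<psi> w) W) (\<psi> v) + g (lie_bracket W (\<psi> v)) (\<psi> w))"
    proof (intro conjI ballI \<psi>_in_sl2)
      fix W assume "W \<in> sl2"
      then obtain u where "W = \<psi> u" by (rule sl2_\<psi>)
      then show "2 * g (\<psi> (scale3 \<mu> v \<times> w)) W =
        g (lie_bracket (\<psi> v) (\<psi> w)) W - g (lie_bracket (\<psi> w) W) (\<psi> v) + g (lie_bracket W (\<psi> v)) (\<psi> w)"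
        by (simp only: lie_bracket_\<psi> metric_\<psi> koszul)
    qed
  next
    fix Z
    assume Z: "Z \<in> sl2 \<and> (\<forall>W\<in>sl2. 2 * g Z W =
        g (lie_bracket (\<psi> v) (\<psi> w)) W - g (lie_bracket (\<psi> w) W) (\<psi> v) + g (lie_bracket W (\<psi> v)) (\<psi> w))"
    then obtain z where z: "Z = \<psi> z" using sl2_\<psi> by blast
    have "z \<bullet> u = (scale3 \<mu> v \<times> w) \<bullet> u" for u
      using Z[THEN conjunct2, rule_format, OF \<psi>_in_sl2[of u]]
      by (simp only: z lie_bracket_\<psi> metric_\<psi> koszul)
    then show "Z = \<psi> (scale3 \<mu> v \<times> w)" unfolding z by (metis vector_eq_rdot)
  qed
qed

text \<open>Eigenvalues of the curvature operator: component \<open>i\<close> is the sectional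
  curvature of the plane orthogonal to the \<open>i\<close>-th axis.\<close>

definition K :: "real^3" where
  "K = vector [\<mu>$1 * (\<mu>$2 + \<mu>$3) - \<mu>$2 * \<mu>$3, \<mu>$2 * (\<mu>$1 + \<mu>$3) - \<mu>$1 * \<mu>$3, \<mu>$3 * (\<mu>$1 + \<mu>$2) - \<mu>$1 * \<mu>$2]"

lemma riemann_\<psi>: "riemann g (\<psi> v) (\<psi> w) (\<psi> u) = \<psi> (u \<times> scale3 K (v \<times> w))"
proof -
  \<comment> \<open>Eliminating \<open>\<sigma>\<close> in favour of \<open>\<mu>\<close> turns the
    curvature identity into a polynomial one.\<close>
  have l: "\<sigma>$1 = \<mu>$2 + \<mu>$3" "\<sigma>$2 = \<mu>$1 + \<mu>$3" "\<sigma>$3 = \<mu>$1 + \<mu>$2" by (simp_all add: \<mu>_def field_simps)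
  have "riemann g (\<psi> v) (\<psi> w) (\<psi> u) = \<psi> (scale3 \<mu> v \<times> (scale3 \<mu> w \<times> u) - scale3 \<mu> w \<times> (scale3 \<mu> v \<times> u)
      - scale3 \<mu> (scale3 \<sigma> (v \<times> w)) \<times> u)"
    by (simp add: riemann_def levi_civita_\<psi> lie_bracket_\<psi> \<psi>_linear)
  also have "scale3 \<mu> v \<times> (scale3 \<mu> w \<times> u) - scale3 \<mu> w \<times> (scale3 \<mu> v \<times> u)
      - scale3 \<mu> (scale3 \<sigma> (v \<times> w)) \<times> u = u \<times> scale3 K (v \<times> w)"
    by (simp add: vec_eq_iff forall_3 scale3_def cross3_def K_def l algebra_simps)
  finally show ?thesis .
qed

lemma metric_riemann_\<psi>: "g (riemann g (\<psi> v) (\<psi> w) (\<psi> u)) (\<psi> x) = scale3 K (v \<times> w) \<bullet> (x \<times> u)"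
  unfolding riemann_\<psi> metric_\<psi> by (simp add: inner_vec_def sum_3 cross3_def algebra_simps)

lemma ricci_\<psi>: "ricci g (\<lambda>i. \<psi> (q i)) (\<psi> x) (\<psi> y) = (\<Sum>i\<in>UNIV. scale3 K (q i \<times> x) \<bullet> (q i \<times> y))"
  by (simp add: ricci_def metric_riemann_\<psi>)

lemma sectional_\<psi>:
  assumes "v \<bullet> v = 1" "w \<bullet> w = 1" "v \<bullet> w = 0"
  shows "sectional_curvature g (\<psi> v) (\<psi> w) = scale3 K (v \<times> w) \<bullet> (v \<times> w)"
  by (simp add: sectional_curvature_def metric_riemann_\<psi>, simp add: metric_\<psi> assms)

text \<open>The polynomials of the ODE enter here: all entries of \<open>\<mu>\<close> have the
  common denominator \<open>sqrt a * sqrt b * sqrt c\<close>, and the quadratic expression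
  \<open>K\<close> squares it to \<open>a * b * c\<close>.\<close>

lemma K_eq: "K $ 1 = F1 a b c / (a * b * c)" "K $ 2 = F2 a b c / (a * b * c)" "K $ 3 = F3 a b c / (a * b * c)"
proof -
  define p q r where s: "p = sqrt a" "q = sqrt b" "r = sqrt c"
  have nz: "p \<noteq> 0" "q \<noteq> 0" "r \<noteq> 0" using pos by (auto simp: s)
  have sq: "a = p\<^sup>2" "b = q\<^sup>2" "c = r\<^sup>2" using pos by (auto simp: s)
  have m: "\<mu>$1 = (a + b + c) / (p * q * r)" "\<mu>$2 = (c - a - b) / (p * q * r)" "\<mu>$3 = (b - a - c) / (p * q * r)"
    using nz unfolding \<mu>_def \<sigma>_def s[symmetric] by (simp_all add: sq divide_simps power2_eq_square)
  have *: "a * b * c = p * q * r * (p * q * r)" by (simp add: sq power2_eq_square mult_ac)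
  have **: "x / d * (y / d + z / d) - y / d * (z / d) = (x * (y + z) - y * z) / (d * d)" for x y z d :: real
    by (simp add: add_divide_distrib diff_divide_distrib ring_distribs)
  have K: "K$1 = \<mu>$1 * (\<mu>$2 + \<mu>$3) - \<mu>$2 * \<mu>$3" "K$2 = \<mu>$2 * (\<mu>$1 + \<mu>$3) - \<mu>$1 * \<mu>$3"
     "K$3 = \<mu>$3 * (\<mu>$1 + \<mu>$2) - \<mu>$1 * \<mu>$2"
    by (simp_all add: K_def)
  show "K $ 1 = F1 a b c / (a * b * c)" "K $ 2 = F2 a b c / (a * b * c)" "K $ 3 = F3 a b c / (a * b * c)"
    unfolding K m * ** F1_def F2_def F3_def 
    by (intro arg_cong2[of _ _ _ _ "(/)"] refl, algebra)+
qed

lemma f_\<psi>: "f 1 = sqrt a *\<^sub>R \<psi> (axis 1 1)" "f 2 = sqrt b *\<^sub>R \<psi> (axis 2 1)" "f 3 = sqrt c *\<^sub>R \<psi> (axis 3 1)"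
  using pos by (simp_all add: \<psi>_def axis_def)

text \<open>Uniqueness of the cross curvature tensor: an arbitrary admissible frame is pulled back
  to an orthonormal frame \<open>q\<close>, the axis is expanded in it, and only the diagonal terms
  survive.\<close>

lemma cross_curvature_\<psi>:
  assumes h: "is_cross_curvature g h" and ijl: "distinct [i, j, l]"
  shows "h (\<psi> (axis i 1)) (\<psi> (axis i 1)) = K $ j * K $ l"
proof -
  from h obtain e k where bil: "bilinear h" and on: "orthonormal_frame g e"
    and E: "\<forall>i j. i \<noteq> j \<longrightarrow> ricci g e (e i) (e j) = 0"
      "\<forall>i j l. distinct [i, j, l] \<longrightarrow> k i = sectional_curvature g (e j) (e l)"
      "\<forall>i j. i \<noteq> j \<longrightarrow> h (e i) (e j) = 0"
      "\<forall>i j l. distinct [i, j, l] \<longrightarrow> h (e i) (e i) = k j * k l"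
    unfolding is_cross_curvature_def by (elim conjE exE) assumption
  note ric = E(1)[rule_format] and k = E(2)[rule_format] and h0 = E(3)[rule_format] and h1 = E(4)[rule_format]
  have "\<exists>v. e i = \<psi> v" for i
    using on sl2_\<psi>[of "e i"] unfolding orthonormal_frame_def by blast
  then have "\<forall>i. \<exists>v. e i = \<psi> v" by blast
  from choice[OF this] obtain q where "\<forall>i. e i = \<psi> (q i)" by blast
  then have e: "e = (\<lambda>i. \<psi> (q i))" by auto
  have q: "q i \<bullet> q j = (if i = j then 1 else 0)" for i j
    using on unfolding e orthonormal_frame_def metric_\<psi> by blast
  have kq: "k i = scale3 K (q j \<times> q l) \<bullet> (q j \<times> q l)" if "distinct [i, j, l]" for i j l
    using k[OF that] that sectional_\<psi>[of "q j" "q l"] q by (simp add: e)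
  have "axis i 1 = (\<Sum>m\<in>UNIV. q m $ i *\<^sub>R q m)"
    using orthonormal_expansion[of q "axis i 1", OF q] by (simp add: inner_axis')
  then have ax: "\<psi> (axis i 1) = q 1 $ i *\<^sub>R e 1 + q 2 $ i *\<^sub>R e 2 + q 3 $ i *\<^sub>R e 3"
    by (simp add: sum_3 \<psi>_linear e)
  have "h (\<psi> (axis i 1)) (\<psi> (axis i 1)) = (\<Sum>m\<in>UNIV. (q m $ i)\<^sup>2 * h (e m) (e m))"
    unfolding ax by (simp add: bilinear_ladd[OF bil] bilinear_radd[OF bil] bilinear_lmul[OF bil]
        bilinear_rmul[OF bil] h0 sum_3 power2_eq_square)
  also have "\<dots> = K $ j * K $ l"
  proof (rule cross_curvature_frame_independent[where q = q and \<kappa> = k and H = "\<lambda>m. h (e m) (e m)", OF q _ _ _ ijl])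
    show "(\<Sum>m\<in>UNIV. scale3 K (q m \<times> q i) \<bullet> (q m \<times> q j)) = 0" if "i \<noteq> j" for i j
      using ric[OF that] unfolding e ricci_\<psi> .
  qed (use kq h1 in auto)
  finally show ?thesis .
qed

lemma cross_curvature_frame:
  assumes "is_cross_curvature g h"
  shows "h (f 1) (f 1) = a * (K $ 2 * K $ 3)" "h (f 2) (f 2) = b * (K $ 3 * K $ 1)" "h (f 3) (f 3) = c * (K $ 1 * K $ 2)"
proof -
  have bil: "bilinear h" using assms unfolding is_cross_curvature_def by blast
  show "h (f 1) (f 1) = a * (K $ 2 * K $ 3)" "h (f 2) (f 2) = b * (K $ 3 * K $ 1)" "h (f 3) (f 3) = c * (K $ 1 * K $ 2)"
    using pos cross_curvature_\<psi>[OF assms, of 1 2 3] cross_curvature_\<psi>[OF assms, of 2 3 1] cross_curvature_\<psi>[OF assms, of 3 1 2]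
    by (simp_all add: f_\<psi> bilinear_lmul[OF bil] bilinear_rmul[OF bil] flip: mult.assoc real_sqrt_mult)
qed

text \<open>\<open>dual_frame\<close> is linear on \<open>sl2\<close> only, while a cross curvature
  form has to be bilinear on all matrices. Projecting along the identity matrix extends the form
  without changing it on \<open>sl2\<close>.\<close>

definition traceless :: "mat2 \<Rightarrow> mat2" where
  "traceless X = X - (trace X / 2) *\<^sub>R mat 1"

lemma traceless: "traceless X \<in> sl2" "X \<in> sl2 \<Longrightarrow> traceless X = X" "traceless (X + Y) = traceless X + traceless Y"
    "traceless (r *\<^sub>R X) = r *\<^sub>R traceless X"
  by (simp_all add: traceless_def sl2_def trace_def sum_2 mat_def add_divide_distrib algebra_simps)

definition cc_form :: form2 where
  "cc_form X Y = diag_metric f (a * (K $ 2 * K $ 3)) (b * (K $ 3 * K $ 1)) (c * (K $ 1 * K $ 2)) (traceless X) (traceless Y)"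

lemma cc_form_\<psi>: "cc_form (\<psi> v) (\<psi> w) = v$1 * w$1 * (K $ 2 * K $ 3) + v$2 * w$2 * (K $ 3 * K $ 1) + v$3 * w$3 * (K $ 1 * K $ 2)"
  using pos by (simp add: cc_form_def traceless \<psi>_in_sl2 diag_metric_def dual_frame_\<psi>)

text \<open>Existence of the tensor: the normalized frame itself diagonalizes the Ricci tensor, with
  \<open>K\<close> as the sectional curvatures.\<close>

lemma is_cross_curvature_cc_form: "is_cross_curvature g cc_form"
  unfolding is_cross_curvature_def
proof (intro conjI)
  have "linear (\<lambda>X. dual_frame f i (traceless X))" for i
    by (rule linearI) (simp_all add: traceless dual_frame_add dual_frame_scale)
  then show "bilinear cc_form"
    unfolding bilinear_def cc_form_def diag_metric_def 
    by (intro conjI allI linearI) (simp_all add: traceless dual_frame_add dual_frame_scale algebra_simps)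
  define q :: "3 \<Rightarrow> real^3" where "q i = axis i 1" for i
  have q: "q i \<bullet> q j = (if i = j then 1 else 0)" for i j
    by (simp add: q_def inner_axis_axis)
  show "\<exists>e k. orthonormal_frame g e \<and>
        (\<forall>i j. i \<noteq> j \<longrightarrow> ricci g e (e i) (e j) = 0) \<and>
        (\<forall>i j l. distinct [i, j, l] \<longrightarrow> k i = sectional_curvature g (e j) (e l)) \<and>
        (\<forall>i j. i \<noteq> j \<longrightarrow> cc_form (e i) (e j) = 0) \<and>
        (\<forall>i j l. distinct [i, j, l] \<longrightarrow> cc_form (e i) (e i) = k j * k l)"
  proof (intro exI[of _ "\<lambda>i. \<psi> (q i)"] exI[of _ "\<lambda>i. K $ i"] conjI allI impI)
    show "orthonormal_frame g (\<lambda>i. \<psi> (q i))" by (simp add: orthonormal_frame_def \<psi>_in_sl2 metric_\<psi> q)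
    show "ricci g (\<lambda>i. \<psi> (q i)) (\<psi> (q i)) (\<psi> (q j)) = 0" if "i \<noteq> j" for i j
      using that unfolding ricci_\<psi> sum_scale3_cross_orthonormal[OF q]
      by (simp add: q) (auto simp: q_def scale3_def inner_vec_def axis_def intro!: sum.neutral)
    show "K $ i = sectional_curvature g (\<psi> (q j)) (\<psi> (q l))" if "distinct [i, j, l]" for i j l
      using that exhaust_3[of i] exhaust_3[of j] exhaust_3[of l]
      by (simp add: sectional_\<psi> q) (auto simp: q_def axis_def scale3_def cross3_def inner_vec_def sum_3)
    show "cc_form (\<psi> (q i)) (\<psi> (q j)) = 0" if "i \<noteq> j" for i j
      using that exhaust_3[of i] exhaust_3[of j] by (auto simp: cc_form_\<psi> q_def axis_def)
    show "cc_form (\<psi> (q i)) (\<psi> (q i)) = K $ j * K $ l" if "distinct [i, j, l]" for i j l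
      using that exhaust_3[of i] exhaust_3[of j] exhaust_3[of l] by (auto simp: cc_form_\<psi> q_def axis_def)
  qed
qed

end

unbundle no cross3_syntax

section \<open>Reduction of the flow to the ODE system\<close>

definition xcf_ode :: "(real \<Rightarrow> real) \<Rightarrow> (real \<Rightarrow> real) \<Rightarrow> (real \<Rightarrow> real) \<Rightarrow> real set \<Rightarrow> bool" where
  "xcf_ode A B C I \<longleftrightarrow> (\<forall>t\<in>I. A t > 0 \<and> B t > 0 \<and> C t > 0 \<and>
     (A has_real_derivative 2 * A t * (F2 (A t) (B t) (C t) * F3 (A t) (B t) (C t)) / (A t * B t * C t)\<^sup>2) (at t within I) \<and>
     (B has_real_derivative 2 * B t * (F3 (A t) (B t) (C t) * F1 (A t) (B t) (C t)) / (A t * B t * C t)\<^sup>2) (at t within I) \<and>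
     (C has_real_derivative 2 * C t * (F1 (A t) (B t) (C t) * F2 (A t) (B t) (C t)) / (A t * B t * C t)\<^sup>2) (at t within I))"

text \<open>Forwards, the tensor equation is evaluated on the pairs \<open>f i\<close>,
  \<open>f i\<close>, where every admissible form has the same value; backwards,
  \<open>cc_form\<close> is the witness.\<close>

lemma positive_xcf_iff_ode:
  assumes "sl2_frame f"
  shows "positive_xcf f A B C T \<longleftrightarrow> xcf_ode A B C {0..<T}"
proof
  assume P: "positive_xcf f A B C T"
  show "xcf_ode A B C {0..<T}"
    unfolding xcf_ode_def
  proof
    fix t assume "t \<in> {0..<T}"
    with P obtain h where pos: "A t > 0" "B t > 0" "C t > 0"
      and h: "is_cross_curvature (diag_metric f (A t) (B t) (C t)) h"
      and d: "\<forall>X\<in>sl2. \<forall>Y\<in>sl2. 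
           ((\<lambda>s. diag_metric f (A s) (B s) (C s) X Y) has_real_derivative 2 * h X Y) (at t within {0..<T})"
      unfolding positive_xcf_def by blast
    note d = d[rule_format]
    interpret sl2_diag_metric f "A t" "B t" "C t" by unfold_locales (use assms pos in auto)
    show "A t > 0 \<and> B t > 0 \<and> C t > 0 \<and>
     (A has_real_derivative 2 * A t * (F2 (A t) (B t) (C t) * F3 (A t) (B t) (C t)) / (A t * B t * C t)\<^sup>2) (at t within {0..<T}) \<and>
     (B has_real_derivative 2 * B t * (F3 (A t) (B t) (C t) * F1 (A t) (B t) (C t)) / (A t * B t * C t)\<^sup>2) (at t within {0..<T}) \<and>
     (C has_real_derivative 2 * C t * (F1 (A t) (B t) (C t) * F2 (A t) (B t) (C t)) / (A t * B t * C t)\<^sup>2) (at t within {0..<T})"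
      using pos d[OF f_in_sl2 f_in_sl2, of 1 1] d[OF f_in_sl2 f_in_sl2, of 2 2] d[OF f_in_sl2 f_in_sl2, of 3 3]
      unfolding cross_curvature_frame[OF h] K_eq
      by (simp add: diag_metric_def dual_frame_basis power2_eq_square mult.assoc)
  qed
next
  assume ode: "xcf_ode A B C {0..<T}"
  show "positive_xcf f A B C T"
    unfolding positive_xcf_def
  proof
    fix t assume "t \<in> {0..<T}"
    with ode have pos: "A t > 0" "B t > 0" "C t > 0"
     and d: "(A has_real_derivative 2 * A t * (F2 (A t) (B t) (C t) * F3 (A t) (B t) (C t)) / (A t * B t * C t)\<^sup>2) (at t within {0..<T})"
     "(B has_real_derivative 2 * B t * (F3 (A t) (B t) (C t) * F1 (A t) (B t) (C t)) / (A t * B t * C t)\<^sup>2) (at t within {0..<T})"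
     "(C has_real_derivative 2 * C t * (F1 (A t) (B t) (C t) * F2 (A t) (B t) (C t)) / (A t * B t * C t)\<^sup>2) (at t within {0..<T})"
      unfolding xcf_ode_def by blast+
    interpret sl2_diag_metric f "A t" "B t" "C t" by unfold_locales (use assms pos in auto)
    have "((\<lambda>s. diag_metric f (A s) (B s) (C s) X Y) has_real_derivative 2 * cc_form X Y) (at t within {0..<T})"
      if "X \<in> sl2" "Y \<in> sl2" for X Y
      unfolding diag_metric_def
      by (rule DERIV_cong, (rule DERIV_add DERIV_cmult_right d)+)
        (simp add: cc_form_def traceless that diag_metric_def K_eq,
         simp add: power2_eq_square mult.assoc ring_distribs)
    then show "A t > 0 \<and> B t > 0 \<and> C t > 0 \<and> (\<exists>h. is_cross_curvature (diag_metric f (A t) (B t) (C t)) h \<and>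
        (\<forall>X\<in>sl2. \<forall>Y\<in>sl2. ((\<lambda>s. diag_metric f (A s) (B s) (C s) X Y) has_real_derivative 2 * h X Y) (at t within {0..<T})))"
      using pos is_cross_curvature_cc_form by blast
  qed
qed

section \<open>Limits at the maximal time\<close>

lemma mono_bounded_tendsto_at_left:
  fixes f :: "real \<Rightarrow> real"
  assumes "a < T" and mono: "\<And>s t. a < s \<Longrightarrow> s \<le> t \<Longrightarrow> t < T \<Longrightarrow> f s \<le> f t"
    and bdd: "\<And>t. a < t \<Longrightarrow> t < T \<Longrightarrow> f t \<le> M"
  obtains l where "(f \<longlongrightarrow> l) (at_left T)"
proof
  define l where "l = Sup (f ` {a<..<T})"
  have bd: "bdd_above (f ` {a<..<T})" using bdd by (intro bdd_aboveI2[of _ _ M]) auto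
  have ne: "f ` {a<..<T} \<noteq> {}" using \<open>a < T\<close> by simp
  show "(f \<longlongrightarrow> l) (at_left T)"
  proof (rule order_tendstoI)
    fix y assume "y < l"
    then obtain s where s: "a < s" "s < T" "y < f s"
      unfolding l_def using less_cSup_iff[OF ne bd] by auto
    then have "\<forall>t>s. t < T \<longrightarrow> y < f t" using mono[of s] by (meson less_imp_le less_le_trans)
    then show "\<forall>\<^sub>F t in at_left T. y < f t" using s eventually_at_left_field by blast
  next
    fix y assume "l < y"
    have "f t \<le> l" if "a < t" "t < T" for t
      unfolding l_def using that bd by (intro cSup_upper) auto
    then have "\<forall>t>a. t < T \<longrightarrow> f t < y" using \<open>l < y\<close> by (meson le_less_trans)
    then show "\<forall>\<^sub>F t in at_left T. f t < y" using \<open>a < T\<close> eventually_at_left_field by blast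
  qed
qed

text \<open>The convergent function \<open>s\<close> serves as a clock: \<open>u - K * s\<close> is
  nondecreasing and \<open>u + K * s\<close> nonincreasing, so the former is monotone and bounded
  above.\<close>

lemma converges_if_deriv_dominated:
  fixes u s :: "real \<Rightarrow> real"
  assumes "a < T" and "\<And>t. a < t \<Longrightarrow> t < T \<Longrightarrow> (u has_real_derivative u' t) (at t)"
    and "\<And>t. a < t \<Longrightarrow> t < T \<Longrightarrow> (s has_real_derivative s' t) (at t)"
    and dom: "\<And>t. a < t \<Longrightarrow> t < T \<Longrightarrow> \<bar>u' t\<bar> \<le> - K * s' t"
    and "\<And>t. a < t \<Longrightarrow> t < T \<Longrightarrow> 0 < s t" and "K \<ge> 0" and lim: "(s \<longlongrightarrow> \<sigma>) (at_left T)"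
  obtains l where "(u \<longlongrightarrow> l) (at_left T)"
proof -
  have m1: "u p - K * s p \<le> u q - K * s q" if "a < p" "p \<le> q" "q < T" for p q
  proof (rule DERIV_nonneg_imp_nondecreasing[OF \<open>p \<le> q\<close>], intro exI conjI)
    fix x assume x: "p \<le> x" "x \<le> q"
    show "((\<lambda>t. u t - K * s t) has_real_derivative (u' x - K * s' x)) (at x)"
      using x that by (intro DERIV_diff DERIV_cmult assms) auto
    show "0 \<le> u' x - K * s' x" using dom[of x] x that by linarith
  qed
  have m2: "u q + K * s q \<le> u p + K * s p" if "a < p" "p \<le> q" "q < T" for p q
  proof (rule DERIV_nonpos_imp_nonincreasing[OF \<open>p \<le> q\<close>], intro exI conjI)
    fix x assume x: "p \<le> x" "x \<le> q"
    show "((\<lambda>t. u t + K * s t) has_real_derivative (u' x + K * s' x)) (at x)"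
      using x that by (intro DERIV_add DERIV_cmult assms) auto
    show "u' x + K * s' x \<le> 0" using dom[of x] x that by linarith
  qed
  define b where "b = (a + T) / 2"
  have b: "a < b" "b < T" using \<open>a < T\<close> by (auto simp: b_def)
  have "u t - K * s t \<le> u b + K * s b" if "b < t" "t < T" for t
  proof -
    have "0 \<le> K * s t" using assms(5)[of t] \<open>K \<ge> 0\<close> that b by simp
    then show ?thesis using m2[of b t] that b by linarith
  qed
  then obtain l where "((\<lambda>t. u t - K * s t) \<longlongrightarrow> l) (at_left T)"
    using mono_bounded_tendsto_at_left[of b T "\<lambda>t. u t - K * s t"] m1 b by (metis less_trans)
  from tendsto_add[OF this tendsto_mult_left[OF lim, of K]]
  have "(u \<longlongrightarrow> l + K * \<sigma>) (at_left T)" by simp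
  with that show ?thesis .
qed

lemma quotient_tendsto_if_deriv_tendsto:
  fixes q :: "real \<Rightarrow> real"
  assumes "(q \<longlongrightarrow> 0) (at_left T)" and "(q' \<longlongrightarrow> l) (at_left T)"
    and "eventually (\<lambda>t. (q has_real_derivative q' t) (at t)) (at_left T)"
  shows "((\<lambda>t. q t / (T - t)) \<longlongrightarrow> - l) (at_left T)"
proof (rule lhopital_left[where f' = q' and g' = "\<lambda>_. - 1"])
  show "((\<lambda>t. T - t) \<longlongrightarrow> 0) (at_left T)" using tendsto_diff[OF tendsto_const tendsto_ident_at, of T T "{..<T}"] by simp
  show "\<forall>\<^sub>F t in at_left T. T - t \<noteq> 0"
    using eventually_at_left_real[of "T - 1" T] by (auto elim: eventually_mono)
  show "\<forall>\<^sub>F x in at_left T. ((-) T has_real_derivative - 1) (at x)"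
    by (auto intro!: always_eventually derivative_eq_intros)
  show "((\<lambda>x. q' x / - 1) \<longlongrightarrow> - l) (at_left T)"
    using tendsto_minus[OF assms(2)] by simp
qed (use assms in auto)

text \<open>\<open>Y X\<^sup>3\<close> and \<open>Z X\<^sup>3\<close> converge to positive limits, because their logarithmic derivatives are
  dominated by the derivative of \<open>(Y + Z) / X\<close>; hence \<open>X powr (-14)\<close> has a negative limiting slope.\<close>

lemma terminal_asymptotics:
  fixes X Y Z P Q R :: "real \<Rightarrow> real"
  assumes "a < T"
    and pos: "\<And>t. a < t \<Longrightarrow> t < T \<Longrightarrow> 0 < X t \<and> 0 < Y t \<and> 0 < Z t"
    and X': "\<And>t. a < t \<Longrightarrow> t < T \<Longrightarrow> (X has_real_derivative 2 * X t * (Q t * R t) / (X t * Y t * Z t)\<^sup>2) (at t)"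
    and Y': "\<And>t. a < t \<Longrightarrow> t < T \<Longrightarrow> (Y has_real_derivative 2 * Y t * (R t * P t) / (X t * Y t * Z t)\<^sup>2) (at t)"
    and Z': "\<And>t. a < t \<Longrightarrow> t < T \<Longrightarrow> (Z has_real_derivative 2 * Z t * (P t * Q t) / (X t * Y t * Z t)\<^sup>2) (at t)"
    and bnd: "\<And>t. a < t \<Longrightarrow> t < T \<Longrightarrow> Y t \<le> X t \<Longrightarrow> Z t \<le> X t \<Longrightarrow>
       \<bar>P t + 3 * (X t)\<^sup>2\<bar> \<le> K * X t * (Y t + Z t) \<and> \<bar>Q t - (X t)\<^sup>2\<bar> \<le> K * X t * (Y t + Z t)
       \<and> \<bar>R t - (X t)\<^sup>2\<bar> \<le> K * X t * (Y t + Z t)"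
    and K: "K \<ge> 1"
    and Y0: "((\<lambda>t. Y t / X t) \<longlongrightarrow> 0) (at_left T)" and Z0: "((\<lambda>t. Z t / X t) \<longlongrightarrow> 0) (at_left T)"
  shows "\<exists>\<eta>1>0. \<exists>\<eta>2>0. \<exists>\<eta>3>0. X \<sim>[at_left T] (\<lambda>t. \<eta>1 * (T - t) powr (-1/14)) \<and>
     Y \<sim>[at_left T] (\<lambda>t. \<eta>2 * (T - t) powr (3/14)) \<and> Z \<sim>[at_left T] (\<lambda>t. \<eta>3 * (T - t) powr (3/14))"
proof -
  define s where "s t = Y t / X t + Z t / X t" for t
  have s0: "(s \<longlongrightarrow> 0) (at_left T)" unfolding s_def using tendsto_add[OF Y0 Z0] by simp
  \<comment> \<open>Keeps the normalized factors \<open>p\<close>, \<open>q\<close>,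
    \<open>r\<close> within 1/10 of their limits -3, 1, 1.\<close>
  have "0 < 1 / (10 * K)" using K by simp
  from order_tendstoD(2)[OF s0 this]
  have "eventually (\<lambda>t. s t < 1 / (10 * K)) (at_left T)" .
  then obtain b' where b': "b' < T" "\<forall>t>b'. t < T \<longrightarrow> s t < 1 / (10 * K)"
    unfolding eventually_at_left_field by blast
  define b where "b = max a b'"
  have b: "b < T" "a \<le> b" "\<And>t. b < t \<Longrightarrow> t < T \<Longrightarrow> K * s t < 1/10"
    using b' \<open>a < T\<close> K by (auto simp: b_def field_simps)
  define p q r \<nu> where "p t = P t / (X t)\<^sup>2" and "q t = Q t / (X t)\<^sup>2" and "r t = R t / (X t)\<^sup>2"
    and "\<nu> t = (X t)^4 / (X t * Y t * Z t)\<^sup>2" for t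
  have pos': "0 < X t" "0 < Y t" "0 < Z t" "0 < s t" "0 < \<nu> t" if "b < t" "t < T" for t
    using pos[of t] that b by (auto simp: s_def \<nu>_def intro!: add_pos_pos)
  have close: "\<bar>p t + 3\<bar> \<le> K * s t" "\<bar>q t - 1\<bar> \<le> K * s t" "\<bar>r t - 1\<bar> \<le> K * s t" if t: "b < t" "t < T" for t
  proof -
    have Xp: "X t > 0" and Yp: "Y t > 0" and Zp: "Z t > 0" using pos' t by auto
    have "s t \<le> K * s t" using K pos'(4)[OF t] by simp
    then have s1: "s t < 1" using b(3)[OF t] by linarith
    have "Y t / X t < 1" "Z t / X t < 1" using s1 Xp Yp Zp divide_pos_pos[of "Y t" "X t"] divide_pos_pos[of "Z t" "X t"]
      unfolding s_def by linarith+
    then have "Y t \<le> X t" "Z t \<le> X t" using Xp by (auto simp: field_simps)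
    note B = bnd[OF _ t(2) this]
    have Ks: "K * s t = K * X t * (Y t + Z t) / (X t)\<^sup>2"
      using Xp by (simp add: s_def field_simps power2_eq_square)
    have e: "p t + 3 = (P t + 3 * (X t)\<^sup>2) / (X t)\<^sup>2" "q t - 1 = (Q t - (X t)\<^sup>2) / (X t)\<^sup>2"
      "r t - 1 = (R t - (X t)\<^sup>2) / (X t)\<^sup>2"
      using Xp by (auto simp: p_def q_def r_def field_simps)
    show "\<bar>p t + 3\<bar> \<le> K * s t" "\<bar>q t - 1\<bar> \<le> K * s t" "\<bar>r t - 1\<bar> \<le> K * s t"
      unfolding e Ks abs_divide using B t b Xp by (auto intro!: divide_right_mono)
  qed
  have X'': "(X has_real_derivative X t * (2 * (q t * r t) * \<nu> t)) (at t)"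
    and Y'': "(Y has_real_derivative Y t * (2 * (r t * p t) * \<nu> t)) (at t)"
    and Z'': "(Z has_real_derivative Z t * (2 * (p t * q t) * \<nu> t)) (at t)" if t: "b < t" "t < T" for t
  proof -
    have e: "2 * x * (m * n) / N = x * (2 * (m / (X t)\<^sup>2 * (n / (X t)\<^sup>2)) * ((X t)^4 / N))" for x m n N
      using pos'(1)[OF t] by (simp add: field_simps power2_eq_square power4_eq_xxxx)
    show "(X has_real_derivative X t * (2 * (q t * r t) * \<nu> t)) (at t)"
      "(Y has_real_derivative Y t * (2 * (r t * p t) * \<nu> t)) (at t)"
      "(Z has_real_derivative Z t * (2 * (p t * q t) * \<nu> t)) (at t)"
      unfolding p_def q_def r_def \<nu>_def e[symmetric] using X' Y' Z' t b by auto
  qed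
  define s' where "s' t = Y t / X t * (2 * r t * (p t - q t) * \<nu> t) + Z t / X t * (2 * q t * (p t - r t) * \<nu> t)" for t
  have ds: "(s has_real_derivative s' t) (at t)" if t: "b < t" "t < T" for t
    unfolding s_def s'_def using pos'[OF t]
    by (auto intro!: derivative_eq_intros X''[OF t] Y''[OF t] Z''[OF t] simp: field_simps)
  \<comment> \<open>In the limit both coefficients in \<open>s'\<close> are
    \<open>2 * 1 * (- 3 - 1) = - 8\<close> times the rate; -4 leaves room for the errors of size
    1/10.\<close>
  have s'le: "s' t \<le> - 4 * s t * \<nu> t" if t: "b < t" "t < T" for t
  proof -
    have *: "2 * x * (p t - y) * \<nu> t \<le> -4 * \<nu> t" if "\<bar>x - 1\<bar> \<le> K * s t" "\<bar>y - 1\<bar> \<le> K * s t" for x y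
    proof -
      have "p t - y \<le> - 3" "9/10 \<le> x" using close(1)[OF t] that b(3)[OF t] by linarith+
      then have "(9/10) * 3 \<le> x * (y - p t)" by (intro mult_mono) auto
      then have "2 * x * (p t - y) \<le> -4" by (simp add: algebra_simps)
      then show ?thesis using pos'(5)[OF t] by (intro mult_right_mono) auto
    qed
    have "s' t \<le> Y t / X t * (-4 * \<nu> t) + Z t / X t * (-4 * \<nu> t)"
      unfolding s'_def using pos'[OF t] close[OF t] by (intro add_mono mult_left_mono *) auto
    then show ?thesis by (simp add: s_def algebra_simps)
  qed
  \<comment> \<open>Serves \<open>Y\<close> and \<open>Z\<close> at once. Writing
    \<open>q * r\<close> as \<open>x * y\<close>, the logarithmic derivative of
    \<open>W * X^3\<close> is \<open>2 * x * (p + 3 * y)\<close> times the rate; the limits -3 and 3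
    cancel, so it is of order \<open>s\<close>.\<close>
  have lim: "\<exists>l>0. ((\<lambda>t. W t * (X t)^3) \<longlongrightarrow> l) (at_left T)"
    if W: "\<And>t. b < t \<Longrightarrow> t < T \<Longrightarrow> W t > 0"
      and W': "\<And>t. b < t \<Longrightarrow> t < T \<Longrightarrow> (W has_real_derivative W t * (2 * (x t * p t) * \<nu> t)) (at t)"
      and xy: "\<And>t. x t * y t = q t * r t" "\<And>t. b < t \<Longrightarrow> t < T \<Longrightarrow> \<bar>x t - 1\<bar> \<le> K * s t \<and> \<bar>y t - 1\<bar> \<le> K * s t" for W x y
  proof -
    define u' where "u' t = 2 * x t * (p t + 3 * y t) * \<nu> t" for t
    have du: "((\<lambda>t. ln (W t) + 3 * ln (X t)) has_real_derivative u' t) (at t)" if t: "b < t" "t < T" for t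
    proof -
      have "((\<lambda>t. ln (W t) + 3 * ln (X t)) has_real_derivative 2 * (x t * p t) * \<nu> t + 3 * (2 * (q t * r t) * \<nu> t)) (at t)"
        using pos'[OF t] W[OF t]
        by (auto intro!: derivative_eq_intros X''[OF t] W'[OF t] simp: field_simps)
      then show ?thesis unfolding xy(1)[symmetric] u'_def by (simp add: algebra_simps)
    qed
    have "\<bar>u' t\<bar> \<le> - (4 * K) * s' t" if t: "b < t" "t < T" for t
    proof -
      have "\<bar>p t + 3 * y t\<bar> \<le> 4 * (K * s t)" using close(1)[OF t] xy(2)[OF t] by linarith
      moreover have "\<bar>2 * x t\<bar> \<le> 4" using xy(2)[OF t] b(3)[OF t] by linarith
      ultimately have "\<bar>2 * x t\<bar> * \<bar>p t + 3 * y t\<bar> \<le> 4 * (4 * (K * s t))" by (intro mult_mono) auto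
      then have "\<bar>2 * x t\<bar> * \<bar>p t + 3 * y t\<bar> * \<nu> t \<le> 4 * (4 * (K * s t)) * \<nu> t"
        using pos'(5)[OF t] by (intro mult_right_mono) auto
      also have "\<dots> = (4 * K) * (4 * s t * \<nu> t)" by simp
      also have "\<dots> \<le> (4 * K) * (- s' t)" using s'le[OF t] K by (intro mult_left_mono) auto
      finally show ?thesis using pos'(5)[OF t] by (simp add: u'_def abs_mult)
    qed
    from converges_if_deriv_dominated[OF b(1) du ds this pos'(4) _ s0] K
    obtain l where l: "((\<lambda>t. ln (W t) + 3 * ln (X t)) \<longlongrightarrow> l) (at_left T)" by auto
    have "\<forall>\<^sub>F t in at_left T. exp (ln (W t) + 3 * ln (X t)) = W t * (X t)^3"
      using eventually_at_left_real[OF b(1)] W pos'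
      by (auto elim!: eventually_mono simp: exp_add power3_eq_cube) (simp add: exp_of_nat_mult[of 3, simplified] power3_eq_cube)
    with tendsto_exp[OF l] have "((\<lambda>t. W t * (X t)^3) \<longlongrightarrow> exp l) (at_left T)"
      by (rule Lim_transform_eventually)
    then show ?thesis by (intro exI[of _ "exp l"]) auto
  qed
  obtain \<beta> where \<beta>: "\<beta> > 0" "((\<lambda>t. Y t * (X t)^3) \<longlongrightarrow> \<beta>) (at_left T)"
    using lim[of Y r q] pos' Y'' close by (auto simp: mult.commute)
  obtain \<gamma> where \<gamma>: "\<gamma> > 0" "((\<lambda>t. Z t * (X t)^3) \<longlongrightarrow> \<gamma>) (at_left T)"
    using lim[of Z q r] pos' Z'' close by (auto simp: mult.commute)
  \<comment> \<open>The power 14 is the one for which every remaining power of \<open>X\<close> in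
    the derivative is absorbed into \<open>Y * X^3\<close> and \<open>Z * X^3\<close>, so that the
    derivative converges.\<close>
  define w where "w t = inverse (X t ^ 14)" for t
  define w' where "w' t = - 28 * (q t * r t) / ((Y t * (X t)^3)\<^sup>2 * (Z t * (X t)^3)\<^sup>2)" for t
  have dw: "\<forall>\<^sub>F t in at_left T. (w has_real_derivative w' t) (at t)"
    using eventually_at_left_real[OF b(1)]
  proof (rule eventually_mono)
    fix t assume "t \<in> {b<..<T}"
    then have t: "b < t" "t < T" by auto
    have "(w has_real_derivative - (inverse (X t ^ 14) * (14 * X t ^ 13 * (X t * (2 * (q t * r t) * \<nu> t))) * inverse (X t ^ 14))) (at t)"
      unfolding w_def using pos'(1)[OF t]
      by (auto intro!: derivative_eq_intros X''[OF t])
    moreover have "- (inverse (X t ^ 14) * (14 * X t ^ 13 * (X t * (2 * (q t * r t) * \<nu> t))) * inverse (X t ^ 14)) = w' t"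
      using pos'[OF t] unfolding w'_def \<nu>_def by (simp add: field_simps power_mult_distrib eval_nat_numeral)
    ultimately show "(w has_real_derivative w' t) (at t)" by simp
  qed
  have squeeze: "(x \<longlongrightarrow> 1) (at_left T)" if "\<And>t. b < t \<Longrightarrow> t < T \<Longrightarrow> \<bar>x t - 1\<bar> \<le> K * s t" for x
  proof -
    have "((\<lambda>t. x t - 1) \<longlongrightarrow> 0) (at_left T)"
      by (rule Lim_null_comparison[of _ "\<lambda>t. K * s t"])
        (use that eventually_at_left_real[OF b(1)] tendsto_mult_left[OF s0, of K] in \<open>auto elim!: eventually_mono\<close>)
    from tendsto_add[OF this tendsto_const[of 1]] show ?thesis by simp
  qed
  define \<delta> where "\<delta> = 28 / (\<beta>\<^sup>2 * \<gamma>\<^sup>2)"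
  have \<delta>: "\<delta> > 0" using \<beta> \<gamma> by (simp add: \<delta>_def)
  have "(w' \<longlongrightarrow> - 28 * (1 * 1) / (\<beta>\<^sup>2 * \<gamma>\<^sup>2)) (at_left T)"
    unfolding w'_def using \<beta> \<gamma> close
    by (intro tendsto_intros squeeze) auto
  then have w'lim: "(w' \<longlongrightarrow> - \<delta>) (at_left T)" by (simp add: \<delta>_def)
  \<comment> \<open>\<open>X\<close> tends to infinity: \<open>Y / X\<close> divided by the
    convergent \<open>Y * X^3\<close> is \<open>X\<close> to the power -4, and the square root of
    its seventh power is \<open>w\<close>.\<close>
  have "((\<lambda>t. (Y t / X t) / (Y t * (X t)^3)) \<longlongrightarrow> 0 / \<beta>) (at_left T)"
    using Y0 \<beta> by (intro tendsto_divide) auto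
  then have "((\<lambda>t. sqrt (((Y t / X t) / (Y t * (X t)^3))^7)) \<longlongrightarrow> sqrt ((0 / \<beta>)^7)) (at_left T)"
    by (intro tendsto_real_sqrt tendsto_power)
  moreover have "\<forall>\<^sub>F t in at_left T. sqrt (((Y t / X t) / (Y t * (X t)^3))^7) = w t"
    using eventually_at_left_real[OF b(1)]
  proof (rule eventually_mono)
    fix t assume "t \<in> {b<..<T}"
    then have t: "b < t" "t < T" by auto
    have "(Y t / X t) / (Y t * (X t)^3) = inverse (X t ^ 4)"
      using pos'[OF t] by (simp add: field_simps eval_nat_numeral)
    then have "((Y t / X t) / (Y t * (X t)^3))^7 = (w t)\<^sup>2"
      by (simp add: w_def power_inverse flip: power_mult)
    then show "sqrt (((Y t / X t) / (Y t * (X t)^3))^7) = w t"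
      using pos'[OF t] by (simp add: w_def)
  qed
  ultimately have w0: "(w \<longlongrightarrow> 0) (at_left T)"
    by (auto dest: Lim_transform_eventually)
  from quotient_tendsto_if_deriv_tendsto[OF w0 w'lim dw]
  have wq: "((\<lambda>t. w t / (T - t)) \<longlongrightarrow> \<delta>) (at_left T)" by simp
  define \<eta> where "\<eta> = \<delta> powr (-1/14)"
  have \<eta>: "\<eta> > 0" using \<delta> by (simp add: \<eta>_def)
  have "((\<lambda>t. (w t / (T - t)) powr (-1/14)) \<longlongrightarrow> \<eta>) (at_left T)"
    unfolding \<eta>_def using wq \<delta> by (intro tendsto_intros) auto
  moreover have "\<forall>\<^sub>F t in at_left T. (w t / (T - t)) powr (-1/14) = X t / (T - t) powr (-1/14)"
    using eventually_at_left_real[OF b(1)]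
  proof (rule eventually_mono)
    fix t assume "t \<in> {b<..<T}"
    then have t: "b < t" "t < T" by auto
    have "w t = X t powr (-14)"
      using pos'[OF t] by (simp add: w_def powr_minus powr_numeral)
    then have "w t powr (-1/14) = X t" using pos'[OF t] by (simp add: powr_powr)
    then show "(w t / (T - t)) powr (-1/14) = X t / (T - t) powr (-1/14)"
      using pos'[OF t] t by (simp add: w_def powr_divide)
  qed
  ultimately have Xlim: "((\<lambda>t. X t / (T - t) powr (-1/14)) \<longlongrightarrow> \<eta>) (at_left T)"
    by (rule Lim_transform_eventually)
  have Wlim: "((\<lambda>t. W t / (T - t) powr (3/14)) \<longlongrightarrow> l / \<eta>^3) (at_left T)"
    if "((\<lambda>t. W t * (X t)^3) \<longlongrightarrow> l) (at_left T)" for W l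
  proof -
    have "((\<lambda>t. (W t * (X t)^3) / (X t / (T - t) powr (-1/14))^3) \<longlongrightarrow> l / \<eta>^3) (at_left T)"
      using that Xlim \<eta> by (intro tendsto_intros) auto
    moreover have "\<forall>\<^sub>F t in at_left T. (W t * (X t)^3) / (X t / (T - t) powr (-1/14))^3 = W t / (T - t) powr (3/14)"
      using eventually_at_left_real[OF b(1)]
    proof (rule eventually_mono)
      fix t assume "t \<in> {b<..<T}"
      then have t: "b < t" "t < T" by auto
      have "((T - t) powr (-1/14))^3 = (T - t) powr (- (3/14))"
        using t by (simp add: powr_powr flip: powr_realpow)
      also have "\<dots> = 1 / (T - t) powr (3/14)" by (simp add: powr_minus field_simps)
      finally show "(W t * (X t)^3) / (X t / (T - t) powr (-1/14))^3 = W t / (T - t) powr (3/14)"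
        using pos'[OF t] t by (simp add: power_divide)
    qed
    ultimately show ?thesis by (rule Lim_transform_eventually)
  qed
  show ?thesis
  proof (intro exI conjI)
    show "X \<sim>[at_left T] (\<lambda>t. \<eta> * (T - t) powr (-1/14))"
      using Xlim \<eta> by (intro asymp_equivI'_const) auto
    show "Y \<sim>[at_left T] (\<lambda>t. (\<beta> / \<eta>^3) * (T - t) powr (3/14))"
      using Wlim[OF \<beta>(2)] \<eta> \<beta> by (intro asymp_equivI'_const) auto
    show "Z \<sim>[at_left T] (\<lambda>t. (\<gamma> / \<eta>^3) * (T - t) powr (3/14))"
      using Wlim[OF \<gamma>(2)] \<eta> \<gamma> by (intro asymp_equivI'_const) auto
  qed (use \<eta> \<beta> \<gamma> in auto)
qed

lemma antimono_tendsto_zero: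
  fixes q :: "real \<Rightarrow> real"
  assumes anti: "\<And>x y. s \<le> x \<Longrightarrow> x \<le> y \<Longrightarrow> y < T \<Longrightarrow> q y \<le> q x" and pos: "\<And>x. s \<le> x \<Longrightarrow> x < T \<Longrightarrow> 0 \<le> q x"
    and inf: "\<And>e. e > 0 \<Longrightarrow> \<exists>x\<ge>s. x < T \<and> q x < e"
  shows "(q \<longlongrightarrow> 0) (at_left T)"
proof (rule order_tendstoI)
  obtain x where "s \<le> x" "x < T" using inf[of 1] by auto
  fix y :: real
  assume "y < 0"
  then have "\<forall>z>x. z < T \<longrightarrow> y < q z" using pos \<open>s \<le> x\<close> by (meson less_imp_le less_le_trans order_trans)
  then show "\<forall>\<^sub>F z in at_left T. y < q z" using \<open>x < T\<close> eventually_at_left_field by blast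
next
  fix y :: real
  assume "0 < y"
  then obtain x where x: "s \<le> x" "x < T" "q x < y" using inf by blast
  then have "\<forall>z>x. z < T \<longrightarrow> q z < y" using anti by (meson less_imp_le le_less_trans)
  then show "\<forall>\<^sub>F z in at_left T. q z < y" using \<open>x < T\<close> eventually_at_left_field by blast
qed

section \<open>The three regimes\<close>

text \<open>In logarithmic coordinates positivity is automatic, the field is a polynomial in
  exponentials and hence Lipschitz on balls, and a bounded solution is one whose coefficients stay
  in a compact subset of the positive reals. So a finite maximal time means leaving every
  \<open>{m..M}\<close>, after any given time \<open>s\<close>.\<close>

lemma xcf_maximal_ode:
  fixes A0 B0 C0 :: real
  assumes pos: "A0 > 0" "B0 > 0" "C0 > 0"
  obtains A B C I where "I = {0..} \<or> (\<exists>T>0. I = {0..<T})" "A 0 = A0" "B 0 = B0" "C 0 = C0" "xcf_ode A B C I"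
    "\<And>A' B' C' T t. xcf_ode A' B' C' {0..<T} \<Longrightarrow> A' 0 = A0 \<Longrightarrow> B' 0 = B0 \<Longrightarrow> C' 0 = C0 \<Longrightarrow>
       t \<in> {0..<T} \<Longrightarrow> t \<in> I \<and> A' t = A t \<and> B' t = B t \<and> C' t = C t"
    "\<And>T s m M. I = {0..<T} \<Longrightarrow> s \<in> I \<Longrightarrow> 0 < m \<Longrightarrow> \<exists>t\<in>I. s \<le> t \<and> \<not> {A t, B t, C t} \<subseteq> {m..M}"
proof -
  define G :: "real \<times> real \<times> real \<Rightarrow> real \<times> real \<times> real" where
    "G p = (let a = exp (fst p); b = exp (fst (snd p)); c = exp (snd (snd p));
               w = 2 * exp (- 2 * (fst p + fst (snd p) + snd (snd p))) 
            in (F2 a b c * F3 a b c * w, F3 a b c * F1 a b c * w, F1 a b c * F2 a b c * w))" for p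
  have G_ln: "G (ln a, ln b, ln c) = (2 * (F2 a b c * F3 a b c) / (a * b * c)\<^sup>2,
      2 * (F3 a b c * F1 a b c) / (a * b * c)\<^sup>2, 2 * (F1 a b c * F2 a b c) / (a * b * c)\<^sup>2)"
    if "a > 0" "b > 0" "c > 0" for a b c
  proof -
    have "exp (ln a + ln b + ln c) = a * b * c" using that by (simp add: exp_add)
    then have "exp (- 2 * (ln a + ln b + ln c)) = 1 / (a * b * c)\<^sup>2"
      using exp_double[of "ln a + ln b + ln c"] exp_minus[of "2 * (ln a + ln b + ln c)"]
      by (simp add: inverse_eq_divide)
    with that show ?thesis by (simp add: G_def Let_def)
  qed
  have coord: "loc_lip (\<lambda>p :: real \<times> real \<times> real. fst p)" "loc_lip (\<lambda>p :: real \<times> real \<times> real. fst (snd p))"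
     "loc_lip (\<lambda>p :: real \<times> real \<times> real. snd (snd p))"
    by (intro loc_lip_bounded_linear bounded_linear_fst
        bounded_linear_compose[OF bounded_linear_fst bounded_linear_snd]
        bounded_linear_compose[OF bounded_linear_snd bounded_linear_snd])+
  have "loc_lip G"
    unfolding G_def Let_def F1_def F2_def F3_def power2_eq_square
    by (intro loc_lip_intros coord loc_lip_compose[OF _ loc_lip_exp])
  then have "\<And>R. \<exists>L. L-lipschitz_on (cball 0 R) G" by (simp add: loc_lip_def)
  then obtain J x where
    J: "J = {0..} \<or> (\<exists>T>0. J = {0..<T})" and x0: "x 0 = (ln A0, ln B0, ln C0)"
    and x: "\<And>t. t \<in> J \<Longrightarrow> (x has_vector_derivative G (x t)) (at t within J)"
    and uniq: "\<And>y T t. ode_sol G (ln A0, ln B0, ln C0) y T \<Longrightarrow> t \<in> {0..<T} \<Longrightarrow> t \<in> J \<and> y t = x t"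
    and bdd: "bounded (x ` J) \<Longrightarrow> J = {0..}"
    by (rule maximal_solution[where ?x0.0 = "(ln A0, ln B0, ln C0)"]) blast
  define A B C where "A t = exp (fst (x t))" and "B t = exp (fst (snd (x t)))" and "C t = exp (snd (snd (x t)))" for t
  have x_eq: "x t = (ln (A t), ln (B t), ln (C t))" for t by (simp add: A_def B_def C_def)
  have p: "A t > 0" "B t > 0" "C t > 0" for t by (auto simp: A_def B_def C_def)
  have ode: "xcf_ode A B C J"
    unfolding xcf_ode_def
  proof (intro ballI conjI p)
    fix t assume t: "t \<in> J"
    have d: "(x has_vector_derivative (2 * (F2 (A t) (B t) (C t) * F3 (A t) (B t) (C t)) / (A t * B t * C t)\<^sup>2,
      2 * (F3 (A t) (B t) (C t) * F1 (A t) (B t) (C t)) / (A t * B t * C t)\<^sup>2, 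
      2 * (F1 (A t) (B t) (C t) * F2 (A t) (B t) (C t)) / (A t * B t * C t)\<^sup>2)) (at t within J)"
      using x[OF t] unfolding x_eq[of t] G_ln[OF p] .
    note ds = bounded_linear.has_vector_derivative[OF bounded_linear_snd d]
    note d3 = bounded_linear.has_vector_derivative[OF bounded_linear_fst d]
       bounded_linear.has_vector_derivative[OF bounded_linear_fst ds]
       bounded_linear.has_vector_derivative[OF bounded_linear_snd ds]
    note d3 = d3[folded has_real_derivative_iff_has_vector_derivative, THEN DERIV_chain2[OF DERIV_exp]]
    show "(A has_real_derivative 2 * A t * (F2 (A t) (B t) (C t) * F3 (A t) (B t) (C t)) / (A t * B t * C t)\<^sup>2) (at t within J)"
     "(B has_real_derivative 2 * B t * (F3 (A t) (B t) (C t) * F1 (A t) (B t) (C t)) / (A t * B t * C t)\<^sup>2) (at t within J)"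
     "(C has_real_derivative 2 * C t * (F1 (A t) (B t) (C t) * F2 (A t) (B t) (C t)) / (A t * B t * C t)\<^sup>2) (at t within J)"
      using d3 by (simp_all add: A_def[symmetric] B_def[symmetric] C_def[symmetric] mult_ac)
  qed
  have cont: "continuous_on J x"
    unfolding continuous_on_eq_continuous_within by (auto intro: has_vector_derivative_continuous[OF x])
  show ?thesis
  proof (rule that[OF J _ _ _ ode])
    show "A 0 = A0" "B 0 = B0" "C 0 = C0" using pos by (simp_all add: A_def B_def C_def x0)
  next
    fix A' B' C' T t
    assume ode': "xcf_ode A' B' C' {0..<T}" and init: "A' 0 = A0" "B' 0 = B0" "C' 0 = C0" and t: "t \<in> {0..<T}"
    define y where "y t = (ln (A' t), ln (B' t), ln (C' t))" for t
    have "(y has_vector_derivative G (y t)) (at t within {0..<T})" if t: "t \<in> {0..<T}" for t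
    proof -
      from ode' t have p': "A' t > 0" "B' t > 0" "C' t > 0"
       and d: "(A' has_real_derivative 2 * A' t * (F2 (A' t) (B' t) (C' t) * F3 (A' t) (B' t) (C' t)) / (A' t * B' t * C' t)\<^sup>2) (at t within {0..<T})"
       "(B' has_real_derivative 2 * B' t * (F3 (A' t) (B' t) (C' t) * F1 (A' t) (B' t) (C' t)) / (A' t * B' t * C' t)\<^sup>2) (at t within {0..<T})"
       "(C' has_real_derivative 2 * C' t * (F1 (A' t) (B' t) (C' t) * F2 (A' t) (B' t) (C' t)) / (A' t * B' t * C' t)\<^sup>2) (at t within {0..<T})"
        unfolding xcf_ode_def by blast+
      have e: "inverse u * (2 * u * v / w) = 2 * v / w" if "u > 0" for u v w :: real using that by simp
      have "((\<lambda>t. ln (A' t)) has_real_derivative 2 * (F2 (A' t) (B' t) (C' t) * F3 (A' t) (B' t) (C' t)) / (A' t * B' t * C' t)\<^sup>2) (at t within {0..<T})"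
       "((\<lambda>t. ln (B' t)) has_real_derivative 2 * (F3 (A' t) (B' t) (C' t) * F1 (A' t) (B' t) (C' t)) / (A' t * B' t * C' t)\<^sup>2) (at t within {0..<T})"
       "((\<lambda>t. ln (C' t)) has_real_derivative 2 * (F1 (A' t) (B' t) (C' t) * F2 (A' t) (B' t) (C' t)) / (A' t * B' t * C' t)\<^sup>2) (at t within {0..<T})"
        using DERIV_chain2[OF DERIV_ln[OF p'(1)] d(1)] DERIV_chain2[OF DERIV_ln[OF p'(2)] d(2)]
          DERIV_chain2[OF DERIV_ln[OF p'(3)] d(3)] p' by (simp_all only: e)
      then show ?thesis
        unfolding y_def G_ln[OF p'] has_real_derivative_iff_has_vector_derivative
        by (intro has_vector_derivative_Pair)
    qed
    then have "ode_sol G (ln A0, ln B0, ln C0) y T" by (simp add: ode_sol_def) (simp add: y_def init)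
    from uniq[OF this t] have "t \<in> J" "y t = x t" by auto
    moreover have "A' t > 0" "B' t > 0" "C' t > 0" using ode' t unfolding xcf_ode_def by blast+
    ultimately show "t \<in> J \<and> A' t = A t \<and> B' t = B t \<and> C' t = C t"
      using p[of t] by (simp add: y_def x_eq)
  next
    fix T s m M :: real
    assume JT: "J = {0..<T}" and s: "s \<in> J" and "0 < m"
    show "\<exists>t\<in>J. s \<le> t \<and> \<not> {A t, B t, C t} \<subseteq> {m..M}"
    proof (rule ccontr)
      assume neg: "\<not> ?thesis"
      have "x ` {t\<in>J. s \<le> t} \<subseteq> {ln m..ln M} \<times> {ln m..ln M} \<times> {ln m..ln M}"
      proof
        fix v assume "v \<in> x ` {t\<in>J. s \<le> t}"
        then obtain t where t: "t \<in> J" "s \<le> t" "v = x t" by blast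
        then have "{A t, B t, C t} \<subseteq> {m..M}" using neg by blast
        with t p[of t] \<open>0 < m\<close> show "v \<in> {ln m..ln M} \<times> {ln m..ln M} \<times> {ln m..ln M}"
          by (auto simp: x_eq)
      qed
      then have "bounded (x ` {t\<in>J. s \<le> t})"
        by (rule bounded_subset[rotated]) (intro bounded_Times bounded_closed_interval)
      moreover have "bounded (x ` {0..s})"
        by (intro compact_imp_bounded compact_continuous_image continuous_on_subset[OF cont]) (use s JT in auto)
      ultimately have "bounded (x ` ({t\<in>J. s \<le> t} \<union> {0..s}))" by (simp add: image_Un)
      moreover have "x ` J \<subseteq> x ` ({t\<in>J. s \<le> t} \<union> {0..s})" by (rule image_mono) (auto simp: JT)
      ultimately have "bounded (x ` J)" by (rule bounded_subset)
      then have "J = {0..}" by (rule bdd)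
      moreover have "T \<notin> J" "0 \<le> T" using JT s by auto
      ultimately show False by simp
    qed
  qed
qed

text \<open>The interval \<open>I\<close> is allowed to be unbounded so that the finiteness of the maximal time can be
  derived in each regime from the same hypotheses.\<close>

locale xcf_flow =
  fixes A B C :: "real \<Rightarrow> real" and I :: "real set"
  assumes I_cases: "I = {0..} \<or> (\<exists>T>0. I = {0..<T})"
    and ode: "xcf_ode A B C I"
    and B0_ge_C0: "B 0 \<ge> C 0"
    and escape: "\<And>T s m M. I = {0..<T} \<Longrightarrow> s \<in> I \<Longrightarrow> 0 < m \<Longrightarrow> \<exists>t\<in>I. s \<le> t \<and> \<not> {A t, B t, C t} \<subseteq> {m..M}"
begin

abbreviation "f1 t \<equiv> F1 (A t) (B t) (C t)"
abbreviation "f2 t \<equiv> F2 (A t) (B t) (C t)"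
abbreviation "f3 t \<equiv> F3 (A t) (B t) (C t)"
abbreviation "n t \<equiv> (A t * B t * C t)\<^sup>2"

lemma pos: "t \<in> I \<Longrightarrow> A t > 0" "t \<in> I \<Longrightarrow> B t > 0" "t \<in> I \<Longrightarrow> C t > 0"
  using ode unfolding xcf_ode_def by auto

lemma n_pos: "t \<in> I \<Longrightarrow> n t > 0"
  using pos[of t] by simp

lemma deriv: 
  "t \<in> I \<Longrightarrow> (A has_real_derivative 2 * A t * (f2 t * f3 t) / n t) (at t within I)"
  "t \<in> I \<Longrightarrow> (B has_real_derivative 2 * B t * (f3 t * f1 t) / n t) (at t within I)"
  "t \<in> I \<Longrightarrow> (C has_real_derivative 2 * C t * (f1 t * f2 t) / n t) (at t within I)"
  using ode unfolding xcf_ode_def by auto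

lemma zero_in_I: "0 \<in> I"
  using I_cases by auto

lemma ln_deriv:
  assumes "(q has_real_derivative q x * r) (at x within S)" "q x > 0"
  shows "((\<lambda>x. ln (q x)) has_real_derivative r) (at x within S)"
  by (rule DERIV_cong[OF DERIV_chain2[OF DERIV_ln[OF assms(2)] assms(1)]]) (use assms(2) in simp)

lemma I_nonneg: "t \<in> I \<Longrightarrow> t \<ge> 0"
  using I_cases by auto

lemma I_interval: "s \<in> I \<Longrightarrow> t \<in> I \<Longrightarrow> {s..t} \<subseteq> I"
  using I_cases by auto

lemma I_later: "s \<in> I \<Longrightarrow> \<exists>t\<in>I. s < t"
  using I_cases
proof (elim disjE exE conjE)
  show "s \<in> I \<Longrightarrow> I = {0..} \<Longrightarrow> \<exists>t\<in>I. s < t" by (auto intro!: bexI[of _ "s + 1"])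
  show "s \<in> I \<Longrightarrow> I = {0..<T} \<Longrightarrow> \<exists>t\<in>I. s < t" for T by (auto intro!: bexI[of _ "(s + T) / 2"])
qed

lemma cont: "S \<subseteq> I \<Longrightarrow> continuous_on S A" "S \<subseteq> I \<Longrightarrow> continuous_on S B" "S \<subseteq> I \<Longrightarrow> continuous_on S C"
  unfolding continuous_on_eq_continuous_within
  by (auto intro!: continuous_within_subset[OF DERIV_continuous[OF deriv(1)]]
      continuous_within_subset[OF DERIV_continuous[OF deriv(2)]]
      continuous_within_subset[OF DERIV_continuous[OF deriv(3)]])

lemma I_mono:
  assumes "s \<in> I" "t \<in> I" "s \<le> t"
    and "\<And>x. x \<in> I \<Longrightarrow> s \<le> x \<Longrightarrow> (q has_real_derivative q' x) (at x within I)"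
    and "\<And>x. x \<in> I \<Longrightarrow> s \<le> x \<Longrightarrow> 0 \<le> q' x"
  shows "q s \<le> q t"
proof (rule mono_if_deriv_nonneg[where f' = q', OF assms(3)])
  fix x assume "x \<in> {s..t}"
  then have x: "x \<in> I" "s \<le> x" using I_interval[OF assms(1,2)] by auto
  show "(q has_real_derivative q' x) (at x within {s..t})"
    by (rule DERIV_subset[OF assms(4)[OF x] I_interval[OF assms(1,2)]])
  show "0 \<le> q' x" by (rule assms(5)[OF x])
qed

lemma I_antimono:
  assumes "s \<in> I" "t \<in> I" "s \<le> t"
    and "\<And>x. x \<in> I \<Longrightarrow> s \<le> x \<Longrightarrow> (q has_real_derivative q' x) (at x within I)"
    and "\<And>x. x \<in> I \<Longrightarrow> s \<le> x \<Longrightarrow> q' x \<le> 0"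
  shows "q t \<le> q s"
proof -
  have "- q s \<le> - q t"
    by (rule I_mono[OF assms(1-3), of "\<lambda>x. - q x" "\<lambda>x. - q' x"]) (auto intro: DERIV_minus assms)
  then show ?thesis by simp
qed

text \<open>The source of every finiteness claim: a nonnegative quantity cannot decrease at the
  definite rate \<open>e\<close> forever.\<close>

lemma I_bounded:
  assumes "s \<in> I" "e > 0"
    and "\<And>x. x \<in> I \<Longrightarrow> s \<le> x \<Longrightarrow> (q has_real_derivative q' x) (at x within I)"
    and "\<And>x. x \<in> I \<Longrightarrow> s \<le> x \<Longrightarrow> q' x \<le> - e"
    and "\<And>x. x \<in> I \<Longrightarrow> s \<le> x \<Longrightarrow> 0 \<le> q x"
  shows "\<exists>T>0. I = {0..<T}"
proof (rule ccontr)
  assume "\<not> ?thesis"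
  then have I: "I = {0..}" using I_cases by blast
  define t where "t = s + (q s + 1) / e"
  have t: "t \<in> I" "s \<le> t" using assms(5)[of s] assms(1,2) by (auto simp: t_def I)
  have "q t + e * t \<le> q s + e * s"
  proof (rule I_antimono[OF assms(1) t])
    show "((\<lambda>x. q x + e * x) has_real_derivative q' x + e * 1) (at x within I)" if "x \<in> I" "s \<le> x" for x
      using that by (intro DERIV_add DERIV_cmult assms DERIV_ident)
    show "q' x + e * 1 \<le> 0" if "x \<in> I" "s \<le> x" for x using assms(4)[OF that] by simp
  qed
  moreover have "e * t = e * s + q s + 1" using \<open>e > 0\<close> by (simp add: t_def field_simps)
  ultimately have "q t \<le> - 1" by simp
  then show False using assms(5)[OF t] by simp
qed

section \<open>Monotone quantities common to the regimes\<close>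

text \<open>\<open>B * f3 - C * f2\<close> is divisible by \<open>B - C\<close>, so
  \<open>B - C\<close> satisfies a homogeneous linear equation and cannot change sign.\<close>

lemma B_ge_C:
  assumes "t \<in> I"
  shows "B t \<ge> C t"
proof -
  define k where "k t = 2 * f1 t * (4 * B t * C t + (A t + B t + C t)\<^sup>2) / n t" for t
  have t: "0 \<le> t" "{0..t} \<subseteq> I" using I_nonneg I_interval zero_in_I assms by auto
  have "0 \<le> B t - C t"
  proof (rule linear_ode_nonneg[OF t(1), of k _ "\<lambda>_. 0"])
    show "continuous_on {0..t} k"
      unfolding k_def F1_def using t pos by (intro continuous_intros cont) (force simp: less_imp_neq)+
    fix x assume "x \<in> {0..t}"
    then have x: "x \<in> I" using t by auto
    have "B x * f3 x - C x * f2 x = (B x - C x) * (4 * B x * C x + (A x + B x + C x)\<^sup>2)"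
      unfolding F2_def F3_def by algebra
    then have "2 * B x * (f3 x * f1 x) - 2 * C x * (f1 x * f2 x) = 2 * f1 x * (4 * B x * C x + (A x + B x + C x)\<^sup>2) * (B x - C x)"
      by algebra
    then have "2 * B x * (f3 x * f1 x) / n x - 2 * C x * (f1 x * f2 x) / n x = k x * (B x - C x) + 0"
      unfolding k_def by (simp flip: diff_divide_distrib)
    then have "((\<lambda>t. B t - C t) has_real_derivative k x * (B x - C x) + 0) (at x within I)"
      using DERIV_diff[OF deriv(2,3)[OF x]] by simp
    then show "((\<lambda>t. B t - C t) has_real_derivative k x * (B x - C x) + 0) (at x within {0..t})"
      by (rule DERIV_subset) (use t in auto)
  qed (use B0_ge_C0 in auto)
  then show ?thesis by simp
qed

lemma f3_pos: "t \<in> I \<Longrightarrow> f3 t \<ge> A t * (A t + (B t - C t))" "t \<in> I \<Longrightarrow> f3 t > 0"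
proof -
  assume t: "t \<in> I"
  have "f3 t = A t * (A t + (B t - C t)) + (A t * (B t - C t) + (B t - C t) * (B t + C t) + 2 * C t * (B t - C t))"
    unfolding F3_def by algebra
  moreover have "A t * (B t - C t) + (B t - C t) * (B t + C t) + 2 * C t * (B t - C t) \<ge> 0"
    using pos[OF t] B_ge_C[OF t] by (intro add_nonneg_nonneg mult_nonneg_nonneg) auto
  ultimately show "f3 t \<ge> A t * (A t + (B t - C t))" by simp
  moreover have "A t * (A t + (B t - C t)) > 0"
    using pos[OF t] B_ge_C[OF t] by (intro mult_pos_pos) auto
  ultimately show "f3 t > 0" by simp
qed

lemma f1_eq: "f1 t = (B t - C t)\<^sup>2 - 2 * A t * (B t + C t) - 3 * (A t)\<^sup>2"
  unfolding F1_def by algebra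

text \<open>The logarithmic rate is \<open>2 * f3 * (f2 - f1) / n\<close>, and
  \<open>f2 - f1\<close> factors. Since \<open>f3\<close> is positive, the defect
  \<open>A + C - B\<close> decides the direction of the ratio. Likewise \<open>f2 - f3\<close>
  factors, and \<open>f1\<close> decides the direction of \<open>C / B\<close>.\<close>

lemma deriv_AB:
  assumes "t \<in> I"
  shows "((\<lambda>t. A t / B t) has_real_derivative A t / B t * (8 * f3 t * (A t + B t) * (A t + C t - B t) / n t)) (at t within I)"
proof -
  have "f2 t - f1 t = 4 * (A t + B t) * (A t + C t - B t)" unfolding F1_def F2_def by algebra
  then have *: "8 * f3 t * (A t + B t) * (A t + C t - B t) / n t = 2 * f2 t * f3 t / n t - 2 * f3 t * f1 t / n t"
    unfolding diff_divide_distrib[symmetric] by (intro arg_cong2[of _ _ _ _ "(/)"] refl) algebra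
  have q: "((a * x) * b - a * (b * y)) / (b * b) = a / b * (x - y)" if "b > 0" for a b x y :: real
    using that by (simp add: field_simps)
  show ?thesis
    unfolding * q[OF pos(2)[OF assms], symmetric]
    using DERIV_divide[OF deriv(1,2)[OF assms]] pos[OF assms] by (simp add: mult_ac)
qed

lemma deriv_CB:
  assumes "t \<in> I"
  shows "((\<lambda>t. C t / B t) has_real_derivative C t / B t * (- 8 * f1 t * (B t - C t) * (A t + B t + C t) / n t)) (at t within I)"
proof -
  have "f2 t - f3 t = - 4 * (B t - C t) * (A t + B t + C t)" unfolding F3_def F2_def by algebra
  then have *: "- 8 * f1 t * (B t - C t) * (A t + B t + C t) / n t = 2 * f1 t * f2 t / n t - 2 * f3 t * f1 t / n t"
    unfolding diff_divide_distrib[symmetric] by (intro arg_cong2[of _ _ _ _ "(/)"] refl) algebra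
  have q: "((a * x) * b - a * (b * y)) / (b * b) = a / b * (x - y)" if "b > 0" for a b x y :: real
    using that by (simp add: field_simps)
  show ?thesis
    unfolding * q[OF pos(2)[OF assms], symmetric]
    using DERIV_divide[OF deriv(3,2)[OF assms]] pos[OF assms] by (simp add: mult_ac)
qed

text \<open>With \<open>y = A + C - B\<close> one has \<open>f1 = p - 2 * (A + B) * y\<close>,
  \<open>f2 = p + 2 * (A + B) * y\<close> and \<open>f3 = - p - 2 * C * y\<close>. Expanding the
  derivative of \<open>y\<close> in these terms leaves \<open>4 * C * p^2 / n\<close> as the part
  without a factor \<open>y\<close>, and \<open>p\<close> is negative.\<close>

lemma defect_pos:
  assumes "s \<in> I" "t \<in> I" "s < t" "A s + C s - B s \<ge> 0"
  shows "A t + C t - B t > 0"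
proof -
  define p where "p t = (A t + B t + C t) * (C t - A t - B t)" for t
  define k where "k t = 2 * (- (p t)\<^sup>2 - A t * (2 * p t * (A t + B t + C t) + 4 * (A t + C t - B t) * C t * (A t + B t))
      - B t * (2 * p t * (A t + B t) - 2 * p t * C t + 4 * (A t + C t - B t) * C t * (A t + B t))
      - 4 * C t * (A t + C t - B t) * (A t + B t)\<^sup>2) / n t" for t
  define r where "r t = 4 * C t * (p t)\<^sup>2 / n t" for t
  have st: "{s..t} \<subseteq> I" using I_interval assms by auto
  show ?thesis
  proof (rule linear_ode_pos[OF \<open>s < t\<close>, of k _ r])
    show "continuous_on {s..t} k"
      unfolding k_def p_def using st pos by (intro continuous_intros cont) (force simp: less_imp_neq)+
    fix x assume "x \<in> {s..t}"
    then have x: "x \<in> I" using st by auto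
    have "2 * A x * (f2 x * f3 x) + 2 * C x * (f1 x * f2 x) - 2 * B x * (f3 x * f1 x)
       = 2 * (- (p x)\<^sup>2 - A x * (2 * p x * (A x + B x + C x) + 4 * (A x + C x - B x) * C x * (A x + B x))
      - B x * (2 * p x * (A x + B x) - 2 * p x * C x + 4 * (A x + C x - B x) * C x * (A x + B x))
      - 4 * C x * (A x + C x - B x) * (A x + B x)\<^sup>2) * (A x + C x - B x) + 4 * C x * (p x)\<^sup>2"
      unfolding F1_def F2_def F3_def p_def by algebra
    then have "2 * A x * (f2 x * f3 x) / n x + 2 * C x * (f1 x * f2 x) / n x - 2 * B x * (f3 x * f1 x) / n x
       = k x * (A x + C x - B x) + r x"
      unfolding k_def r_def times_divide_eq_left add_divide_distrib[symmetric] diff_divide_distrib[symmetric]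
      by (rule arg_cong)
    then have "((\<lambda>t. A t + C t - B t) has_real_derivative k x * (A x + C x - B x) + r x) (at x within I)"
      using DERIV_diff[OF DERIV_add[OF deriv(1)[OF x] deriv(3)[OF x]] deriv(2)[OF x]] by simp
    then show "((\<lambda>t. A t + C t - B t) has_real_derivative k x * (A x + C x - B x) + r x) (at x within {s..t})"
      by (rule DERIV_subset) (use st in auto)
    have "p x < 0" unfolding p_def using pos[OF x] B_ge_C[OF x] by (intro mult_pos_neg) auto
    then show "0 < r x" unfolding r_def using pos[OF x] by simp
  qed (use assms in auto)
qed

section \<open>The regime in which \<open>A\<close> dominates\<close>

text \<open>Finiteness comes from \<open>B / A\<close>, which decreases at a definite rate. If it
  did not tend to 0, then \<open>A\<close> would be at most a constant times \<open>B\<close>, and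
  \<open>B\<close> would be bounded below because its logarithmic decrease is paid for by the
  bounded ratio \<open>A / B\<close>; the solution would be trapped in a compact set.\<close>

lemma regime1:
  assumes t0: "t0 \<in> I" and "A t0 \<ge> B t0 - C t0"
  shows "\<exists>T>0. I = {0..<T} \<and> ((\<lambda>t. B t / A t) \<longlongrightarrow> 0) (at_left T) \<and> ((\<lambda>t. C t / A t) \<longlongrightarrow> 0) (at_left T)"
proof -
  obtain s where s: "s \<in> I" "t0 < s" using I_later[OF t0] by blast
  have D: "A t + C t - B t > 0" if "t \<in> I" "s \<le> t" for t
    using defect_pos[OF t0 that(1)] s that assms(2) by simp
  have f1: "f1 t < 0" "f1 t \<ge> - (4 * A t * B t + 3 * (A t)\<^sup>2)" if t: "t \<in> I" "s \<le> t" for t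
  proof -
    have "(B t - C t)\<^sup>2 \<le> (A t)\<^sup>2" using D[OF t] B_ge_C[OF t(1)] by (intro power_mono) auto
    moreover have "2 * A t * (B t + C t) > 0" "3 * (A t)\<^sup>2 \<ge> (A t)\<^sup>2" "2 * A t * (B t + C t) \<le> 4 * A t * B t" 
      using pos[OF t(1)] B_ge_C[OF t(1)] by (auto intro!: mult_pos_pos)
    ultimately show "f1 t < 0" "f1 t \<ge> - (4 * A t * B t + 3 * (A t)\<^sup>2)"
      unfolding f1_eq using zero_le_power2[of "B t - C t"] by linarith+
  qed
  have a_mono: "A s / B s \<le> A t / B t" if t: "t \<in> I" "s \<le> t" for t
    by (rule I_mono[OF s(1) t deriv_AB])
      (use D f3_pos(2) pos n_pos in \<open>auto intro!: mult_nonneg_nonneg divide_nonneg_nonneg simp: less_imp_le\<close>)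
  have c_mono: "C s / B s \<le> C t / B t" if t: "t \<in> I" "s \<le> t" for t
  proof (rule I_mono[OF s(1) t deriv_CB])
    fix x assume x: "x \<in> I" "s \<le> x"
    have "0 \<le> 8 * (- f1 x) * (B x - C x) * (A x + B x + C x)"
      using f1(1)[OF x] B_ge_C[OF x(1)] pos[OF x(1)] by (intro mult_nonneg_nonneg) auto
    then have "0 \<le> - 8 * f1 x * (B x - C x) * (A x + B x + C x)" by (simp add: mult_ac)
    then show "0 \<le> C x / B x * (- 8 * f1 x * (B x - C x) * (A x + B x + C x) / n x)"
      using pos[OF x(1)] by (simp only: zero_le_mult_iff zero_le_divide_iff zero_le_power2) auto
  qed
  have B_anti: "B t \<le> B s" if t: "t \<in> I" "s \<le> t" for t
  proof (rule I_antimono[OF s(1) t deriv(2)])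
    fix x assume x: "x \<in> I" "s \<le> x"
    have le: "f3 x * f1 x \<le> 0" using f1(1)[OF x] f3_pos(2)[OF x(1)] by (simp add: mult_le_0_iff)
    show "2 * B x * (f3 x * f1 x) / n x \<le> 0"
      using mult_nonneg_nonpos[of "2 * B x", OF _ le] pos[OF x(1)]
      by (intro divide_nonpos_nonneg zero_le_power2) simp
  qed
  \<comment> \<open>The defect divided by \<open>B\<close> is \<open>A / B + C / B - 1\<close>,
    which increases; its value at \<open>s\<close> is therefore a lower bound afterwards.\<close>
  define d where "d = (A s + C s - B s) / B s"
  have d: "d > 0" using D[OF s(1)] pos[OF s(1)] by (simp add: d_def)
  have dD: "d * B t \<le> A t + C t - B t" if t: "t \<in> I" "s \<le> t" for t
  proof -
    have "d = A s / B s + C s / B s - 1" using pos(2)[OF s(1)] by (simp add: d_def field_simps)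
    also have "\<dots> \<le> A t / B t + C t / B t - 1" using a_mono[OF t] c_mono[OF t] by simp
    also have "\<dots> = (A t + C t - B t) / B t" using pos(2)[OF t(1)] by (simp add: field_simps)
    finally show ?thesis using pos(2)[OF t(1)] by (simp add: field_simps)
  qed
  define w' where "w' t = - (B t / A t * (8 * f3 t * (A t + B t) * (A t + C t - B t) / n t))" for t
  have dBA: "((\<lambda>t. B t / A t) has_real_derivative w' t) (at t within I)" if t: "t \<in> I" for t
  proof -
    have i: "- (inverse (a / b) * (a / b * r) * inverse (a / b)) = - (b / a * r)" if "a > 0" "b > 0" for a b r :: real
      using that by (simp add: field_simps)
    have "((\<lambda>t. inverse (A t / B t)) has_real_derivative w' t) (at t within I)"
      using DERIV_inverse'[OF deriv_AB[OF t]] pos[OF t] unfolding w'_def i[OF pos(1)[OF t] pos(2)[OF t]] by simp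
    then show ?thesis by simp
  qed
  \<comment> \<open>The bounds \<open>(A t)^2\<close> for \<open>f3 t\<close>, \<open>A t\<close>
    for \<open>A t + B t\<close> and \<open>d * B t\<close> for the defect cancel all powers of
    \<open>A\<close> and \<open>B\<close> and leave \<open>8 * d / (C t)^2\<close>, where
    \<open>C t\<close> is at most \<open>B s\<close>.\<close>
  have w'_le: "w' t \<le> - (8 * d / (B s)\<^sup>2)" if t: "t \<in> I" "s \<le> t" for t
  proof -
    note p = pos[OF t(1)]
    have "(A t)\<^sup>2 \<le> A t * (A t + (B t - C t))"
      using p B_ge_C[OF t(1)] unfolding power2_eq_square by (intro mult_left_mono) auto
    then have "(A t)\<^sup>2 \<le> f3 t" using f3_pos(1)[OF t(1)] by linarith
    then have "8 * (A t)\<^sup>2 * A t * (d * B t) \<le> 8 * f3 t * (A t + B t) * (A t + C t - B t)"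
      using p dD[OF t] d D[OF t] less_imp_le[OF f3_pos(2)[OF t(1)]]
      by (intro mult_mono mult_nonneg_nonneg) auto
    then have "B t / A t * (8 * (A t)\<^sup>2 * A t * (d * B t) / n t) \<le> - w' t"
      unfolding w'_def minus_minus using p by (intro mult_left_mono divide_right_mono) auto
    moreover have "B t / A t * (8 * (A t)\<^sup>2 * A t * (d * B t) / n t) = 8 * d / (C t)\<^sup>2"
      using p by (simp add: field_simps power2_eq_square)
    moreover have "C t \<le> B s" using B_ge_C[OF t(1)] B_anti[OF t] by simp
    then have "8 * d / (B s)\<^sup>2 \<le> 8 * d / (C t)\<^sup>2"
      using p d by (intro divide_left_mono power_mono) auto
    ultimately show ?thesis by linarith
  qed
  have "\<exists>T>0. I = {0..<T}"
    by (rule I_bounded[OF s(1) _ dBA w'_le]) (use pos d pos(2)[OF s(1)] in \<open>auto intro!: divide_nonneg_nonneg simp: less_imp_le\<close>)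
  then obtain T where T: "T > 0" "I = {0..<T}" by blast
  have BA: "((\<lambda>t. B t / A t) \<longlongrightarrow> 0) (at_left T)"
  proof (rule antimono_tendsto_zero[of s])
    show "0 \<le> B x / A x" if "s \<le> x" "x < T" for x
      using pos[of x] that s T I_nonneg by (auto simp: less_imp_le)
    show "B y / A y \<le> B x / A x" if "s \<le> x" "x \<le> y" "y < T" for x y
    proof (rule I_antimono[OF _ _ _ dBA])
      show "w' z \<le> 0" if z: "z \<in> I" "x \<le> z" for z
      proof -
        have "s \<le> z" using z \<open>s \<le> x\<close> by simp
        moreover have "0 \<le> 8 * d / (B s)\<^sup>2" using d by simp
        ultimately show ?thesis using w'_le[OF z(1)] by linarith
      qed
    qed (use that s T in auto)
  next
    fix e :: real assume "e > 0"
    show "\<exists>x\<ge>s. x < T \<and> B x / A x < e"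
    proof (rule ccontr)
      assume "\<not> ?thesis"
      then have le: "e \<le> B t / A t" if "t \<in> I" "s \<le> t" for t using that T by (auto simp: not_less)
      have A_le: "A t \<le> B t / e" if t: "t \<in> I" "s \<le> t" for t
        using le[OF t] pos[OF t(1)] \<open>e > 0\<close> by (simp add: field_simps)
      \<comment> \<open>Chosen so that \<open>4 * \<kappa> * d * B^2\<close> equals the bound for
        \<open>- f1\<close> obtained from \<open>A \<le> B / e\<close>; the growth of
        \<open>\<kappa> * ln (A / B)\<close> then outweighs the loss of \<open>ln B\<close>.\<close>
      define \<kappa> where "\<kappa> = (4 / e + 3 / e\<^sup>2) / (4 * d)"
      have "\<kappa> > 0" using \<open>e > 0\<close> d by (auto simp: \<kappa>_def intro!: divide_pos_pos add_pos_pos)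
      have key: "ln (B s) + \<kappa> * ln (A s / B s) \<le> ln (B t) + \<kappa> * ln (A t / B t)" if t: "t \<in> I" "s \<le> t" for t
      proof (rule I_mono[OF s(1) t])
        fix x assume x: "x \<in> I" "s \<le> x"
        note p = pos[OF x(1)]
        have "(B has_real_derivative B x * (2 * (f3 x * f1 x) / n x)) (at x within I)"
          using deriv(2)[OF x(1)] by (simp add: mult_ac)
        from DERIV_add[OF ln_deriv[OF this p(2)] DERIV_cmult[OF ln_deriv[OF deriv_AB[OF x(1)]], of \<kappa>]] p
        show "((\<lambda>x. ln (B x) + \<kappa> * ln (A x / B x)) has_real_derivative
            2 * (f3 x * f1 x) / n x + \<kappa> * (8 * f3 x * (A x + B x) * (A x + C x - B x) / n x)) (at x within I)"
          by simp
        have "4 * A x * B x + 3 * (A x)\<^sup>2 \<le> 4 * (B x / e) * B x + 3 * (B x / e)\<^sup>2"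
          using A_le[OF x] p by (intro add_mono mult_mono power_mono) auto
        also have "\<dots> = 4 * \<kappa> * (B x * (d * B x))" 
          using \<open>e > 0\<close> d by (simp add: \<kappa>_def field_simps power2_eq_square)
        also have "\<dots> \<le> 4 * \<kappa> * ((A x + B x) * (A x + C x - B x))"
          using \<open>\<kappa> > 0\<close> p dD[OF x] d by (intro mult_left_mono mult_mono) auto
        finally have "0 \<le> f1 x + 4 * \<kappa> * ((A x + B x) * (A x + C x - B x))" using f1(2)[OF x] by linarith
        then have "0 \<le> 2 * f3 x * (f1 x + 4 * \<kappa> * ((A x + B x) * (A x + C x - B x))) / n x"
          using f3_pos(2)[OF x(1)] by (intro divide_nonneg_nonneg mult_nonneg_nonneg) auto
        also have "\<dots> = 2 * (f3 x * f1 x) / n x + \<kappa> * (8 * f3 x * (A x + B x) * (A x + C x - B x) / n x)"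
          by (simp add: algebra_simps flip: add_divide_distrib)
        finally show "0 \<le> 2 * (f3 x * f1 x) / n x + \<kappa> * (8 * f3 x * (A x + B x) * (A x + C x - B x) / n x)" .
      qed
      define m0 where "m0 = exp (ln (B s) + \<kappa> * ln (A s / B s) - \<kappa> * ln (1 / e))"
      have m0: "m0 \<le> B t" if t: "t \<in> I" "s \<le> t" for t
      proof -
        have "A t / B t \<le> 1 / e" using A_le[OF t] pos[OF t(1)] \<open>e > 0\<close> by (simp add: field_simps)
        then have "\<kappa> * ln (A t / B t) \<le> \<kappa> * ln (1 / e)"
          using \<open>\<kappa> > 0\<close> pos[OF t(1)] \<open>e > 0\<close> by (intro mult_left_mono ln_mono) auto
        then have "ln (B s) + \<kappa> * ln (A s / B s) - \<kappa> * ln (1 / e) \<le> ln (B t)" using key[OF t] by linarith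
        then have "m0 \<le> exp (ln (B t))" unfolding m0_def by (rule exp_mono)
        then show ?thesis using pos[OF t(1)] by simp
      qed
      define m where "m = min m0 (min (A s / B s * m0) (C s / B s * m0))"
      define M where "M = max (B s) (B s / e)"
      have "m > 0" using pos[OF s(1)] by (simp add: m_def m0_def)
      from escape[OF T(2) s(1) this, of M] obtain t where t: "t \<in> I" "s \<le> t" and bad: "\<not> {A t, B t, C t} \<subseteq> {m..M}"
        by blast
      have "m0 > 0" by (simp add: m0_def)
      have "A s / B s * m0 \<le> A t / B t * B t" "C s / B s * m0 \<le> C t / B t * B t"
        using a_mono[OF t] c_mono[OF t] m0[OF t] pos[OF t(1)] \<open>m0 > 0\<close> pos[OF s(1)] by (intro mult_mono; simp)+
      then have lower: "m \<le> A t" "m \<le> B t" "m \<le> C t" using m0[OF t] pos[OF t(1)] by (auto simp: m_def)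
      have "B t / e \<le> B s / e" using B_anti[OF t] \<open>e > 0\<close> by (simp add: divide_right_mono)
      then have "A t \<le> M" "B t \<le> M" "C t \<le> M"
        using A_le[OF t] B_anti[OF t] B_ge_C[OF t(1)] by (auto simp: M_def)
      with lower bad show False by auto
    qed
  qed
  moreover have "((\<lambda>t. C t / A t) \<longlongrightarrow> 0) (at_left T)"
  proof (rule tendsto_sandwich[OF _ _ tendsto_const BA])
    have "\<forall>\<^sub>F t in at_left T. t \<in> I" using eventually_at_left_real[OF T(1)] by eventually_elim (simp add: T)
    then show "\<forall>\<^sub>F t in at_left T. 0 \<le> C t / A t" "\<forall>\<^sub>F t in at_left T. C t / A t \<le> B t / A t"
      using pos B_ge_C by (auto elim!: eventually_mono intro!: divide_right_mono divide_nonneg_nonneg simp: less_imp_le)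
  qed
  ultimately show ?thesis using T by blast
qed

section \<open>The regime in which \<open>B\<close> dominates\<close>

text \<open>Where \<open>f1\<close> vanishes, \<open>B\<close> and \<open>C\<close> are stationary,
  and \<open>f2 * f3\<close> equals \<open>- 8 * A * (A + B + C)^3\<close>, so \<open>A\<close>
  decreases. As \<open>F1\<close> decreases in \<open>A\<close>, the part of the derivative free of
  \<open>f1\<close> is the positive \<open>r\<close>.\<close>

lemma f1_preserved_pos:
  assumes "s \<in> I" "t \<in> I" "s \<le> t" "f1 s > 0"
  shows "f1 t > 0"
proof (cases "s = t")
  case False
  then have "s < t" using assms by simp
  define k where "k t = (- (6 * A t + 2 * (B t + C t)) * 2 * A t * ((B t - C t)\<^sup>2 + 2 * A t * (B t + C t) + (A t)\<^sup>2 - 4 * (A t + B t + C t)\<^sup>2)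
     + (2 * B t - 2 * C t - 2 * A t) * 2 * B t * f3 t + (2 * C t - 2 * B t - 2 * A t) * 2 * C t * f2 t) / n t" for t
  define r where "r t = (6 * A t + 2 * (B t + C t)) * 16 * (A t)\<^sup>2 * (A t + B t + C t)^3 / n t" for t
  have st: "{s..t} \<subseteq> I" using I_interval assms by auto
  show ?thesis
  proof (rule linear_ode_pos[OF \<open>s < t\<close>, of k f1 r])
    show "continuous_on {s..t} k"
      unfolding k_def F2_def F3_def using st pos by (intro continuous_intros cont) (force simp: less_imp_neq)+
    fix x assume "x \<in> {s..t}"
    then have x: "x \<in> I" using st by auto
    define a' b' c' where "a' = 2 * A x * (f2 x * f3 x)" and "b' = 2 * B x * (f3 x * f1 x)" and "c' = 2 * C x * (f1 x * f2 x)"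
    have "(- 6 * A x - 2 * B x - 2 * C x) * a' + (2 * B x - 2 * C x - 2 * A x) * b' + (2 * C x - 2 * B x - 2 * A x) * c'
       = (- (6 * A x + 2 * (B x + C x)) * 2 * A x * ((B x - C x)\<^sup>2 + 2 * A x * (B x + C x) + (A x)\<^sup>2 - 4 * (A x + B x + C x)\<^sup>2)
     + (2 * B x - 2 * C x - 2 * A x) * 2 * B x * f3 x + (2 * C x - 2 * B x - 2 * A x) * 2 * C x * f2 x) * f1 x
     + (6 * A x + 2 * (B x + C x)) * 16 * (A x)\<^sup>2 * (A x + B x + C x)^3"
      unfolding F1_def F2_def F3_def a'_def b'_def c'_def by algebra
    then have eq: "((- 6 * A x - 2 * B x - 2 * C x) * a' + (2 * B x - 2 * C x - 2 * A x) * b' + (2 * C x - 2 * B x - 2 * A x) * c') / n x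
       = k x * f1 x + r x"
      unfolding k_def r_def times_divide_eq_left add_divide_distrib[symmetric] by (rule arg_cong)
    define u v w where "u = a' / n x" and "v = b' / n x" and "w = c' / n x"
    note d = deriv[OF x, folded a'_def b'_def c'_def, folded u_def v_def w_def]
    have "(f1 has_real_derivative (- 6 * A x - 2 * B x - 2 * C x) * u + (2 * B x - 2 * C x - 2 * A x) * v
        + (2 * C x - 2 * B x - 2 * A x) * w) (at x within I)"
      unfolding F1_def power2_eq_square
      by (rule DERIV_cong, (rule DERIV_diff DERIV_add DERIV_mult DERIV_const d)+) (simp add: algebra_simps)
    moreover have "(- 6 * A x - 2 * B x - 2 * C x) * u + (2 * B x - 2 * C x - 2 * A x) * v
        + (2 * C x - 2 * B x - 2 * A x) * w = k x * f1 x + r x"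
      unfolding eq[symmetric] u_def v_def w_def by (simp only: add_divide_distrib times_divide_eq_right)
    ultimately have "(f1 has_real_derivative k x * f1 x + r x) (at x within I)" by simp
    then show "(f1 has_real_derivative k x * f1 x + r x) (at x within {s..t})"
      by (rule DERIV_subset) (use st in auto)
    show "0 < r x" unfolding r_def using pos[OF x] by (intro divide_pos_pos mult_pos_pos zero_less_power) auto
  qed (use assms in auto)
qed (use assms in simp)

text \<open>The three logarithmic derivatives are comparable, so none of \<open>A / B\<close>, \<open>C / B\<close> can stay away from
  zero while the solution leaves every compact set.\<close>

lemma regime2:
  assumes s: "s \<in> I" and f1s: "f1 s > 0"
  shows "\<exists>T>0. I = {0..<T} \<and> ((\<lambda>t. A t / B t) \<longlongrightarrow> 0) (at_left T) \<and> ((\<lambda>t. C t / B t) \<longlongrightarrow> 0) (at_left T)"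
proof -
  have f1: "f1 t > 0" if "t \<in> I" "s \<le> t" for t
    using f1_preserved_pos[OF s that f1s] .
  have gap: "B t - C t > A t" if t: "t \<in> I" "s \<le> t" for t
  proof -
    have "2 * A t * (B t + C t) > 0" "3 * (A t)\<^sup>2 \<ge> (A t)\<^sup>2" using pos[OF t(1)] by auto
    then have "(A t)\<^sup>2 < (B t - C t)\<^sup>2" using f1[OF t] unfolding f1_eq by linarith
    then show ?thesis by (rule power2_less_imp_less) (use B_ge_C[OF t(1)] in simp)
  qed
  have f3_lb: "f3 t \<ge> (B t - C t) * B t" if t: "t \<in> I" "s \<le> t" for t
  proof -
    have "f3 t = (B t - C t) * B t + (2 * C t * (B t - C t - A t) + A t * (A t + B t + C t) + (B t - C t) * (A t + C t))"
      unfolding F3_def by algebra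
    moreover have "0 \<le> 2 * C t * (B t - C t - A t) + A t * (A t + B t + C t) + (B t - C t) * (A t + C t)"
      using pos[OF t(1)] gap[OF t] B_ge_C[OF t(1)] by (intro add_nonneg_nonneg mult_nonneg_nonneg) auto
    ultimately show ?thesis by linarith
  qed
  have f2_ub: "f2 t \<le> - (B t * (B t - C t - A t))" if t: "t \<in> I" "s \<le> t" for t
  proof -
    have "f2 t = - (B t * (B t - C t - A t)) - (2 * B t * (A t + (B t - C t)) + (A t + C t) * (B t - C t - A t))"
      unfolding F2_def by algebra
    moreover have "0 \<le> 2 * B t * (A t + (B t - C t)) + (A t + C t) * (B t - C t - A t)"
      using pos[OF t(1)] gap[OF t] B_ge_C[OF t(1)] by (intro add_nonneg_nonneg mult_nonneg_nonneg) auto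
    ultimately show ?thesis by linarith
  qed
  have a_rate: "8 * f3 t * (A t + B t) * (A t + C t - B t) \<le> 0" if t: "t \<in> I" "s \<le> t" for t
    using pos[OF t(1)] gap[OF t] f3_pos(2)[OF t(1)] by (intro mult_nonneg_nonpos mult_nonneg_nonneg) auto
  have c_rate: "- 8 * f1 t * (B t - C t) * (A t + B t + C t) \<le> 0" if t: "t \<in> I" "s \<le> t" for t
  proof -
    have "0 \<le> 8 * f1 t * (B t - C t) * (A t + B t + C t)"
      using pos[OF t(1)] B_ge_C[OF t(1)] f1[OF t] by (intro mult_nonneg_nonneg) auto
    then show ?thesis by simp
  qed
  have a_anti: "A y / B y \<le> A x / B x" if "x \<in> I" "s \<le> x" "y \<in> I" "x \<le> y" for x y
  proof (rule I_antimono[OF that(1) that(3,4) deriv_AB])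
    fix z assume z: "z \<in> I" "x \<le> z"
    have "8 * f3 z * (A z + B z) * (A z + C z - B z) / n z \<le> 0"
      by (intro divide_nonpos_nonneg zero_le_power2 a_rate) (use z \<open>s \<le> x\<close> in auto)
    then show "A z / B z * (8 * f3 z * (A z + B z) * (A z + C z - B z) / n z) \<le> 0"
      using pos[OF z(1)] by (intro mult_nonneg_nonpos) auto
  qed
  have c_anti: "C y / B y \<le> C x / B x" if "x \<in> I" "s \<le> x" "y \<in> I" "x \<le> y" for x y
  proof (rule I_antimono[OF that(1) that(3,4) deriv_CB])
    fix z assume z: "z \<in> I" "x \<le> z"
    have "- 8 * f1 z * (B z - C z) * (A z + B z + C z) / n z \<le> 0"
      by (intro divide_nonpos_nonneg zero_le_power2 c_rate) (use z \<open>s \<le> x\<close> in auto)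
    then show "C z / B z * (- 8 * f1 z * (B z - C z) * (A z + B z + C z) / n z) \<le> 0"
      using pos[OF z(1)] by (intro mult_nonneg_nonpos) auto
  qed
  have B_mono: "B s \<le> B t" if t: "t \<in> I" "s \<le> t" for t
    by (rule I_mono[OF s t deriv(2)])
      (use f1 f3_pos(2) pos in \<open>auto intro!: divide_nonneg_nonneg mult_nonneg_nonneg simp: less_imp_le\<close>)
  \<comment> \<open>The gap \<open>(B - C - A) / B\<close> increases because both ratios decrease,
    so its value at \<open>s\<close> persists as a lower bound.\<close>
  define \<delta> where "\<delta> = 1 - C s / B s - A s / B s"
  have "\<delta> = (B s - C s - A s) / B s" using pos(2)[OF s] by (simp add: \<delta>_def field_simps)
  then have \<delta>: "\<delta> > 0" using gap[OF s order_refl] pos[OF s] by simp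
  have \<delta>_le: "\<delta> * B t \<le> B t - C t - A t" if t: "t \<in> I" "s \<le> t" for t
  proof -
    have "\<delta> \<le> 1 - C t / B t - A t / B t"
      unfolding \<delta>_def using a_anti[OF s _ t] c_anti[OF s _ t] by simp
    also have "\<dots> = (B t - C t - A t) / B t" using pos(2)[OF t(1)] by (simp add: field_simps)
    finally show ?thesis using pos(2)[OF t(1)] by (simp add: field_simps)
  qed
  have \<delta>_le': "\<delta> * B t \<le> B t - C t" if t: "t \<in> I" "s \<le> t" for t
    using \<delta>_le[OF t] pos[OF t(1)] by simp
  have f3_lb': "\<delta> * (B t)\<^sup>2 \<le> f3 t" if t: "t \<in> I" "s \<le> t" for t
  proof -
    have "\<delta> * B t * B t \<le> (B t - C t) * B t"
      by (rule mult_right_mono[OF \<delta>_le'[OF t]]) (use pos[OF t(1)] in simp)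
    with f3_lb[OF t] show ?thesis by (simp add: power2_eq_square)
  qed
  \<comment> \<open>The square of \<open>A\<close> is used because its derivative has lost all
    powers of \<open>A\<close>; \<open>- f2\<close> and \<open>f3\<close> are at least
    \<open>\<delta> * B^2\<close>, and \<open>C\<close> is at most \<open>B\<close>.\<close>
  have "\<exists>T>0. I = {0..<T}"
  proof (rule I_bounded[OF s])
    fix t assume t: "t \<in> I" "s \<le> t"
    note p = pos[OF t(1)]
    show "((\<lambda>t. (A t)\<^sup>2) has_real_derivative 4 * (f2 t * f3 t) / (B t * C t)\<^sup>2) (at t within I)"
      by (rule DERIV_cong, rule DERIV_power[OF deriv(1)[OF t(1)]])
        (use p in \<open>simp add: field_simps power2_eq_square\<close>)
    have nn: "0 \<le> \<delta> * (B t)\<^sup>2" using \<delta> by simp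
    have f2_lb: "\<delta> * (B t)\<^sup>2 \<le> - f2 t"
    proof -
      have "B t * (\<delta> * B t) \<le> B t * (B t - C t - A t)"
        by (rule mult_left_mono[OF \<delta>_le[OF t]]) (use p in simp)
      then have "B t * (\<delta> * B t) \<le> - f2 t" using f2_ub[OF t] by linarith
      then show ?thesis by (simp add: power2_eq_square mult_ac)
    qed
    have "(\<delta> * (B t)\<^sup>2) * (\<delta> * (B t)\<^sup>2) \<le> (- f2 t) * f3 t"
      by (rule mult_mono[OF f2_lb f3_lb'[OF t] order_trans[OF nn f2_lb] nn])
    moreover have "C t * C t \<le> B t * B t" using p B_ge_C[OF t(1)] by (intro mult_mono) auto
    then have "\<delta>\<^sup>2 * ((B t * C t) * (B t * C t)) \<le> (\<delta> * (B t)\<^sup>2) * (\<delta> * (B t)\<^sup>2)"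
    proof -
      have "\<delta>\<^sup>2 * (B t * B t) * (C t * C t) \<le> \<delta>\<^sup>2 * (B t * B t) * (B t * B t)"
        by (rule mult_left_mono) (use \<open>C t * C t \<le> B t * B t\<close> in auto)
      then show ?thesis by (simp only: power2_eq_square mult_ac)
    qed
    ultimately have "\<delta>\<^sup>2 * ((B t * C t) * (B t * C t)) \<le> - (f2 t * f3 t)" by simp
    then have "4 * (f2 t * f3 t) \<le> - (4 * \<delta>\<^sup>2) * (B t * C t)\<^sup>2"
      unfolding power2_eq_square[of "B t * C t"] by linarith
    then show "4 * (f2 t * f3 t) / (B t * C t)\<^sup>2 \<le> - (4 * \<delta>\<^sup>2)"
      using p by (simp add: pos_divide_le_eq)
  qed (use \<delta> in auto)
  then obtain T where T: "T > 0" "I = {0..<T}" by blast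
  \<comment> \<open>\<open>f1 / B^2\<close> depends only on the two ratios and grows as they fall,
    so its value at \<open>s\<close> is a lower bound.\<close>
  define \<phi> where "\<phi> = f1 s / (B s)\<^sup>2"
  have \<phi>: "\<phi> > 0" using f1s pos[OF s] by (simp add: \<phi>_def)
  have f1_scaled: "f1 t / (B t)\<^sup>2 = (1 - C t / B t)\<^sup>2 - 2 * (A t / B t) * (1 + C t / B t) - 3 * (A t / B t)\<^sup>2"
    if "t \<in> I" for t
    using pos(2)[OF that] unfolding f1_eq by (simp add: field_simps power2_eq_square)
  have f1_lb: "\<phi> * (B t)\<^sup>2 \<le> f1 t" if t: "t \<in> I" "s \<le> t" for t
  proof -
    have "C s / B s \<le> 1" using B_ge_C[OF s] pos[OF s] by simp
    then have "\<phi> \<le> f1 t / (B t)\<^sup>2"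
      unfolding \<phi>_def f1_scaled[OF s] f1_scaled[OF t(1)]
      using a_anti[OF s _ t] c_anti[OF s _ t] pos[OF s] pos[OF t(1)]
      by (intro diff_mono power_mono mult_mono add_mono mult_left_mono) auto
    then show ?thesis using pos(2)[OF t(1)] by (simp add: field_simps)
  qed
  have f1_ub: "f1 t \<le> (B t)\<^sup>2" if t: "t \<in> I" "s \<le> t" for t
  proof -
    have "(B t - C t)\<^sup>2 \<le> (B t)\<^sup>2" using pos[OF t(1)] B_ge_C[OF t(1)] by (intro power_mono) auto
    moreover have "0 \<le> 2 * A t * (B t + C t)" "0 \<le> 3 * (A t)\<^sup>2" using pos[OF t(1)] by auto
    ultimately show ?thesis unfolding f1_eq by linarith
  qed
  have f3_ub: "f3 t \<le> 8 * (B t)\<^sup>2" if t: "t \<in> I" "s \<le> t" for t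
  proof -
    note p = pos[OF t(1)]
    have "f3 t = 2 * C t * (B t - C t - A t) + (A t + (B t - C t)) * (A t + B t + C t)"
      unfolding F3_def by algebra
    also have "\<dots> \<le> 2 * B t * B t + (2 * B t) * (3 * B t)"
      using p gap[OF t] B_ge_C[OF t(1)] by (intro add_mono mult_mono) auto
    finally show ?thesis by (simp add: power2_eq_square)
  qed
  \<comment> \<open>The common rate: the decay rates of \<open>ln (A / B)\<close> and
    \<open>ln (C / B)\<close> lie between positive multiples of it, and the growth rate of
    \<open>ln B\<close> is at most a multiple.\<close>
  define \<beta> where "\<beta> t = (B t)^4 / n t" for t
  define la lc lb where "la t = 8 * f3 t * (A t + B t) * (B t - C t - A t) / n t"
    and "lc t = 8 * f1 t * (B t - C t) * (A t + B t + C t) / n t" and "lb t = 2 * (f3 t * f1 t) / n t" for t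
  have dla: "((\<lambda>t. ln (A t / B t)) has_real_derivative - la t) (at t within I)" if t: "t \<in> I" for t
  proof (rule ln_deriv)
    have "8 * f3 t * (A t + B t) * (A t + C t - B t) / n t = - la t"
      unfolding la_def minus_divide_left by (rule arg_cong2[of _ _ _ _ "(/)", OF _ refl]) algebra
    then show "((\<lambda>t. A t / B t) has_real_derivative A t / B t * - la t) (at t within I)"
      using deriv_AB[OF t] by simp
  qed (use pos[OF t] in simp)
  have dlc: "((\<lambda>t. ln (C t / B t)) has_real_derivative - lc t) (at t within I)" if t: "t \<in> I" for t
  proof (rule ln_deriv)
    have "- 8 * f1 t * (B t - C t) * (A t + B t + C t) / n t = - lc t"
      unfolding lc_def minus_divide_left by (rule arg_cong2[of _ _ _ _ "(/)", OF _ refl]) algebra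
    then show "((\<lambda>t. C t / B t) has_real_derivative C t / B t * - lc t) (at t within I)"
      using deriv_CB[OF t] by simp
  qed (use pos[OF t] in simp)
  have dlb: "((\<lambda>t. ln (B t)) has_real_derivative lb t) (at t within I)" if t: "t \<in> I" for t
  proof (rule ln_deriv)
    show "(B has_real_derivative B t * lb t) (at t within I)"
      using deriv(2)[OF t] by (simp add: lb_def mult_ac)
  qed (use pos[OF t] in simp)
  have bounds: "8 * \<delta>\<^sup>2 * \<beta> t \<le> la t" "la t \<le> 128 * \<beta> t" "8 * \<phi> * \<delta> * \<beta> t \<le> lc t" "lc t \<le> 24 * \<beta> t" "lb t \<le> 16 * \<beta> t"
    if t: "t \<in> I" "s \<le> t" for t
  proof -
    note p = pos[OF t(1)] and g = gap[OF t] and f3p = less_imp_le[OF f3_pos(2)[OF t(1)]] and f1p = less_imp_le[OF f1[OF t]]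
    have "8 * (\<delta> * (B t)\<^sup>2) * B t * (\<delta> * B t) \<le> 8 * f3 t * (A t + B t) * (B t - C t - A t)"
      using p g f3p f3_lb'[OF t] \<delta>_le[OF t] \<delta> by (intro mult_mono mult_nonneg_nonneg) auto
    then show "8 * \<delta>\<^sup>2 * \<beta> t \<le> la t"
      unfolding la_def \<beta>_def times_divide_eq_right
      by (intro divide_right_mono zero_le_power2) (simp add: power2_eq_square power4_eq_xxxx mult_ac)
    have "8 * f3 t * (A t + B t) * (B t - C t - A t) \<le> 8 * (8 * (B t)\<^sup>2) * (2 * B t) * B t"
      using p g f3p f3_ub[OF t] by (intro mult_mono mult_nonneg_nonneg) auto
    then show "la t \<le> 128 * \<beta> t"
      unfolding la_def \<beta>_def times_divide_eq_right
      by (intro divide_right_mono zero_le_power2) (simp add: power2_eq_square power4_eq_xxxx mult_ac)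
    have "8 * (\<phi> * (B t)\<^sup>2) * (\<delta> * B t) * B t \<le> 8 * f1 t * (B t - C t) * (A t + B t + C t)"
      using p g f1p f1_lb[OF t] \<delta>_le'[OF t] \<delta> \<phi> by (intro mult_mono mult_nonneg_nonneg) auto
    then show "8 * \<phi> * \<delta> * \<beta> t \<le> lc t"
      unfolding lc_def \<beta>_def times_divide_eq_right
      by (intro divide_right_mono zero_le_power2) (simp add: power2_eq_square power4_eq_xxxx mult_ac)
    have "8 * f1 t * (B t - C t) * (A t + B t + C t) \<le> 8 * (B t)\<^sup>2 * B t * (3 * B t)"
      using p g f1p f1_ub[OF t] B_ge_C[OF t(1)] by (intro mult_mono mult_nonneg_nonneg) auto
    then show "lc t \<le> 24 * \<beta> t"
      unfolding lc_def \<beta>_def times_divide_eq_right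
      by (intro divide_right_mono zero_le_power2) (simp add: power2_eq_square power4_eq_xxxx mult_ac)
    have "2 * (f3 t * f1 t) \<le> 2 * (8 * (B t)\<^sup>2 * (B t)\<^sup>2)"
      using f3p f1p f3_ub[OF t] f1_ub[OF t] by (intro mult_mono mult_nonneg_nonneg) auto
    then show "lb t \<le> 16 * \<beta> t"
      unfolding lb_def \<beta>_def times_divide_eq_right
      by (intro divide_right_mono zero_le_power2) (simp add: power2_eq_square power4_eq_xxxx mult_ac)
  qed
  \<comment> \<open>\<open>ln v - L / K * ln u\<close> is nondecreasing, since \<open>v\<close>
    decays at most at rate \<open>L * \<beta>\<close> and \<open>u\<close> at least at rate
    \<open>K * \<beta>\<close>. A lower bound for \<open>u\<close> thus passes to
    \<open>v\<close>.\<close>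
  have compare: "\<exists>m>0. \<forall>t\<in>I. s \<le> t \<longrightarrow> m \<le> v t"
    if dv: "\<And>t. t \<in> I \<Longrightarrow> ((\<lambda>t. ln (v t)) has_real_derivative - l t) (at t within I)"
      and du: "\<And>t. t \<in> I \<Longrightarrow> ((\<lambda>t. ln (u t)) has_real_derivative - k t) (at t within I)"
      and l: "\<And>t. t \<in> I \<Longrightarrow> s \<le> t \<Longrightarrow> l t \<le> L * \<beta> t" and k: "\<And>t. t \<in> I \<Longrightarrow> s \<le> t \<Longrightarrow> K * \<beta> t \<le> k t"
      and "K > 0" "L > 0" and u: "\<And>t. t \<in> I \<Longrightarrow> s \<le> t \<Longrightarrow> e \<le> u t" and "e > 0"
      and v: "\<And>t. t \<in> I \<Longrightarrow> s \<le> t \<Longrightarrow> v t > 0" for u v l k :: "real \<Rightarrow> real" and K L e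
  proof (intro exI[of _ "exp (ln (v s) - L / K * ln (u s) + L / K * ln e)"] conjI ballI impI)
    fix t assume t: "t \<in> I" "s \<le> t"
    have "ln (v s) - L / K * ln (u s) \<le> ln (v t) - L / K * ln (u t)"
    proof (rule I_mono[OF s t DERIV_diff[OF dv DERIV_cmult[OF du]]])
      fix x assume x: "x \<in> I" "s \<le> x"
      have "L * \<beta> x = L / K * (K * \<beta> x)" using \<open>K > 0\<close> by simp
      also have "\<dots> \<le> L / K * k x" using k[OF x] \<open>K > 0\<close> \<open>L > 0\<close> by (intro mult_left_mono) auto
      finally show "0 \<le> - l x - L / K * - k x" using l[OF x] by simp
    qed
    moreover have "L / K * ln e \<le> L / K * ln (u t)"
      using u[OF t] \<open>e > 0\<close> \<open>K > 0\<close> \<open>L > 0\<close> by (intro mult_left_mono ln_mono) auto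
    ultimately have "ln (v s) - L / K * ln (u s) + L / K * ln e \<le> ln (v t)" by linarith
    then have "exp (ln (v s) - L / K * ln (u s) + L / K * ln e) \<le> exp (ln (v t))" by (rule exp_mono)
    then show "exp (ln (v s) - L / K * ln (u s) + L / K * ln e) \<le> v t" using v[OF t] by simp
  qed simp
  \<comment> \<open>If \<open>A / B\<close> stayed above \<open>e\<close>, comparison would bound
    \<open>C / B\<close> and \<open>1 / B\<close> from below, and all coefficients would remain in a
    compact set.\<close>
  have a_inf: "\<exists>x\<ge>s. x < T \<and> A x / B x < e" if "e > 0" for e
  proof (rule ccontr)
    assume "\<not> ?thesis"
    then have le: "e \<le> A t / B t" if "t \<in> I" "s \<le> t" for t using that T by (auto simp: not_less)
    obtain mc where mc: "mc > 0" "\<And>t. t \<in> I \<Longrightarrow> s \<le> t \<Longrightarrow> mc \<le> C t / B t"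
      using compare[of "\<lambda>t. C t / B t" lc "\<lambda>t. A t / B t" la 24 "8 * \<delta>\<^sup>2" e] dlc dla bounds(4,1) \<delta> le \<open>e > 0\<close> pos by auto
    have dib: "((\<lambda>t. ln (1 / B t)) has_real_derivative - lb t) (at t within I)" if t: "t \<in> I" for t
      using DERIV_minus[OF dlb[OF t]] by (simp add: ln_div ln_inverse flip: inverse_eq_divide)
    obtain mb where mb: "mb > 0" "\<And>t. t \<in> I \<Longrightarrow> s \<le> t \<Longrightarrow> mb \<le> 1 / B t"
      using compare[of "\<lambda>t. 1 / B t" lb "\<lambda>t. A t / B t" la 16 "8 * \<delta>\<^sup>2" e] dib dla bounds(5,1) \<delta> le \<open>e > 0\<close> pos by auto
    define m where "m = min (B s) (min (e * B s) (mc * B s))"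
    have "m > 0" using \<open>e > 0\<close> mc pos[OF s] by (simp add: m_def)
    from escape[OF T(2) s this, of "1 / mb"] obtain t where t: "t \<in> I" "s \<le> t" and bad: "\<not> {A t, B t, C t} \<subseteq> {m..1 / mb}"
      by blast
    note p = pos[OF t(1)]
    have "B t \<le> 1 / mb" using mb(2)[OF t] mb(1) p by (simp add: field_simps)
    moreover have "A t \<le> B t" "C t \<le> B t" using gap[OF t] p B_ge_C[OF t(1)] by auto
    moreover have "e * B s \<le> A t / B t * B t" "mc * B s \<le> C t / B t * B t"
      using le[OF t] mc(2)[OF t] B_mono[OF t] p pos[OF s] \<open>e > 0\<close> mc(1) by (intro mult_mono; simp)+
    then have "m \<le> A t" "m \<le> B t" "m \<le> C t" using B_mono[OF t] p by (auto simp: m_def)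
    ultimately show False using bad by auto
  qed
  have c_inf: "\<exists>x\<ge>s. x < T \<and> C x / B x < e" if "e > 0" for e
  proof (rule ccontr)
    assume "\<not> ?thesis"
    then have le: "e \<le> C t / B t" if "t \<in> I" "s \<le> t" for t using that T by (auto simp: not_less)
    obtain ma where "ma > 0" "\<And>t. t \<in> I \<Longrightarrow> s \<le> t \<Longrightarrow> ma \<le> A t / B t"
      using compare[of "\<lambda>t. A t / B t" la "\<lambda>t. C t / B t" lc 128 "8 * \<phi> * \<delta>" e] dlc dla bounds(2,3) \<delta> \<phi> le \<open>e > 0\<close> pos by auto
    with a_inf[of ma] s T I_nonneg show False by fastforce
  qed
  have "((\<lambda>t. A t / B t) \<longlongrightarrow> 0) (at_left T)"
    by (rule antimono_tendsto_zero[of s, OF _ _ a_inf]) (use s T pos in \<open>auto intro!: a_anti divide_nonneg_nonneg simp: less_imp_le\<close>)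
  moreover have "((\<lambda>t. C t / B t) \<longlongrightarrow> 0) (at_left T)"
    by (rule antimono_tendsto_zero[of s, OF _ _ c_inf]) (use s T pos in \<open>auto intro!: c_anti divide_nonneg_nonneg simp: less_imp_le\<close>)
  ultimately show ?thesis using T by blast
qed

section \<open>The borderline regime\<close>

text \<open>The hypotheses fix the signs of all three factors: \<open>A\<close> and \<open>B\<close>
  do not increase, \<open>C\<close> does not decrease, so only \<open>A\<close> can degenerate. The
  condition on \<open>f1\<close> is the upper bound for \<open>w\<close>, which an escape upwards
  from the unstable value would violate; an escape downwards would violate positivity.\<close>

lemma regime3:
  assumes gap: "\<And>t. t \<in> I \<Longrightarrow> A t < B t - C t" and f1: "\<And>t. t \<in> I \<Longrightarrow> f1 t \<le> 0"
  shows "\<exists>T>0. I = {0..<T} \<and> (\<exists>CT>0. (C \<longlongrightarrow> CT) (at_left T) \<and>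
          A \<sim>[at_left T] (\<lambda>t. 64 / CT * (T - t)) \<and>
          (\<lambda>t. B t - CT) \<sim>[at_left T] (\<lambda>t. 4 * sqrt (2 * (T - t))) \<and>
          (\<lambda>t. C t - CT) \<sim>[at_left T] (\<lambda>t. - 4 * sqrt (2 * (T - t))))"
proof -
  define S where "S t = B t + C t" for t
  define w where "w t = (B t - C t)\<^sup>2 / A t" for t
  have f3_lb: "f3 t \<ge> (B t - C t) * B t" if t: "t \<in> I" for t
  proof -
    have "f3 t = (B t - C t) * B t + (2 * C t * (B t - C t - A t) + A t * (A t + B t + C t) + (B t - C t) * (A t + C t))"
      unfolding F3_def by algebra
    moreover have "0 \<le> 2 * C t * (B t - C t - A t) + A t * (A t + B t + C t) + (B t - C t) * (A t + C t)"
      using pos[OF t] gap[OF t] B_ge_C[OF t] by (intro add_nonneg_nonneg mult_nonneg_nonneg) auto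
    ultimately show ?thesis by linarith
  qed
  have f2_ub: "f2 t \<le> - (B t * (B t - C t))" if t: "t \<in> I" for t
  proof -
    have "f2 t = - (B t * (B t - C t)) - (B t * (A t + A t + (B t - C t)) + (A t + B t + C t) * (B t - C t - A t))"
      unfolding F2_def by algebra
    moreover have "0 \<le> B t * (A t + A t + (B t - C t)) + (A t + B t + C t) * (B t - C t - A t)"
      using pos[OF t] gap[OF t] B_ge_C[OF t] by (intro add_nonneg_nonneg mult_nonneg_nonneg) auto
    ultimately show ?thesis by linarith
  qed
  have f2: "f2 t \<le> 0" if t: "t \<in> I" for t
    using f2_ub[OF t] mult_nonneg_nonneg[of "B t" "B t - C t"] pos[OF t] B_ge_C[OF t] by linarith
  have f3: "f3 t \<ge> 0" if t: "t \<in> I" for t using f3_pos(2)[OF t] by simp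
  have rates: "2 * A t * (f2 t * f3 t) / n t \<le> 0" "2 * B t * (f3 t * f1 t) / n t \<le> 0" "0 \<le> 2 * C t * (f1 t * f2 t) / n t"
    if t: "t \<in> I" for t
    using divide_nonpos_nonneg[OF mult_nonneg_nonpos[OF _ mult_nonpos_nonneg[OF f2[OF t] f3[OF t]]] zero_le_power2, of "2 * A t"]
      divide_nonpos_nonneg[OF mult_nonneg_nonpos[OF _ mult_nonneg_nonpos[OF f3[OF t] f1[OF t]]] zero_le_power2, of "2 * B t"]
      divide_nonneg_nonneg[OF mult_nonneg_nonneg[OF _ mult_nonpos_nonpos[OF f1[OF t] f2[OF t]]] zero_le_power2, of "2 * C t"]
      pos[OF t] by simp_all
  have A_anti: "A y \<le> A x" if "x \<in> I" "y \<in> I" "x \<le> y" for x y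
    using I_antimono[OF that deriv(1) rates(1)] .
  have B_anti: "B y \<le> B x" if "x \<in> I" "y \<in> I" "x \<le> y" for x y
    using I_antimono[OF that deriv(2) rates(2)] .
  have C_mono: "C x \<le> C y" if "x \<in> I" "y \<in> I" "x \<le> y" for x y
    using I_mono[OF that deriv(3) rates(3)] .
  define M where "M = B 0"
  have M: "M > 0" using pos(2)[OF zero_in_I] by (simp add: M_def)
  have bnd: "C 0 \<le> C t" "C t \<le> M" "B t \<le> M" "A t \<le> M" "S t \<le> 2 * M" "0 < S t" if t: "t \<in> I" for t
    using C_mono[OF zero_in_I t] B_anti[OF zero_in_I t] B_ge_C[OF t] gap[OF t] I_nonneg[OF t] pos[OF t]
    by (auto simp: M_def S_def)
  have wA: "(B t - C t)\<^sup>2 = w t * A t" if t: "t \<in> I" for t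
    using pos(1)[OF t] by (simp add: w_def)
  have f1_w: "f1 t = A t * (w t - 2 * S t - 3 * A t)" if t: "t \<in> I" for t
    unfolding f1_eq wA[OF t] S_def by algebra
  have w: "0 < w t" "w t \<le> 2 * S t + 3 * A t" "w t \<le> 7 * M" if t: "t \<in> I" for t
  proof -
    show "0 < w t" using pos[OF t] gap[OF t] by (simp add: w_def)
    show "w t \<le> 2 * S t + 3 * A t"
      using f1[OF t] pos(1)[OF t] unfolding f1_w[OF t] by (simp add: mult_le_0_iff)
    then show "w t \<le> 7 * M" using bnd[OF t] by linarith
  qed
  have quad: "4 * B t * C t + (A t + B t + C t)\<^sup>2 = (S t)\<^sup>2 - w t * A t + (A t + S t)\<^sup>2" if t: "t \<in> I" for t
    unfolding wA[OF t, symmetric] S_def by algebra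
  have f23: "f2 t * f3 t = A t * (A t * (A t - w t)\<^sup>2 - 4 * w t * (A t + S t)\<^sup>2)" if t: "t \<in> I" for t
  proof -
    have "f2 t * f3 t = ((A t)\<^sup>2 - (B t - C t)\<^sup>2)\<^sup>2 - 4 * (B t - C t)\<^sup>2 * (A t + S t)\<^sup>2"
      unfolding F2_def F3_def S_def by algebra
    then show ?thesis unfolding wA[OF t] by algebra
  qed
  \<comment> \<open>Replacing \<open>(B - C)^2\<close> by \<open>w * A\<close> exposes a factor
    \<open>A^2\<close> that cancels the one in the denominator. \<open>A'\<close> and the
    \<open>S'\<close> below are therefore regular as \<open>A\<close> tends to 0.\<close>
  define A' where "A' t = 2 * (A t * (A t - w t)\<^sup>2 - 4 * w t * (A t + S t)\<^sup>2) / (B t * C t)\<^sup>2" for t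
  define S' where "S' t = 2 * (w t - 2 * S t - 3 * A t) * (S t * A t + S t * w t + 2 * w t * A t) / (B t * C t)\<^sup>2" for t
  have cancel: "a * a * x / (a * b * c)\<^sup>2 = x / (b * c)\<^sup>2" if "a > 0" for a b c x :: real
    using that by (simp add: power2_eq_square)
  have dA: "(A has_real_derivative A' t) (at t within I)" if t: "t \<in> I" for t
  proof -
    have "2 * A t * (f2 t * f3 t) = A t * A t * (2 * (A t * (A t - w t)\<^sup>2 - 4 * w t * (A t + S t)\<^sup>2))"
      unfolding f23[OF t] by algebra
    then show ?thesis using deriv(1)[OF t] unfolding A'_def by (simp only: cancel[OF pos(1)[OF t]])
  qed
  have dS: "(S has_real_derivative S' t) (at t within I)" if t: "t \<in> I" for t
  proof -
    have "B t * f3 t + C t * f2 t = S t * (A t)\<^sup>2 + S t * (B t - C t)\<^sup>2 + 2 * (B t - C t)\<^sup>2 * A t"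
      unfolding F2_def F3_def S_def by algebra
    then have e: "B t * f3 t + C t * f2 t = A t * (S t * A t + S t * w t + 2 * w t * A t)"
      unfolding wA[OF t] by algebra
    have "2 * B t * (f3 t * f1 t) + 2 * C t * (f1 t * f2 t) = 2 * f1 t * (B t * f3 t + C t * f2 t)" by algebra
    also have "\<dots> = A t * A t * (2 * (w t - 2 * S t - 3 * A t) * (S t * A t + S t * w t + 2 * w t * A t))"
      unfolding e f1_w[OF t] by algebra
    finally have "2 * B t * (f3 t * f1 t) / n t + 2 * C t * (f1 t * f2 t) / n t = S' t"
      unfolding S'_def add_divide_distrib[symmetric] by (simp only: cancel[OF pos(1)[OF t]])
    then show ?thesis using DERIV_add[OF deriv(2,3)[OF t]] unfolding S_def by simp
  qed
  define \<nu> where "\<nu> t = w t / (A t * (B t * C t)\<^sup>2)" for t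
  have \<nu>: "\<nu> t > 0" if t: "t \<in> I" for t using w[OF t] pos[OF t] by (simp add: \<nu>_def)
  \<comment> \<open>Collects all terms of the \<open>w\<close> equation that carry an extra factor
    \<open>A\<close>; only its boundedness matters.\<close>
  define \<rho> where "\<rho> t = 4 * (w t - 2 * S t) * (2 * S t + A t - w t) - 12 * (2 * (S t)\<^sup>2 + 2 * A t * S t + (A t)\<^sup>2 - w t * A t)
     - 2 * (A t - w t)\<^sup>2 + 8 * w t * (2 * S t + A t)" for t
  define \<theta> where "\<theta> t = 16 * (S t)\<^sup>2 * (w t - S t) + A t * \<rho> t" for t
  have dw: "(w has_real_derivative \<nu> t * \<theta> t) (at t within I)" if t: "t \<in> I" for t
  proof -
    define \<epsilon>' where "\<epsilon>' = 2 * f1 t * (4 * B t * C t + (A t + B t + C t)\<^sup>2) / n t"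
    have "B t * f3 t - C t * f2 t = (B t - C t) * (4 * B t * C t + (A t + B t + C t)\<^sup>2)"
      unfolding F2_def F3_def by algebra
    then have "2 * B t * (f3 t * f1 t) - 2 * C t * (f1 t * f2 t) = 2 * f1 t * (4 * B t * C t + (A t + B t + C t)\<^sup>2) * (B t - C t)"
      by algebra
    then have "2 * B t * (f3 t * f1 t) / n t - 2 * C t * (f1 t * f2 t) / n t = (B t - C t) * \<epsilon>'"
      unfolding \<epsilon>'_def by (simp flip: diff_divide_distrib)
    then have dE: "((\<lambda>t. B t - C t) has_real_derivative (B t - C t) * \<epsilon>') (at t within I)"
      using DERIV_diff[OF deriv(2,3)[OF t]] by simp
    have dA2: "(A has_real_derivative A t * (2 * (f2 t * f3 t) / n t)) (at t within I)"
      using deriv(1)[OF t] by (simp add: mult_ac)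
    have "2 * (4 * f1 t * (4 * B t * C t + (A t + B t + C t)\<^sup>2)) / 2 - 2 * (f2 t * f3 t) = A t * \<theta> t"
      unfolding quad[OF t] f1_w[OF t] f23[OF t] \<theta>_def \<rho>_def by (simp add: field_simps power2_eq_square)
    then have "2 * \<epsilon>' - 2 * (f2 t * f3 t) / n t = A t * \<theta> t / n t"
      unfolding \<epsilon>'_def by (simp add: field_simps flip: diff_divide_distrib)
    also have "\<dots> = \<theta> t / (A t * (B t * C t)\<^sup>2)"
      using pos[OF t] by (simp add: power2_eq_square)
    finally have e: "w t * (2 * \<epsilon>' - 2 * (f2 t * f3 t) / n t) = \<nu> t * \<theta> t" by (simp add: \<nu>_def)
    have q: "(a * (2 * p * (p * x)) - p\<^sup>2 * (a * y)) / (a * a) = p\<^sup>2 / a * (2 * x - y)" if "a > 0" for a p x y :: real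
      using that by (simp add: field_simps power2_eq_square)
    have "((\<lambda>t. (B t - C t)\<^sup>2 / A t) has_real_derivative (B t - C t)\<^sup>2 / A t * (2 * \<epsilon>' - 2 * (f2 t * f3 t) / n t)) (at t within I)"
      unfolding q[OF pos(1)[OF t], symmetric]
      by (rule DERIV_cong, rule DERIV_divide[OF DERIV_power[OF dE] dA2]) (use pos[OF t] in \<open>auto simp: mult_ac\<close>)
    then show ?thesis using e unfolding w_def by simp
  qed
  \<comment> \<open>A crude constant: the seven products estimated below add up to
    \<open>1176 * M^2\<close>.\<close>
  define R where "R = 2000 * M\<^sup>2"
  have R: "R > 0" using M by (simp add: R_def)
  have \<rho>: "\<bar>\<rho> t\<bar> \<le> R" if t: "t \<in> I" for t
  proof -
    note b = bnd[OF t] w[OF t] pos(1)[OF t]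
    define m where "m = M * M"
    have "m \<ge> 0" by (simp add: m_def)
    have combine: "\<bar>4 * x1 - 12 * (2 * x2 + 2 * x3 + x4 - x5) - 2 * x6 + 8 * x7\<bar> \<le> 2000 * m"
      if "\<bar>x1\<bar> \<le> 132 * m" "\<bar>x2\<bar> \<le> 4 * m" "\<bar>x3\<bar> \<le> 2 * m" "\<bar>x4\<bar> \<le> m" "\<bar>x5\<bar> \<le> 7 * m"
        "\<bar>x6\<bar> \<le> 64 * m" "\<bar>x7\<bar> \<le> 35 * m" for x1 x2 x3 x4 x5 x6 x7 :: real
      using that \<open>m \<ge> 0\<close> unfolding abs_le_iff by auto
    have prod: "\<bar>x * y\<bar> \<le> p * q * m" if "\<bar>x\<bar> \<le> p * M" "\<bar>y\<bar> \<le> q * M" for x y p q :: real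
      using mult_mono[OF that] order_trans[OF abs_ge_zero that(1)] by (simp add: abs_mult m_def mult_ac)
    have "\<rho> t = 4 * ((w t - 2 * S t) * (2 * S t + A t - w t))
       - 12 * (2 * (S t * S t) + 2 * (A t * S t) + A t * A t - w t * A t)
       - 2 * ((A t - w t) * (A t - w t)) + 8 * (w t * (2 * S t + A t))"
      by (simp add: \<rho>_def power2_eq_square)
    also have "\<bar>\<dots>\<bar> \<le> 2000 * m"
    proof (rule combine)
      show "\<bar>(w t - 2 * S t) * (2 * S t + A t - w t)\<bar> \<le> 132 * m"
        using prod[of "w t - 2 * S t" 11 "2 * S t + A t - w t" 12] b M by (simp add: abs_le_iff)
      show "\<bar>S t * S t\<bar> \<le> 4 * m" using prod[of "S t" 2 "S t" 2] b M by simp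
      show "\<bar>A t * S t\<bar> \<le> 2 * m" using prod[of "A t" 1 "S t" 2] b M by simp
      show "\<bar>A t * A t\<bar> \<le> m" using prod[of "A t" 1 "A t" 1] b M by simp
      show "\<bar>w t * A t\<bar> \<le> 7 * m" using prod[of "w t" 7 "A t" 1] b M by simp
      show "\<bar>(A t - w t) * (A t - w t)\<bar> \<le> 64 * m"
        using prod[of "A t - w t" 8 "A t - w t" 8] b M by (simp add: abs_le_iff)
      show "\<bar>w t * (2 * S t + A t)\<bar> \<le> 35 * m"
        using prod[of "w t" 7 "2 * S t + A t" 5] b M by (simp add: abs_le_iff)
    qed
    finally show ?thesis by (simp add: R_def m_def power2_eq_square)
  qed
  \<comment> \<open>The eventual limit of the nonincreasing \<open>S\<close>, taken as an infimum
    because the end of \<open>I\<close> is not yet known to be finite.\<close>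
  define L where "L = Inf (S ` I)"
  have bdd: "bdd_below (S ` I)" using bnd(6) by (intro bdd_belowI2[of _ 0]) (auto simp: less_imp_le)
  have SL: "L \<le> S t" if t: "t \<in> I" for t unfolding L_def using t bdd by (intro cInf_lower) auto
  have L: "L > 0"
  proof -
    have "C 0 \<le> L" unfolding L_def
    proof (rule cInf_greatest)
      show "C 0 \<le> x" if "x \<in> S ` I" for x
        using that bnd(1) pos(2) unfolding S_def by (force simp: add_increasing)
    qed (use zero_in_I in auto)
    then show ?thesis using pos(3)[OF zero_in_I] by simp
  qed
  have S_anti: "S y \<le> S x" if "x \<in> I" "y \<in> I" "x \<le> y" for x y
  proof (rule I_antimono[OF that dS])
    fix t assume t: "t \<in> I" "x \<le> t"
    have "0 \<le> S t * A t + S t * w t + 2 * w t * A t"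
      using bnd[OF t(1)] w[OF t(1)] pos[OF t(1)] by (intro add_nonneg_nonneg mult_nonneg_nonneg) auto
    moreover have "2 * (w t - 2 * S t - 3 * A t) \<le> 0" using w(2)[OF t(1)] by simp
    ultimately show "S' t \<le> 0"
      unfolding S'_def by (metis divide_nonpos_nonneg mult_nonpos_nonneg zero_le_power2)
  qed
  have S_late: "\<exists>s\<in>I. \<forall>t\<in>I. s \<le> t \<longrightarrow> S t < L + e" if "e > 0" for e
  proof -
    have "\<exists>x\<in>S ` I. x < L + e"
      by (rule cInf_lessD) (use zero_in_I that in \<open>auto simp: L_def\<close>)
    then obtain s where "s \<in> I" "S s < L + e" by blast
    then show ?thesis using S_anti by (meson le_less_trans)
  qed
  \<comment> \<open>If \<open>A\<close> stayed above \<open>e\<close>, so would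
    \<open>B - C\<close>. Then \<open>A^2\<close> would decrease at a definite rate, the time
    interval would be finite, and yet the solution would remain in a compact set.\<close>
  have A_late: "\<exists>s\<in>I. \<forall>t\<in>I. s \<le> t \<longrightarrow> A t < e" if "e > 0" for e
  proof -
    have "\<exists>s\<in>I. A s < e"
    proof (rule ccontr)
      assume "\<not> ?thesis"
      then have le: "e \<le> A t" if "t \<in> I" for t using that by (auto simp: not_less)
      have "\<exists>T>0. I = {0..<T}"
      proof (rule I_bounded[OF zero_in_I])
        fix t assume t: "t \<in> I" "0 \<le> t"
        note p = pos[OF t(1)]
        show "((\<lambda>t. (A t)\<^sup>2) has_real_derivative 4 * (f2 t * f3 t) / (B t * C t)\<^sup>2) (at t within I)"
          by (rule DERIV_cong, rule DERIV_power[OF deriv(1)[OF t(1)]])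
            (use p in \<open>simp add: field_simps power2_eq_square\<close>)
        have E: "e \<le> B t - C t" using le[OF t(1)] gap[OF t(1)] by simp
        have "(B t * e) * (e * B t) \<le> (B t * (B t - C t)) * ((B t - C t) * B t)"
          using p E \<open>e > 0\<close> by (intro mult_mono mult_nonneg_nonneg) auto
        also have "\<dots> \<le> (- f2 t) * f3 t"
          using f2_ub[OF t(1)] f3_lb[OF t(1)] p B_ge_C[OF t(1)] f2[OF t(1)] by (intro mult_mono mult_nonneg_nonneg) auto
        finally have *: "(B t * e) * (e * B t) \<le> - (f2 t * f3 t)" by simp
        have "e\<^sup>2 / M\<^sup>2 * (B t * C t)\<^sup>2 \<le> e\<^sup>2 / M\<^sup>2 * (B t * M)\<^sup>2"
          using bnd[OF t(1)] p by (intro mult_left_mono power_mono) auto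
        also have "\<dots> = (B t * e) * (e * B t)" using M by (simp add: power2_eq_square field_simps)
        finally have "4 * (f2 t * f3 t) \<le> - (4 * (e\<^sup>2 / M\<^sup>2)) * (B t * C t)\<^sup>2" using * by linarith
        then show "4 * (f2 t * f3 t) / (B t * C t)\<^sup>2 \<le> - (4 * (e\<^sup>2 / M\<^sup>2))"
          using p by (simp add: pos_divide_le_eq)
      qed (use \<open>e > 0\<close> M in auto)
      then obtain T where T: "T > 0" "I = {0..<T}" by blast
      define m where "m = min e (C 0)"
      have "m > 0" using \<open>e > 0\<close> pos(3)[OF zero_in_I] by (simp add: m_def)
      from escape[OF T(2) zero_in_I this, of M] obtain t where t: "t \<in> I" "\<not> {A t, B t, C t} \<subseteq> {m..M}" by blast
      then show False using bnd[OF t(1)] le[OF t(1)] B_ge_C[OF t(1)] by (auto simp: m_def)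
    qed
    then show ?thesis using A_anti by (meson le_less_trans)
  qed
  \<comment> \<open>The constant is \<open>2 * 4 * 3^2\<close>, from
    \<open>A + S \<le> 3 * M\<close>. The bound expresses that \<open>ln A\<close> falls no faster
    than a multiple of the factor \<open>\<nu>\<close> that also drives \<open>w\<close>.\<close>
  have lnA_rate: "- (72 * M\<^sup>2) * \<nu> t \<le> A' t / A t" if t: "t \<in> I" for t
  proof -
    note p = pos[OF t] and b = bnd[OF t]
    have "- (72 * M\<^sup>2) * w t = 2 * (0 - 4 * w t * (3 * M)\<^sup>2)" by (simp add: power_mult_distrib)
    also have "\<dots> \<le> 2 * (A t * (A t - w t)\<^sup>2 - 4 * w t * (A t + S t)\<^sup>2)"
      using p b w[OF t] by (intro mult_left_mono diff_mono power_mono) auto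
    finally have "- (72 * M\<^sup>2) * w t \<le> 2 * (A t * (A t - w t)\<^sup>2 - 4 * w t * (A t + S t)\<^sup>2)" .
    then have "- (72 * M\<^sup>2) * w t / (B t * C t)\<^sup>2 / A t \<le> A' t / A t"
      unfolding A'_def using p by (intro divide_right_mono zero_le_power2) auto
    then show ?thesis by (simp add: \<nu>_def field_simps)
  qed
  text \<open>A drift of \<open>w\<close> of constant sign would, measured against \<open>ln A \<rightarrow> - \<infinity>\<close>, make \<open>w\<close> unbounded.\<close>
  have trap: False if "t1 \<in> I" "\<kappa> > 0" "\<bar>\<sigma>\<bar> = 1" and drift: "\<And>t. t \<in> I \<Longrightarrow> t1 \<le> t \<Longrightarrow> \<kappa> \<le> \<sigma> * \<theta> t" for t1 \<kappa> \<sigma> :: real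
  proof -
    define c where "c = \<kappa> / (72 * M\<^sup>2)"
    have c: "c > 0" using \<open>\<kappa> > 0\<close> M by (simp add: c_def)
    have mono: "\<sigma> * w t1 + c * ln (A t1) \<le> \<sigma> * w t + c * ln (A t)" if t: "t \<in> I" "t1 \<le> t" for t
    proof (rule I_mono[OF \<open>t1 \<in> I\<close> t])
      fix x assume x: "x \<in> I" "t1 \<le> x"
      have "(A has_real_derivative A x * (A' x / A x)) (at x within I)" using dA[OF x(1)] pos(1)[OF x(1)] by simp
      from DERIV_add[OF DERIV_cmult[OF dw[OF x(1)], of \<sigma>] DERIV_cmult[OF ln_deriv[OF this pos(1)[OF x(1)]], of c]]
      show "((\<lambda>x. \<sigma> * w x + c * ln (A x)) has_real_derivative \<sigma> * (\<nu> x * \<theta> x) + c * (A' x / A x)) (at x within I)" .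
      have "\<nu> x * \<kappa> \<le> \<nu> x * (\<sigma> * \<theta> x)" using drift[OF x] \<nu>[OF x(1)] by (intro mult_left_mono) auto
      moreover have "c * (- (72 * M\<^sup>2) * \<nu> x) \<le> c * (A' x / A x)"
        by (rule mult_left_mono[OF lnA_rate[OF x(1)]]) (use c in simp)
      moreover have "c * (- (72 * M\<^sup>2) * \<nu> x) = - (\<nu> x * \<kappa>)" using M by (simp add: c_def)
      moreover have "\<nu> x * (\<sigma> * \<theta> x) = \<sigma> * (\<nu> x * \<theta> x)" by simp
      ultimately show "0 \<le> \<sigma> * (\<nu> x * \<theta> x) + c * (A' x / A x)" by linarith
    qed
    \<comment> \<open>Since \<open>w\<close> lies between 0 and \<open>7 * M\<close>,
      \<open>\<sigma> * w\<close> cannot change by more than \<open>14 * M\<close>; once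
      \<open>A\<close> is below this \<open>e\<close>, the drift would have forced a larger
      change.\<close>
    define e where "e = A t1 * exp (- ((14 * M + 1) / c))"
    have "e > 0" using pos(1)[OF \<open>t1 \<in> I\<close>] by (simp add: e_def)
    from A_late[OF this] obtain s where s: "s \<in> I" "\<forall>t\<in>I. s \<le> t \<longrightarrow> A t < e" by blast
    define t where "t = max s t1"
    have t: "t \<in> I" "t1 \<le> t" "A t < e" using s \<open>t1 \<in> I\<close> by (auto simp: t_def max_def)
    have "ln (A t) < ln e" using t pos(1)[OF t(1)] \<open>e > 0\<close> by simp
    also have "ln e = ln (A t1) - (14 * M + 1) / c"
      using pos(1)[OF \<open>t1 \<in> I\<close>] by (simp add: e_def ln_mult)
    finally have "c * ln (A t) < c * (ln (A t1) - (14 * M + 1) / c)"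
      using c by (rule mult_strict_left_mono)
    then have "c * ln (A t) < c * ln (A t1) - (14 * M + 1)"
      using c by (simp add: right_diff_distrib)
    then have "14 * M + 1 < \<sigma> * w t - \<sigma> * w t1" using mono[OF t(1,2)] by linarith
    moreover have "\<bar>\<sigma> * w x\<bar> \<le> 7 * M" if "x \<in> I" for x
      using w[OF that] \<open>\<bar>\<sigma>\<bar> = 1\<close> by (simp add: abs_mult)
    from this[OF t(1)] this[OF \<open>t1 \<in> I\<close>] have "\<sigma> * w t - \<sigma> * w t1 \<le> 14 * M" by linarith
    ultimately show False by simp
  qed
  \<comment> \<open>A barrier at level \<open>l\<close>: \<open>w - l\<close> satisfies a linear
    equation whose forcing has the sign \<open>\<sigma>\<close>. The sign treats escape upwards and
    downwards together.\<close>
  have persist: "0 \<le> \<sigma> * (w t - l)"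
    if "t1 \<in> I" "t \<in> I" "t1 \<le> t" and start: "0 \<le> \<sigma> * (w t1 - l)"
      and r: "\<And>t. t \<in> I \<Longrightarrow> t1 \<le> t \<Longrightarrow> 0 \<le> \<sigma> * (16 * (S t)\<^sup>2 * (l - S t) + A t * \<rho> t)" for t1 t \<sigma> l :: real
  proof (rule linear_ode_nonneg[OF \<open>t1 \<le> t\<close>, of "\<lambda>t. \<nu> t * (16 * (S t)\<^sup>2)" _ "\<lambda>t. \<nu> t * (\<sigma> * (16 * (S t)\<^sup>2 * (l - S t) + A t * \<rho> t))"])
    have st: "{t1..t} \<subseteq> I" using I_interval that by auto
    show "continuous_on {t1..t} (\<lambda>t. \<nu> t * (16 * (S t)\<^sup>2))"
      unfolding \<nu>_def w_def S_def using st pos by (intro continuous_intros cont) (force simp: less_imp_neq)+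
    fix x assume "x \<in> {t1..t}"
    then have x: "x \<in> I" "t1 \<le> x" using st by auto
    have "((\<lambda>t. \<sigma> * (w t - l)) has_real_derivative \<sigma> * (\<nu> x * \<theta> x - 0)) (at x within I)"
      by (intro DERIV_cmult DERIV_diff dw x DERIV_const)
    moreover have "\<sigma> * (\<nu> x * \<theta> x - 0) = \<nu> x * (16 * (S x)\<^sup>2) * (\<sigma> * (w x - l)) + \<nu> x * (\<sigma> * (16 * (S x)\<^sup>2 * (l - S x) + A x * \<rho> x))"
      unfolding \<theta>_def by algebra
    ultimately show "((\<lambda>t. \<sigma> * (w t - l)) has_real_derivative \<nu> x * (16 * (S x)\<^sup>2) * (\<sigma> * (w x - l))
       + \<nu> x * (\<sigma> * (16 * (S x)\<^sup>2 * (l - S x) + A x * \<rho> x))) (at x within {t1..t})"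
      using DERIV_subset[OF _ st] by simp
    show "0 \<le> \<nu> x * (\<sigma> * (16 * (S x)\<^sup>2 * (l - S x) + A x * \<rho> x))"
      by (rule mult_nonneg_nonneg[OF less_imp_le[OF \<nu>[OF x(1)]] r[OF x]])
  qed (fact start)
  have w_late: "\<exists>s\<in>I. \<forall>t\<in>I. s \<le> t \<longrightarrow> \<bar>w t - L\<bar> < e" if "e > 0" for e
  proof -
    \<comment> \<open>At distance \<open>e / 2\<close> from \<open>S\<close> the leading term has
      size at least \<open>16 * L^2 * (e / 2) = 2 * \<kappa>\<close>; the remainder
      \<open>A * \<rho>\<close> consumes at most one \<open>\<kappa>\<close>, and one is left as
      drift.\<close>
    define \<kappa> where "\<kappa> = 4 * L\<^sup>2 * e"
    have \<kappa>: "\<kappa> > 0" using L \<open>e > 0\<close> by (simp add: \<kappa>_def)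
    obtain s1 where s1: "s1 \<in> I" "\<And>t. t \<in> I \<Longrightarrow> s1 \<le> t \<Longrightarrow> S t < L + e / 2"
      using S_late[of "e / 2"] \<open>e > 0\<close> by auto
    obtain s2 where s2: "s2 \<in> I" "\<And>t. t \<in> I \<Longrightarrow> s2 \<le> t \<Longrightarrow> A t < \<kappa> / R"
      using A_late[of "\<kappa> / R"] \<kappa> R by auto
    define s where "s = max s1 s2"
    have s: "s \<in> I" using s1 s2 by (simp add: s_def max_def)
    have small: "\<bar>A t * \<rho> t\<bar> \<le> \<kappa>" if t: "t \<in> I" "s \<le> t" for t
    proof -
      have "\<bar>A t * \<rho> t\<bar> \<le> \<kappa> / R * R"
        unfolding abs_mult using s2(2)[of t] \<rho>[OF t(1)] t pos(1)[OF t(1)] R by (intro mult_mono) (auto simp: s_def)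
      then show ?thesis using R by simp
    qed
    have gain: "2 * \<kappa> \<le> 16 * (S t)\<^sup>2 * d" if t: "t \<in> I" "e / 2 \<le> d" for t d
    proof -
      have "16 * L\<^sup>2 * (e / 2) \<le> 16 * (S t)\<^sup>2 * d"
        using SL[OF t(1)] L t(2) \<open>e > 0\<close> by (intro mult_mono power_mono) auto
      then show ?thesis by (simp add: \<kappa>_def)
    qed
    have absorb: "2 * \<kappa> \<le> g \<Longrightarrow> \<bar>h\<bar> \<le> \<kappa> \<Longrightarrow> \<kappa> \<le> g + h" for g h :: real by linarith
    have upper: "w t - L < e" if t: "t \<in> I" "s \<le> t" for t
    proof (rule ccontr)
      assume "\<not> ?thesis"
      then have start: "0 \<le> 1 * (w t - (L + e))" by simp
      have r: "\<kappa> \<le> 16 * (S x)\<^sup>2 * (L + e - S x) + A x * \<rho> x" if x: "x \<in> I" "t \<le> x" for x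
      proof (rule absorb[OF gain[OF x(1)] small[OF x(1)]])
        show "s \<le> x" using x t by simp
        then show "e / 2 \<le> L + e - S x" using s1(2)[OF x(1)] by (simp add: s_def)
      qed
      show False
      proof (rule trap[OF t(1) \<kappa>, of 1])
        fix x assume x: "x \<in> I" "t \<le> x"
        have "0 \<le> 1 * (w x - (L + e))"
          by (rule persist[OF t(1) x start]) (use r \<kappa> in force)
        then have "16 * (S x)\<^sup>2 * (L + e - S x) \<le> 16 * (S x)\<^sup>2 * (w x - S x)" by (intro mult_left_mono) auto
        then show "\<kappa> \<le> 1 * \<theta> x" using r[OF x] by (simp add: \<theta>_def)
      qed simp
    qed
    have lower: "- e < w t - L" if t: "t \<in> I" "s \<le> t" for t
    proof (rule ccontr)
      assume "\<not> ?thesis"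
      then have start: "0 \<le> (-1) * (w t - (L - e))" by simp
      have r: "\<kappa> \<le> (-1) * (16 * (S x)\<^sup>2 * (L - e - S x) + A x * \<rho> x)" if x: "x \<in> I" "t \<le> x" for x
      proof -
        have "\<kappa> \<le> 16 * (S x)\<^sup>2 * (S x - L + e) + - (A x * \<rho> x)"
        proof (rule absorb[OF gain[OF x(1)]])
          show "e / 2 \<le> S x - L + e" using SL[OF x(1)] \<open>e > 0\<close> by simp
          show "\<bar>- (A x * \<rho> x)\<bar> \<le> \<kappa>" using small[OF x(1)] x t by simp
        qed
        also have "\<dots> = (-1) * (16 * (S x)\<^sup>2 * (L - e - S x) + A x * \<rho> x)" by algebra
        finally show ?thesis .
      qed
      show False
      proof (rule trap[OF t(1) \<kappa>, of "-1"])
        fix x assume x: "x \<in> I" "t \<le> x"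
        have "0 \<le> (-1) * (w x - (L - e))"
          by (rule persist[OF t(1) x start]) (use r \<kappa> in force)
        then have "16 * (S x)\<^sup>2 * (w x - S x) \<le> 16 * (S x)\<^sup>2 * (L - e - S x)" by (intro mult_left_mono) auto
        then show "\<kappa> \<le> (-1) * \<theta> x" using r[OF x] by (simp add: \<theta>_def)
      qed simp
    qed
    have "\<bar>w t - L\<bar> < e" if t: "t \<in> I" "s \<le> t" for t
      using upper[OF t] lower[OF t] by linarith
    then show ?thesis using s by blast
  qed
  have "\<exists>T>0. I = {0..<T}"
  proof -
    obtain s1 where s1: "s1 \<in> I" "\<And>t. t \<in> I \<Longrightarrow> s1 \<le> t \<Longrightarrow> \<bar>w t - L\<bar> < L / 2"
      using w_late[of "L / 2"] L by auto
    \<comment> \<open>With \<open>A - w\<close> bounded by \<open>8 * M\<close>, this threshold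
      keeps \<open>A * (A - w)^2\<close> below \<open>L^3\<close>, half of the lower bound
      \<open>2 * L^3\<close> for the negative term when \<open>w \<ge> L / 2\<close>.\<close>
    obtain s2 where s2: "s2 \<in> I" "\<And>t. t \<in> I \<Longrightarrow> s2 \<le> t \<Longrightarrow> A t < L^3 / (64 * M\<^sup>2)"
      using A_late[of "L^3 / (64 * M\<^sup>2)"] L M by auto
    show ?thesis
    proof (rule I_bounded[of "max s1 s2" "2 * L^3 / (M * M)\<^sup>2" A A'])
      fix t assume t: "t \<in> I" "max s1 s2 \<le> t"
      note p = pos[OF t(1)] and b = bnd[OF t(1)]
      have "(A t - w t)\<^sup>2 \<le> (8 * M)\<^sup>2"
        using b w[OF t(1)] p by (intro power2_le_iff_abs_le[THEN iffD2]) (auto simp: abs_if)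
      then have "A t * (A t - w t)\<^sup>2 \<le> L^3 / (64 * M\<^sup>2) * (8 * M)\<^sup>2"
        using s2(2)[OF t(1)] t p by (intro mult_mono) auto
      also have "\<dots> = L^3" using M by (simp add: power_mult_distrib)
      finally have 1: "A t * (A t - w t)\<^sup>2 \<le> L^3" .
      have "\<bar>w t - L\<bar> < L / 2" using s1(2)[OF t(1)] t(2) by simp
      then have "L / 2 \<le> w t" by linarith
      then have "4 * (L / 2) * L\<^sup>2 \<le> 4 * w t * (A t + S t)\<^sup>2"
        using SL[OF t(1)] L p by (intro mult_mono power_mono) auto
      then have "2 * (A t * (A t - w t)\<^sup>2 - 4 * w t * (A t + S t)\<^sup>2) \<le> - (2 * L^3)"
        using 1 by (simp add: power3_eq_cube power2_eq_square)
      then have "A' t \<le> - (2 * L^3) / (B t * C t)\<^sup>2" unfolding A'_def by (intro divide_right_mono) auto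
      moreover have "2 * L^3 / (M * M)\<^sup>2 \<le> 2 * L^3 / (B t * C t)\<^sup>2"
        using b p L by (intro divide_left_mono power_mono mult_mono) auto
      ultimately show "A' t \<le> - (2 * L^3 / (M * M)\<^sup>2)" by simp
    qed (use dA s1 s2 L M pos in \<open>auto simp: max_def less_imp_le\<close>)
  qed
  then obtain T where T: "T > 0" "I = {0..<T}" by blast
  have late: "(q \<longlongrightarrow> l) (at_left T)" if "\<And>e. e > 0 \<Longrightarrow> \<exists>s\<in>I. \<forall>t\<in>I. s \<le> t \<longrightarrow> \<bar>q t - l\<bar> < e" for q :: "real \<Rightarrow> real" and l
  proof (rule tendstoI)
    fix e :: real assume "e > 0"
    from that[OF this] obtain s where s: "s \<in> I" "\<forall>t\<in>I. s \<le> t \<longrightarrow> \<bar>q t - l\<bar> < e" by blast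
    have "s < T" using s T by simp
    then show "\<forall>\<^sub>F t in at_left T. dist (q t) l < e"
      using eventually_at_left_real[of s T] s T by (auto elim!: eventually_mono simp: dist_real_def)
  qed
  have ev: "\<forall>\<^sub>F t in at_left T. t \<in> {0<..<T}" using eventually_at_left_real[OF T(1)] .
  have at: "at t within I = at t" if "t \<in> {0<..<T}" for t
    using that at_within_interior[of t I] by (simp add: T)
  have A0: "(A \<longlongrightarrow> 0) (at_left T)"
    by (rule late) (use A_late pos in \<open>force\<close>)
  have SL': "(S \<longlongrightarrow> L) (at_left T)"
  proof (rule late)
    fix e :: real assume "e > 0"
    from S_late[OF this] obtain s where s: "s \<in> I" "\<forall>t\<in>I. s \<le> t \<longrightarrow> S t < L + e" by blast
    have "\<bar>S t - L\<bar> < e" if "t \<in> I" "s \<le> t" for t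
    proof -
      have "S t < L + e" using s that by blast
      then show ?thesis using SL[OF that(1)] by linarith
    qed
    then show "\<exists>s\<in>I. \<forall>t\<in>I. s \<le> t \<longrightarrow> \<bar>S t - L\<bar> < e" using s by blast
  qed
  have wL: "(w \<longlongrightarrow> L) (at_left T)" by (rule late[OF w_late])
  have E_eq: "sqrt (w t * A t) = B t - C t" if "t \<in> I" for t
    using wA[OF that] B_ge_C[OF that] by (metis diff_ge_0_iff_ge real_sqrt_unique)
  have E0: "((\<lambda>t. B t - C t) \<longlongrightarrow> 0) (at_left T)"
  proof (rule Lim_transform_eventually)
    show "((\<lambda>t. sqrt (w t * A t)) \<longlongrightarrow> 0) (at_left T)"
      using tendsto_real_sqrt[OF tendsto_mult[OF wL A0]] by simp
    show "\<forall>\<^sub>F t in at_left T. sqrt (w t * A t) = B t - C t"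
      using ev by eventually_elim (use E_eq T in auto)
  qed
  have BL: "(B \<longlongrightarrow> L / 2) (at_left T)" and CL: "(C \<longlongrightarrow> L / 2) (at_left T)"
    using tendsto_divide[OF tendsto_add[OF SL' E0] tendsto_const[of 2]]
      tendsto_divide[OF tendsto_diff[OF SL' E0] tendsto_const[of 2]] by (simp_all add: S_def)
  \<comment> \<open>At the limit \<open>A = 0\<close>, \<open>w = S = L\<close> and
    \<open>B = C = L / 2\<close>; the slope \<open>- 128 / L\<close> is
    \<open>- 64 / CT\<close>.\<close>
  have "(A' \<longlongrightarrow> 2 * (0 * (0 - L)\<^sup>2 - 4 * L * (0 + L)\<^sup>2) / (L / 2 * (L / 2))\<^sup>2) (at_left T)"
    unfolding A'_def using L by (intro tendsto_intros A0 wL SL' BL CL) auto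
  moreover have "2 * (0 * (0 - L)\<^sup>2 - 4 * L * (0 + L)\<^sup>2) / (L / 2 * (L / 2))\<^sup>2 = - (128 / L)"
    using L by (simp add: field_simps power2_eq_square)
  ultimately have A'L: "(A' \<longlongrightarrow> - (128 / L)) (at_left T)" by simp
  have "\<forall>\<^sub>F t in at_left T. (A has_real_derivative A' t) (at t)"
    using ev by eventually_elim (use dA T at in force)
  from quotient_tendsto_if_deriv_tendsto[OF A0 A'L this]
  have Aq: "((\<lambda>t. A t / (T - t)) \<longlongrightarrow> 128 / L) (at_left T)" by simp
  \<comment> \<open>A finite slope makes \<open>S - L\<close> of order \<open>T - t\<close>,
    negligible against the square root of \<open>T - t\<close>. So \<open>B\<close> and
    \<open>C\<close> deviate from \<open>L / 2\<close> by plus and minus half of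
    \<open>B - C\<close> to leading order.\<close>
  have S'L: "(S' \<longlongrightarrow> 2 * (L - 2 * L - 3 * 0) * (L * 0 + L * L + 2 * L * 0) / (L / 2 * (L / 2))\<^sup>2) (at_left T)"
    unfolding S'_def using L by (intro tendsto_intros A0 wL SL' BL CL) auto
  have dS': "\<forall>\<^sub>F t in at_left T. ((\<lambda>t. S t - L) has_real_derivative S' t) (at t)"
  proof (rule eventually_mono[OF ev])
    fix t assume t: "t \<in> {0<..<T}"
    then have "t \<in> I" by (simp add: T)
    from DERIV_diff[OF dS[OF this] DERIV_const, of L] show "((\<lambda>t. S t - L) has_real_derivative S' t) (at t)"
      by (simp add: at[OF t])
  qed
  have S0: "((\<lambda>t. S t - L) \<longlongrightarrow> 0) (at_left T)" using tendsto_diff[OF SL' tendsto_const[of L]] by simp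
  note Sq = quotient_tendsto_if_deriv_tendsto[OF S0 S'L dS']
  have sq0: "((\<lambda>t. sqrt (T - t)) \<longlongrightarrow> 0) (at_left T)"
    using tendsto_real_sqrt[OF tendsto_diff[OF tendsto_const tendsto_ident_at, of T T "{..<T}"]] by simp
  have Ss: "((\<lambda>t. (S t - L) / sqrt (T - t)) \<longlongrightarrow> 0) (at_left T)"
  proof (rule Lim_transform_eventually)
    show "((\<lambda>t. (S t - L) / (T - t) * sqrt (T - t)) \<longlongrightarrow> 0) (at_left T)"
      using tendsto_mult[OF Sq sq0] by simp
    show "\<forall>\<^sub>F t in at_left T. (S t - L) / (T - t) * sqrt (T - t) = (S t - L) / sqrt (T - t)"
    proof (rule eventually_mono[OF ev])
      fix t assume "t \<in> {0<..<T}"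
      then have "sqrt (T - t) * sqrt (T - t) = T - t" "sqrt (T - t) > 0" by auto
      moreover have "p / (r * r) * r = p / r" if "r > 0" for p r :: real using that by simp
      ultimately show "(S t - L) / (T - t) * sqrt (T - t) = (S t - L) / sqrt (T - t)" by metis
    qed
  qed
  have Es: "((\<lambda>t. (B t - C t) / sqrt (T - t)) \<longlongrightarrow> 8 * sqrt 2) (at_left T)"
  proof (rule Lim_transform_eventually)
    have "((\<lambda>t. sqrt (w t * (A t / (T - t)))) \<longlongrightarrow> sqrt (L * (128 / L))) (at_left T)"
      by (intro tendsto_real_sqrt tendsto_mult wL Aq)
    moreover have "sqrt (L * (128 / L)) = 8 * sqrt 2" using L real_sqrt_mult[of 64 2] by simp
    ultimately show "((\<lambda>t. sqrt (w t * (A t / (T - t)))) \<longlongrightarrow> 8 * sqrt 2) (at_left T)" by simp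
    show "\<forall>\<^sub>F t in at_left T. sqrt (w t * (A t / (T - t))) = (B t - C t) / sqrt (T - t)"
      using ev by eventually_elim (use E_eq T in \<open>simp add: real_sqrt_divide\<close>)
  qed
  define CT where "CT = L / 2"
  have sqrt2: "4 * sqrt (2 * (T - t)) = 4 * sqrt 2 * sqrt (T - t)" for t
    by (simp only: real_sqrt_mult mult.assoc)
  have halves: "((b + c - L) / s + (b - c) / s) / 2 = (b - CT) / s" "((b + c - L) / s - (b - c) / s) / 2 = (c - CT) / s"
    for b c s :: real
    by (simp_all add: CT_def field_simps flip: add_divide_distrib diff_divide_distrib)
  have "A \<sim>[at_left T] (\<lambda>t. 64 / CT * (T - t))"
    using Aq L by (intro asymp_equivI'_const) (auto simp: CT_def)
  moreover have "(\<lambda>t. B t - CT) \<sim>[at_left T] (\<lambda>t. 4 * sqrt (2 * (T - t)))"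
    unfolding sqrt2
  proof (rule asymp_equivI'_const)
    have "(\<lambda>t. ((S t - L) / sqrt (T - t) + (B t - C t) / sqrt (T - t)) / 2) = (\<lambda>t. (B t - CT) / sqrt (T - t))"
      by (simp add: S_def halves)
    with tendsto_divide[OF tendsto_add[OF Ss Es] tendsto_const[of 2]]
    show "((\<lambda>t. (B t - CT) / sqrt (T - t)) \<longlongrightarrow> 4 * sqrt 2) (at_left T)" by simp
  qed simp
  moreover have "(\<lambda>t. C t - CT) \<sim>[at_left T] (\<lambda>t. - 4 * sqrt (2 * (T - t)))"
  proof -
    have "(\<lambda>t. C t - CT) \<sim>[at_left T] (\<lambda>t. - (4 * sqrt 2) * sqrt (T - t))"
    proof (rule asymp_equivI'_const)
      have "(\<lambda>t. ((S t - L) / sqrt (T - t) - (B t - C t) / sqrt (T - t)) / 2) = (\<lambda>t. (C t - CT) / sqrt (T - t))"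
        by (simp add: S_def halves)
      with tendsto_divide[OF tendsto_diff[OF Ss Es] tendsto_const[of 2]]
      show "((\<lambda>t. (C t - CT) / sqrt (T - t)) \<longlongrightarrow> - (4 * sqrt 2)) (at_left T)" by simp
    qed simp
    moreover have "- (4 * sqrt 2) * sqrt (T - t) = - 4 * sqrt (2 * (T - t))" for t
      unfolding mult_minus_left sqrt2 ..
    ultimately show ?thesis by (simp only:)
  qed
  moreover have "(C \<longlongrightarrow> CT) (at_left T)" "CT > 0" using CL L by (auto simp: CT_def)
  ultimately show ?thesis using T by blast
qed

section \<open>From the regimes to the asymptotic statements\<close>

text \<open>The threshold is the nonnegative root of \<open>F1\<close> as a quadratic in
  \<open>A\<close>. Completing the square gives
  \<open>(3 * A + B + C)^2 + 3 * f1 = (B + C)^2 + 3 * (B - C)^2\<close>.\<close>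

lemma threshold_iff:
  assumes "t \<in> I"
  shows "A t < 1/3 * (2 * sqrt ((B t)\<^sup>2 - B t * C t + (C t)\<^sup>2) - B t - C t) \<longleftrightarrow> f1 t > 0"
proof -
  note p = pos[OF assms]
  have "2 * sqrt ((B t)\<^sup>2 - B t * C t + (C t)\<^sup>2) = sqrt ((B t + C t)\<^sup>2 + 3 * (B t - C t)\<^sup>2)"
  proof -
    have "(B t + C t)\<^sup>2 + 3 * (B t - C t)\<^sup>2 = 4 * ((B t)\<^sup>2 - B t * C t + (C t)\<^sup>2)" by algebra
    then show ?thesis by (simp only: real_sqrt_mult real_sqrt_four)
  qed
  then have "A t < 1/3 * (2 * sqrt ((B t)\<^sup>2 - B t * C t + (C t)\<^sup>2) - B t - C t)
      \<longleftrightarrow> 3 * A t + (B t + C t) < sqrt ((B t + C t)\<^sup>2 + 3 * (B t - C t)\<^sup>2)"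
    by auto
  also have "\<dots> \<longleftrightarrow> sqrt ((3 * A t + (B t + C t))\<^sup>2) < sqrt ((B t + C t)\<^sup>2 + 3 * (B t - C t)\<^sup>2)"
    using p by simp
  also have "\<dots> \<longleftrightarrow> (3 * A t + (B t + C t))\<^sup>2 < (B t + C t)\<^sup>2 + 3 * (B t - C t)\<^sup>2"
    by (rule real_sqrt_less_iff)
  also have "(B t + C t)\<^sup>2 + 3 * (B t - C t)\<^sup>2 = (3 * A t + (B t + C t))\<^sup>2 + 3 * f1 t"
    unfolding F1_def by algebra
  finally show ?thesis by simp
qed

lemma ode_at:
  assumes "I = {0..<T}" "0 < t" "t < T"
  shows "(A has_real_derivative 2 * A t * (f2 t * f3 t) / n t) (at t)"
    "(B has_real_derivative 2 * B t * (f3 t * f1 t) / n t) (at t)"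
    "(C has_real_derivative 2 * C t * (f1 t * f2 t) / n t) (at t)"
proof -
  have "at t within I = at t" using assms at_within_interior[of t I] by simp
  moreover have "t \<in> I" using assms by simp
  ultimately show "(A has_real_derivative 2 * A t * (f2 t * f3 t) / n t) (at t)"
    "(B has_real_derivative 2 * B t * (f3 t * f1 t) / n t) (at t)"
    "(C has_real_derivative 2 * C t * (f1 t * f2 t) / n t) (at t)"
    using deriv[of t] by simp_all
qed

text \<open>Each monomial is at most 3 times \<open>x * y\<close> or \<open>x * z\<close>; two are
  charged to \<open>x * y\<close> and three to \<open>x * z\<close>, whence 9. This supplies the
  constant \<open>K\<close> of \<open>terminal_asymptotics\<close>.\<close>

lemma terminal_bounds:
  fixes x y z :: real
  assumes "0 < x" "0 < y" "0 < z" "y \<le> x" "z \<le> x" 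
    and F: "\<bar>c1\<bar> \<le> 3" "\<bar>c2\<bar> \<le> 3" "\<bar>c3\<bar> \<le> 3" "\<bar>c4\<bar> \<le> 3" "\<bar>c5\<bar> \<le> 3"
  shows "\<bar>c1 * y\<^sup>2 + c2 * z\<^sup>2 + c3 * (y * z) + c4 * (x * z) + c5 * (x * y)\<bar> \<le> 9 * x * (y + z)"
proof -
  have b: "\<bar>c * (u * v)\<bar> \<le> 3 * (x * v)" if "\<bar>c\<bar> \<le> 3" "0 < u" "u \<le> x" "0 < v" for c u v
    unfolding abs_mult using that by (intro mult_mono) auto
  have "\<bar>c1 * (y * y)\<bar> \<le> 3 * (x * y)" "\<bar>c2 * (z * z)\<bar> \<le> 3 * (x * z)" "\<bar>c3 * (y * z)\<bar> \<le> 3 * (x * z)"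
    "\<bar>c4 * (x * z)\<bar> \<le> 3 * (x * z)" "\<bar>c5 * (x * y)\<bar> \<le> 3 * (x * y)"
    using assms by (intro b; simp)+
  moreover have "0 \<le> x * y" using assms by simp
  ultimately show ?thesis
    unfolding power2_eq_square distrib_left mult.assoc abs_le_iff by auto
qed

lemma asymptotics1:
  assumes T: "T > 0" "I = {0..<T}" and "((\<lambda>t. B t / A t) \<longlongrightarrow> 0) (at_left T)" "((\<lambda>t. C t / A t) \<longlongrightarrow> 0) (at_left T)"
  shows "\<exists>\<eta>1>0. \<exists>\<eta>2>0. \<exists>\<eta>3>0.
          A \<sim>[at_left T] (\<lambda>t. \<eta>1 * (T - t) powr (-1/14)) \<and>
          B \<sim>[at_left T] (\<lambda>t. \<eta>2 * (T - t) powr (3/14)) \<and>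
          C \<sim>[at_left T] (\<lambda>t. \<eta>3 * (T - t) powr (3/14))"
proof (rule terminal_asymptotics[OF T(1), where P = f1 and Q = f2 and R = f3 and K = 9])
  fix t assume t: "0 < t" "t < T"
  then have tI: "t \<in> I" using T by simp
  show "0 < A t \<and> 0 < B t \<and> 0 < C t" using pos[OF tI] by simp
  show "(A has_real_derivative 2 * A t * (f2 t * f3 t) / n t) (at t)"
    "(B has_real_derivative 2 * B t * (f3 t * f1 t) / n t) (at t)"
    "(C has_real_derivative 2 * C t * (f1 t * f2 t) / n t) (at t)"
    using ode_at[OF T(2) t] by simp_all
  assume "B t \<le> A t" "C t \<le> A t"
  note b = terminal_bounds[OF pos(1)[OF tI] pos(2)[OF tI] pos(3)[OF tI] this]
  have "f1 t + 3 * (A t)\<^sup>2 = 1 * (B t)\<^sup>2 + 1 * (C t)\<^sup>2 + (-2) * (B t * C t) + (-2) * (A t * C t) + (-2) * (A t * B t)"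
    "f2 t - (A t)\<^sup>2 = (-3) * (B t)\<^sup>2 + 1 * (C t)\<^sup>2 + 2 * (B t * C t) + 2 * (A t * C t) + (-2) * (A t * B t)"
    "f3 t - (A t)\<^sup>2 = 1 * (B t)\<^sup>2 + (-3) * (C t)\<^sup>2 + 2 * (B t * C t) + (-2) * (A t * C t) + 2 * (A t * B t)"
    unfolding F1_def F2_def F3_def by algebra+
  then show "\<bar>f1 t + 3 * (A t)\<^sup>2\<bar> \<le> 9 * A t * (B t + C t) \<and> \<bar>f2 t - (A t)\<^sup>2\<bar> \<le> 9 * A t * (B t + C t) \<and>
    \<bar>f3 t - (A t)\<^sup>2\<bar> \<le> 9 * A t * (B t + C t)"
    by (simp only:) (intro conjI b; simp)
qed (use assms in auto)

text \<open>The roles of \<open>A\<close> and \<open>B\<close> are exchanged: here \<open>F2\<close>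
  has the coefficient -3 at the dominant square, while \<open>F1\<close> and \<open>F3\<close> have
  the coefficient 1.\<close>

lemma asymptotics2:
  assumes T: "T > 0" "I = {0..<T}" and "((\<lambda>t. A t / B t) \<longlongrightarrow> 0) (at_left T)" "((\<lambda>t. C t / B t) \<longlongrightarrow> 0) (at_left T)"
  shows "\<exists>\<eta>1>0. \<exists>\<eta>2>0. \<exists>\<eta>3>0.
          A \<sim>[at_left T] (\<lambda>t. \<eta>1 * (T - t) powr (3/14)) \<and>
          B \<sim>[at_left T] (\<lambda>t. \<eta>2 * (T - t) powr (-1/14)) \<and>
          C \<sim>[at_left T] (\<lambda>t. \<eta>3 * (T - t) powr (3/14))"
proof -
  have "\<exists>\<eta>2>0. \<exists>\<eta>1>0. \<exists>\<eta>3>0.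
          B \<sim>[at_left T] (\<lambda>t. \<eta>2 * (T - t) powr (-1/14)) \<and>
          A \<sim>[at_left T] (\<lambda>t. \<eta>1 * (T - t) powr (3/14)) \<and>
          C \<sim>[at_left T] (\<lambda>t. \<eta>3 * (T - t) powr (3/14))"
  proof (rule terminal_asymptotics[OF T(1), where P = f2 and Q = f1 and R = f3 and K = 9])
    fix t assume t: "0 < t" "t < T"
    then have tI: "t \<in> I" using T by simp
    show "0 < B t \<and> 0 < A t \<and> 0 < C t" using pos[OF tI] by simp
    show "(B has_real_derivative 2 * B t * (f1 t * f3 t) / (B t * A t * C t)\<^sup>2) (at t)"
      "(A has_real_derivative 2 * A t * (f3 t * f2 t) / (B t * A t * C t)\<^sup>2) (at t)"
      "(C has_real_derivative 2 * C t * (f2 t * f1 t) / (B t * A t * C t)\<^sup>2) (at t)"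
      using ode_at[OF T(2) t] by (simp_all only: mult.commute[of "f1 t"] mult.commute[of "f3 t" "f2 t"] mult.commute[of "B t" "A t"])
    assume "A t \<le> B t" "C t \<le> B t"
    note b = terminal_bounds[OF pos(2)[OF tI] pos(1)[OF tI] pos(3)[OF tI] this]
    have "f2 t + 3 * (B t)\<^sup>2 = 1 * (A t)\<^sup>2 + 1 * (C t)\<^sup>2 + 2 * (A t * C t) + 2 * (B t * C t) + (-2) * (B t * A t)"
      "f1 t - (B t)\<^sup>2 = (-3) * (A t)\<^sup>2 + 1 * (C t)\<^sup>2 + (-2) * (A t * C t) + (-2) * (B t * C t) + (-2) * (B t * A t)"
      "f3 t - (B t)\<^sup>2 = 1 * (A t)\<^sup>2 + (-3) * (C t)\<^sup>2 + (-2) * (A t * C t) + 2 * (B t * C t) + 2 * (B t * A t)"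
      unfolding F1_def F2_def F3_def by algebra+
    then show "\<bar>f2 t + 3 * (B t)\<^sup>2\<bar> \<le> 9 * B t * (A t + C t) \<and> \<bar>f1 t - (B t)\<^sup>2\<bar> \<le> 9 * B t * (A t + C t) \<and>
      \<bar>f3 t - (B t)\<^sup>2\<bar> \<le> 9 * B t * (A t + C t)"
      by (simp only:) (intro conjI b; simp)
  qed (use assms in auto)
  then show ?thesis by blast
qed

lemma finite_time: "\<exists>T>0. I = {0..<T}"
proof (cases "\<exists>t\<in>I. A t \<ge> B t - C t")
  case True
  then show ?thesis using regime1 by blast
next
  case no1: False
  show ?thesis
  proof (cases "\<exists>t\<in>I. f1 t > 0")
    case True
    then show ?thesis using regime2 by blast
  next
    case False
    then show ?thesis using regime3 no1 by (force simp: not_le not_less)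
  qed
qed

end

theorem theorem6p12:
  fixes f :: "3 \<Rightarrow> mat2" and A0 B0 C0 :: real
  assumes "sl2_frame f"
    and "A0 > 0" and "B0 > 0" and "C0 > 0" and "B0 \<ge> C0"
  shows "\<exists>(Tb::real) A B C. Tb > 0 \<and> maximal_positive_xcf f A0 B0 C0 A B C Tb \<and>
    ((\<exists>t\<in>{0..<Tb}. A t \<ge> B t - C t) \<longrightarrow>
       (\<exists>\<eta>1>0. \<exists>\<eta>2>0. \<exists>\<eta>3>0.
          A \<sim>[at_left Tb] (\<lambda>t. \<eta>1 * (Tb - t) powr (-1/14)) \<and>
          B \<sim>[at_left Tb] (\<lambda>t. \<eta>2 * (Tb - t) powr (3/14)) \<and>
          C \<sim>[at_left Tb] (\<lambda>t. \<eta>3 * (Tb - t) powr (3/14)))) \<and>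
    ((\<exists>t\<in>{0..<Tb}. A t < 1/3 * (2 * sqrt ((B t)\<^sup>2 - B t * C t + (C t)\<^sup>2) - B t - C t)) \<longrightarrow>
       (\<exists>\<eta>1>0. \<exists>\<eta>2>0. \<exists>\<eta>3>0.
          A \<sim>[at_left Tb] (\<lambda>t. \<eta>1 * (Tb - t) powr (3/14)) \<and>
          B \<sim>[at_left Tb] (\<lambda>t. \<eta>2 * (Tb - t) powr (-1/14)) \<and>
          C \<sim>[at_left Tb] (\<lambda>t. \<eta>3 * (Tb - t) powr (3/14)))) \<and>
    ((\<forall>t\<in>{0..<Tb}. 1/3 * (2 * sqrt ((B t)\<^sup>2 - B t * C t + (C t)\<^sup>2) - B t - C t) \<le> A t
          \<and> A t < B t - C t) \<longrightarrow>
       (\<exists>CT>0. (C \<longlongrightarrow> CT) (at_left Tb) \<and>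
          A \<sim>[at_left Tb] (\<lambda>t. 64 / CT * (Tb - t)) \<and>
          (\<lambda>t. B t - CT) \<sim>[at_left Tb] (\<lambda>t. 4 * sqrt (2 * (Tb - t))) \<and>
          (\<lambda>t. C t - CT) \<sim>[at_left Tb] (\<lambda>t. - 4 * sqrt (2 * (Tb - t)))))"
proof -
  obtain A B C I where I: "I = {0..} \<or> (\<exists>T>0. I = {0..<T})" and init: "A 0 = A0" "B 0 = B0" "C 0 = C0"
    and ode: "xcf_ode A B C I"
    and uniq: "\<And>A' B' C' T t. xcf_ode A' B' C' {0..<T} \<Longrightarrow> A' 0 = A0 \<Longrightarrow> B' 0 = B0 \<Longrightarrow> C' 0 = C0 \<Longrightarrow>
       t \<in> {0..<T} \<Longrightarrow> t \<in> I \<and> A' t = A t \<and> B' t = B t \<and> C' t = C t"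
    and escape: "\<And>T s m M. I = {0..<T} \<Longrightarrow> s \<in> I \<Longrightarrow> 0 < m \<Longrightarrow> \<exists>t\<in>I. s \<le> t \<and> \<not> {A t, B t, C t} \<subseteq> {m..M}"
    by (rule xcf_maximal_ode[OF assms(2-4)]) blast
  interpret xcf_flow A B C I
    by unfold_locales (use I ode init assms(5) escape in auto)
  obtain T where T: "T > 0" "I = {0..<T}" using finite_time by blast
  \<comment> \<open>Each regime lemma provides its own end point; it is determined by the interval
    \<open>I\<close>.\<close>
  have T_eq: "T' = T" if "I = {0..<T'}" "T' > 0" for T'
    using that T by (metis atLeastLessThan_inj(2))
  have maximal: "maximal_positive_xcf f A0 B0 C0 A B C T"
    unfolding maximal_positive_xcf_def positive_xcf_iff_ode[OF assms(1)]
  proof (intro conjI allI impI)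
    show "xcf_ode A B C {0..<T}" using ode T by simp
    fix A' B' C' T' assume sol: "xcf_ode A' B' C' {0..<T'} \<and> A' 0 = A0 \<and> B' 0 = B0 \<and> C' 0 = C0"
    then have *: "t \<in> I \<and> A' t = A t \<and> B' t = B t \<and> C' t = C t" if "t \<in> {0..<T'}" for t
      using uniq that by blast
    show "T' \<le> T"
    proof (rule ccontr)
      assume "\<not> T' \<le> T"
      then show False using *[of T] T by simp
    qed
    show "\<forall>t\<in>{0..<T'}. A' t = A t \<and> B' t = B t \<and> C' t = C t" using * by blast
  qed (use T init in auto)
  have case1: "\<exists>\<eta>1>0. \<exists>\<eta>2>0. \<exists>\<eta>3>0.
          A \<sim>[at_left T] (\<lambda>t. \<eta>1 * (T - t) powr (-1/14)) \<and>
          B \<sim>[at_left T] (\<lambda>t. \<eta>2 * (T - t) powr (3/14)) \<and>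
          C \<sim>[at_left T] (\<lambda>t. \<eta>3 * (T - t) powr (3/14))"
    if ex: "\<exists>t\<in>{0..<T}. A t \<ge> B t - C t"
  proof -
    from ex obtain t where "t \<in> I" "A t \<ge> B t - C t" using T by blast
    from regime1[OF this] obtain T' where T': "T' > 0" "I = {0..<T'}" "((\<lambda>t. B t / A t) \<longlongrightarrow> 0) (at_left T')"
      "((\<lambda>t. C t / A t) \<longlongrightarrow> 0) (at_left T')" by blast
    from asymptotics1[OF this] show ?thesis unfolding T_eq[OF T'(2,1)] .
  qed
  have case2: "\<exists>\<eta>1>0. \<exists>\<eta>2>0. \<exists>\<eta>3>0.
          A \<sim>[at_left T] (\<lambda>t. \<eta>1 * (T - t) powr (3/14)) \<and>
          B \<sim>[at_left T] (\<lambda>t. \<eta>2 * (T - t) powr (-1/14)) \<and>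
          C \<sim>[at_left T] (\<lambda>t. \<eta>3 * (T - t) powr (3/14))"
    if ex: "\<exists>t\<in>{0..<T}. A t < 1/3 * (2 * sqrt ((B t)\<^sup>2 - B t * C t + (C t)\<^sup>2) - B t - C t)"
  proof -
    from ex obtain t where t: "t \<in> I" "A t < 1/3 * (2 * sqrt ((B t)\<^sup>2 - B t * C t + (C t)\<^sup>2) - B t - C t)"
      using T by blast
    from regime2[OF t(1) threshold_iff[OF t(1), THEN iffD1, OF t(2)]] obtain T'
      where T': "T' > 0" "I = {0..<T'}" "((\<lambda>t. A t / B t) \<longlongrightarrow> 0) (at_left T')"
      "((\<lambda>t. C t / B t) \<longlongrightarrow> 0) (at_left T')" by blast
    from asymptotics2[OF this] show ?thesis unfolding T_eq[OF T'(2,1)] .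
  qed
  have case3: "\<exists>CT>0. (C \<longlongrightarrow> CT) (at_left T) \<and>
          A \<sim>[at_left T] (\<lambda>t. 64 / CT * (T - t)) \<and>
          (\<lambda>t. B t - CT) \<sim>[at_left T] (\<lambda>t. 4 * sqrt (2 * (T - t))) \<and>
          (\<lambda>t. C t - CT) \<sim>[at_left T] (\<lambda>t. - 4 * sqrt (2 * (T - t)))"
    if all: "\<forall>t\<in>{0..<T}. 1/3 * (2 * sqrt ((B t)\<^sup>2 - B t * C t + (C t)\<^sup>2) - B t - C t) \<le> A t \<and> A t < B t - C t"
  proof -
    have "f1 t \<le> 0" if "t \<in> I" for t
    proof -
      have "\<not> A t < 1/3 * (2 * sqrt ((B t)\<^sup>2 - B t * C t + (C t)\<^sup>2) - B t - C t)"
        using all that unfolding T by (simp add: not_less)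
      then show ?thesis unfolding threshold_iff[OF that] by simp
    qed
    moreover have "A t < B t - C t" if "t \<in> I" for t using all that unfolding T by blast
    ultimately obtain T' where T': "T' > 0" "I = {0..<T'}" and *: "\<exists>CT>0. (C \<longlongrightarrow> CT) (at_left T') \<and>
          A \<sim>[at_left T'] (\<lambda>t. 64 / CT * (T' - t)) \<and>
          (\<lambda>t. B t - CT) \<sim>[at_left T'] (\<lambda>t. 4 * sqrt (2 * (T' - t))) \<and>
          (\<lambda>t. C t - CT) \<sim>[at_left T'] (\<lambda>t. - 4 * sqrt (2 * (T' - t)))"
      using regime3 by blast
    from * show ?thesis unfolding T_eq[OF T'(2,1)] .
  qed
  show ?thesis
    by (rule exI[of _ T], rule exI[of _ A], rule exI[of _ B], rule exI[of _ C], intro conjI impI)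
      (fact T(1) maximal | erule case1 case2 case3)+
qed

end
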